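(* Let $k\ge2$ be an odd integer, let $C$ be an extremal Type II code of length $24$ over $\mathbb{Z}_{2k}$, and let $i\in\{1,\dots,24\}$. Then $$\frac{\eta(q^2)^{48}}{\eta(q)^{24}\eta(q^4)^{24}}-24=q^{-1}\,\frac12\sum_{c\in C}(-1)^{\tau_i(c)}\,\mathrm{ch}(M(c))+\frac12\,\frac{\eta(q)^{24}}{\eta(q^2)^{24}}.$$
   Context: $\mathbb{Z}_n=\mathbb{Z}/n\mathbb{Z}$. $\eta(q)=q^{1/24}\prod_{n\ge1}(1-q^n)$. A code of length $n$ over $\mathbb{Z}_{2k}$ is a $\mathbb{Z}_{2k}$-submodule of $\mathbb{Z}_{2k}^n$. The Euclidean weight of $(\bar m_1,\dots,\bar m_n)$ with $-k<m_j\le k$ is $\sum m_j^2$. A Type II code is a self-dual code (for the standard inner product) all of whose codewords have Euclidean weight divisible by $4k$; an extremal Type II code of length 24 is a Type II code of length 24 with minimum (nonzero) Euclidean weight $8k$. $\tau_i:\mathbb{Z}_{2k}^{24}\to\mathbb{Z}_2$ is the projection to the $i$-th coordinate followed by the canonical map $\mathbb{Z}_{2k}\to\mathbb{Z}_2$. For $c=(\bar c_1,\dots,\bar c_{24})\in\mathbb{Z}_{2k}^{24}$, $M(c)=\bigotimes_{j=1}^{24}V_{c_j\alpha/2k+L}$, where $L=\mathbb{Z}\alpha$, $\langle\alpha,\alpha\rangle=2k$, and $V_{\lambda+L}$ ($\lambda\in\mathbb{Z}\frac{\alpha}{2k}$) is the irreducible module for the lattice VOA $V_L$ attached to the coset $\lambda+L$;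 $\mathrm{ch}$ denotes the graded dimension with respect to conformal weight ($\sum_n\dim(\cdot)_nq^n$), so $\mathrm{ch}(M(c))=\prod_{j=1}^{24}\mathrm{ch}(V_{c_j\alpha/2k+L})$ with $\mathrm{ch}(V_{r\alpha/2k+L})=\frac{1}{\phi(q)}\sum_{n\in\mathbb{Z}}q^{k(n+r/2k)^2}$, $\phi(q)=\prod_{n\ge1}(1-q^n)$. *)

theory Defs
  imports
    "HOL-Analysis.Analysis"
    "HOL-Library.Multiset"
    "HOL-Library.FuncSet"
    "HOL-Library.Function_Algebras"
    "HOL-Algebra.Module"
    "HOL-Number_Theory.Residues"
begin

section \<open>Codes over the integers modulo \<open>2k\<close>\<close>

text \<open>
  The ring of integers modulo \<open>m\<close> is \<open>residue_ring m\<close>, with carrier \<open>{0..m - 1}\<close>.  Elements of its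
  \<open>n\<close>-th power are functions on the coordinate set \<open>{1..n}\<close>, extended by \<open>undefined\<close>.
  The multiplicative fields of the module record play no role.
\<close>

definition residue_module :: "int \<Rightarrow> nat \<Rightarrow> (int, nat \<Rightarrow> int) module" where
  "residue_module m n =
     \<lparr> carrier = (\<Pi>\<^sub>E j\<in>{1..n}. carrier (residue_ring m)),
       monoid.mult = (\<lambda>x y. \<lambda>j\<in>{1..n}. x j \<otimes>\<^bsub>residue_ring m\<^esub> y j),
       one = (\<lambda>j\<in>{1..n}. \<one>\<^bsub>residue_ring m\<^esub>),
       zero = (\<lambda>j\<in>{1..n}. \<zero>\<^bsub>residue_ring m\<^esub>),
       add = (\<lambda>x y. \<lambda>j\<in>{1..n}. x j \<oplus>\<^bsub>residue_ring m\<^esub> y j),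
       smult = (\<lambda>a x. \<lambda>j\<in>{1..n}. a \<otimes>\<^bsub>residue_ring m\<^esub> x j) \<rparr>"

definition is_code :: "int \<Rightarrow> nat \<Rightarrow> (nat \<Rightarrow> int) set \<Rightarrow> bool" where
  "is_code k n C \<longleftrightarrow> submodule C (residue_ring (2 * k)) (residue_module (2 * k) n)"

definition dual_code :: "int \<Rightarrow> nat \<Rightarrow> (nat \<Rightarrow> int) set \<Rightarrow> (nat \<Rightarrow> int) set" where
  "dual_code k n C = {y \<in> carrier (residue_module (2 * k) n).
     \<forall>x\<in>C. [(\<Sum>j\<in>{1..n}. x j * y j) = 0] (mod 2 * k)}"

definition self_dual_code :: "int \<Rightarrow> nat \<Rightarrow> (nat \<Rightarrow> int) set \<Rightarrow> bool" where
  "self_dual_code k n C \<longleftrightarrow> is_code k n C \<and> dual_code k n C = C"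

definition centred_rep :: "int \<Rightarrow> int \<Rightarrow> int" where
  "centred_rep k a = (THE m. - k < m \<and> m \<le> k \<and> [m = a] (mod 2 * k))"

definition euclidean_weight :: "int \<Rightarrow> nat \<Rightarrow> (nat \<Rightarrow> int) \<Rightarrow> int" where
  "euclidean_weight k n x = (\<Sum>j\<in>{1..n}. (centred_rep k (x j))\<^sup>2)"

definition type_II_code :: "int \<Rightarrow> nat \<Rightarrow> (nat \<Rightarrow> int) set \<Rightarrow> bool" where
  "type_II_code k n C \<longleftrightarrow>
     self_dual_code k n C \<and> (\<forall>x\<in>C. 4 * k dvd euclidean_weight k n x)"

definition min_euclidean_weight :: "int \<Rightarrow> nat \<Rightarrow> (nat \<Rightarrow> int) set \<Rightarrow> int" where
  "min_euclidean_weight k n C =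
     Min (euclidean_weight k n ` (C - {\<zero>\<^bsub>residue_module (2 * k) n\<^esub>}))"

definition extremal_type_II_code_24 :: "int \<Rightarrow> (nat \<Rightarrow> int) set \<Rightarrow> bool" where
  "extremal_type_II_code_24 k C \<longleftrightarrow>
     type_II_code k 24 C \<and> min_euclidean_weight k 24 C = 8 * k"

text \<open>
  The canonical map to the integers modulo 2 is well defined on residues modulo \<open>2k\<close>; its values
  are taken in \<open>{0, 1}\<close>, the carrier of \<open>residue_ring 2\<close>.
\<close>

definition tau :: "nat \<Rightarrow> (nat \<Rightarrow> int) \<Rightarrow> int" where
  "tau i c = c i mod 2"

section \<open>The graded modules\<close>

text \<open>
  Vector spaces are complex spaces of finitely supported functions on a set of basis labels,
  with pointwise addition and scalar multiplication \<open>fun_scale\<close>.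
\<close>

definition fun_scale :: "complex \<Rightarrow> ('b \<Rightarrow> complex) \<Rightarrow> 'b \<Rightarrow> complex" where
  "fun_scale a f = (\<lambda>b. a * f b)"

lemma vector_space_fun_scale: "vector_space fun_scale"
  by unfold_locales (simp_all add: fun_scale_def fun_eq_iff algebra_simps)

definition free_space :: "'b set \<Rightarrow> ('b \<Rightarrow> complex) set" where
  "free_space B = {f. finite {b. f b \<noteq> 0} \<and> {b. f b \<noteq> 0} \<subseteq> B}"

text \<open>
  Let \<open>L = \<int>\<alpha>\<close> with \<open>\<langle>\<alpha>,\<alpha>\<rangle> = 2k\<close> and \<open>\<lambda> = r\<alpha>/2k\<close>.  As a graded space, the irreducible
  \<open>V_L\<close>-module \<open>V_(\<lambda>+L)\<close> is \<open>S(t^(-1)\<h>[t^(-1)]) \<otimes> \<complex>[\<lambda>+L]\<close> with \<open>\<h> = \<complex>\<alpha>\<close>.  It has the basis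
  \<open>\<alpha>(-n_1) ... \<alpha>(-n_s) e^(x\<alpha>)\<close>, where \<open>{n_1, ..., n_s}\<close> is a multiset of positive integers and
  \<open>x\<alpha> \<in> \<lambda>+L\<close>; this basis vector is labelled \<open>({#n_1, ..., n_s#}, x)\<close> and is an eigenvector of
  \<open>L(0)\<close> with eigenvalue \<open>n_1 + ... + n_s + \<langle>x\<alpha>,x\<alpha>\<rangle>/2\<close>.
\<close>

type_synonym fock_label = "nat multiset \<times> real"

definition lattice_module :: "int \<Rightarrow> int \<Rightarrow> (fock_label \<Rightarrow> complex) set" where
  "lattice_module k r =
     free_space {(\<mu>, x). 0 \<notin># \<mu> \<and> x - real_of_int r / real_of_int (2 * k) \<in> \<int>}"

definition conformal_weight :: "int \<Rightarrow> fock_label \<Rightarrow> real" where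
  "conformal_weight k b = real (sum_mset (fst b)) + (real_of_int (2 * k) * (snd b)\<^sup>2) / 2"

text \<open>
  The tensor product of spaces of functions on label sets, realised inside the functions on
  label tuples: \<open>\<Otimes> f_j\<close> is the function \<open>(b_j) \<mapsto> \<Prod> f_j(b_j)\<close>.
\<close>

definition pure_tensor :: "nat set \<Rightarrow> (nat \<Rightarrow> 'b \<Rightarrow> complex) \<Rightarrow> (nat \<Rightarrow> 'b) \<Rightarrow> complex" where
  "pure_tensor J f = (\<lambda>b. if b \<in> extensional J then \<Prod>j\<in>J. f j (b j) else 0)"

definition tensor_space :: "nat set \<Rightarrow> (nat \<Rightarrow> ('b \<Rightarrow> complex) set) \<Rightarrow> ((nat \<Rightarrow> 'b) \<Rightarrow> complex) set" where
  "tensor_space J W = module.span fun_scale {pure_tensor J f | f. \<forall>j\<in>J. f j \<in> W j}"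

definition M_module :: "int \<Rightarrow> (nat \<Rightarrow> int) \<Rightarrow> ((nat \<Rightarrow> fock_label) \<Rightarrow> complex) set" where
  "M_module k c = tensor_space {1..24} (\<lambda>j. lattice_module k (c j))"

text \<open>
  On the tensor product \<open>L(0)\<close> acts as the sum of the operators \<open>L(0)\<close> of the 24 factors.
\<close>

definition L0 :: "int \<Rightarrow> ((nat \<Rightarrow> fock_label) \<Rightarrow> complex) \<Rightarrow> (nat \<Rightarrow> fock_label) \<Rightarrow> complex" where
  "L0 k v = (\<lambda>b. (\<Sum>j\<in>{1..24}. complex_of_real (conformal_weight k (b j))) * v b)"

definition weight_space :: "int \<Rightarrow> (nat \<Rightarrow> int) \<Rightarrow> real \<Rightarrow> ((nat \<Rightarrow> fock_label) \<Rightarrow> complex) set" where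
  "weight_space k c w = {v \<in> M_module k c. L0 k v = fun_scale (complex_of_real w) v}"

section \<open>The q-series\<close>

text \<open>
  Series in \<open>q\<close> are read as functions of a complex number \<open>q\<close> with \<open>0 < |q| < 1\<close>.  Fractional
  powers of \<open>q\<close> use the principal branch; the choice is immaterial where only 24th powers of
  \<open>eta\<close> and integral conformal weights occur.
\<close>

definition ch_M :: "int \<Rightarrow> (nat \<Rightarrow> int) \<Rightarrow> complex \<Rightarrow> complex" where
  "ch_M k c q =
     (\<Sum>\<^sub>\<infinity>w::real. of_nat (vector_space.dim fun_scale (weight_space k c w)) * q powr complex_of_real w)"

definition eta :: "complex \<Rightarrow> complex" where
  "eta q = q powr (1 / 24) * prodinf (\<lambda>n. 1 - q ^ Suc n)"

end

theory Submission
  imports Defs "HOL-Complex_Analysis.Complex_Analysis" "HOL-Probability.Probability"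
begin

text \<open>
  Let \<open>t\<close> be the point of the upper half-plane with \<open>q = exp (2 pi i t)\<close>.  Construction A turns the code into
  an even unimodular lattice \<open>\<Lambda> = {x / sqrt(2k) | x mod 2k \<in> C}\<close> without vectors of norm 2, and
  \<open>phi(q)^24\<close> times the sum over the code is the theta series of \<open>\<Lambda>\<close> twisted by the character
  \<open>x \<mapsto> (-1)^(x_i)\<close>.  By Poisson summation and the MacWilliams identity, this is a form of
  weight 12, invariant under \<open>t \<mapsto> t + 1\<close>, whose image under \<open>t \<mapsto> -1/t\<close> is the theta series of
  \<open>\<Lambda> + v/2\<close> with \<open>v = sqrt(2k) e_i\<close>; since \<open>k\<close> is odd, that image changes sign under \<open>t \<mapsto> t + 2\<close>.
  With \<open>x = theta_3^4\<close>, \<open>y = theta_4^4\<close>, \<open>z = theta_2^4\<close> at \<open>2t\<close>, the form \<open>y^3 (x^3 + z^3)\<close> has the same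
  behaviour, and both forms agree up to \<open>O(q^2)\<close> at one cusp and are \<open>O(q^(3/4))\<close> at the other.
  The product of the three conjugates of their difference, divided by \<open>Delta^3\<close>, has
  \<open>SL_2(Z)\<close>-invariant modulus and vanishes at the cusp, hence is zero by the maximum principle.
  The eta quotients of the claim come from \<open>x = y + z\<close> and the triple product identity.
\<close>

section \<open>Theta series and Poisson summation\<close>

text \<open>The twisted series is a form, with a sign character, only on a subgroup of index 3 in
  SL_2(Z). Its conjugates are the form \<open>a\<close> itself, the image \<open>b\<close> under
  inversion, and \<open>b (t + 1)\<close>, which is why a product of three is taken. The count that
  makes the argument work is 2 + 3/4 + 3/4 = 7/2, which exceeds 3, the order in q of the cube of
  \<open>Delta\<close>. The order 3/4 is what extremality contributes at the second cusp: oddness of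
  \<open>k\<close> alone forces the orders there to be odd multiples of 1/4, and 2 + 1/4 + 1/4 would
  fall short of 3. Since \<open>b\<close> changes sign under translation by 2, the product is
  invariant only up to sign; the maximum principle needs no more than its modulus. The comparison
  form is not guessed: it is the claimed identity multiplied by \<open>2 * q * phi(q)^24\<close> and
  rewritten in theta constants.\<close>

lemma infsum_dominated_tendsto:
  fixes f :: "nat \<Rightarrow> 'a \<Rightarrow> 'b::banach"
  assumes lim: "\<And>x. x \<in> A \<Longrightarrow> (\<lambda>n. f n x) \<longlonglongrightarrow> g x"
    and bound: "\<And>n x. x \<in> A \<Longrightarrow> norm (f n x) \<le> h x"
    and h: "h summable_on A"
  shows "(\<lambda>n. infsum (f n) A) \<longlonglongrightarrow> infsum g A"
proof (rule swap_uniform_limit'[where G = sequentially and F = "finite_subsets_at_top A"])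
  show "\<forall>\<^sub>F X in finite_subsets_at_top A. ((\<lambda>n. \<Sum>x\<in>X. f n x) \<longlongrightarrow> (\<Sum>x\<in>X. g x)) sequentially"
    by (rule eventually_finite_subsets_at_top_weakI) (intro tendsto_sum lim, auto)
  show "uniform_limit UNIV (\<lambda>X n. \<Sum>x\<in>X. f n x) (\<lambda>n. infsum (f n) A) (finite_subsets_at_top A)"
    by (rule Weierstrass_m_test_general[OF _ h]) (use bound in auto)
  have gb: "norm (g x) \<le> h x" if "x \<in> A" for x
    by (rule Lim_norm_ubound[OF _ lim[OF that]]) (use bound that in auto)
  have "g abs_summable_on A"
    by (rule summable_on_comparison_test[OF h gb]) auto
  then have "g summable_on A" by (rule abs_summable_summable)
  then show "((\<lambda>X. \<Sum>x\<in>X. g x) \<longlongrightarrow> infsum g A) (finite_subsets_at_top A)"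
    by (rule infsum_tendsto)
qed auto

text \<open>Locally uniform limits of holomorphic functions are holomorphic, here along the filter
  of finite subsets. The majorant may depend on the point \<open>z0\<close>, because theta series
  have no single majorant on the whole half-plane.\<close>

lemma holomorphic_on_infsum:
  fixes f :: "'a \<Rightarrow> complex \<Rightarrow> complex"
  assumes S: "open S"
    and hol: "\<And>x. x \<in> A \<Longrightarrow> f x holomorphic_on S"
    and bound: "\<And>z0. z0 \<in> S \<Longrightarrow> \<exists>r>0. \<exists>h. h summable_on A \<and> (\<forall>x\<in>A. \<forall>z\<in>cball z0 r \<inter> S. norm (f x z) \<le> h x)"
  shows "(\<lambda>z. infsum (\<lambda>x. f x z) A) holomorphic_on S"
proof -
  have "\<exists>d>0. (\<lambda>z. infsum (\<lambda>x. f x z) A) holomorphic_on ball z0 d" if z0: "z0 \<in> S" for z0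
  proof -
    obtain r h where r: "r > 0" and h: "h summable_on A"
      and b: "\<And>x z. x \<in> A \<Longrightarrow> z \<in> cball z0 r \<inter> S \<Longrightarrow> norm (f x z) \<le> h x"
      using bound[OF z0] by metis
    obtain e where e: "e > 0" "cball z0 e \<subseteq> S" using S z0 open_contains_cball by metis
    define d where "d = min r e"
    have d: "d > 0" "cball z0 d \<subseteq> S" "cball z0 d \<subseteq> cball z0 r \<inter> S" using r e by (auto simp: d_def)
    have u: "uniform_limit (cball z0 d) (\<lambda>X z. \<Sum>x\<in>X. f x z) (\<lambda>z. infsum (\<lambda>x. f x z) A) (finite_subsets_at_top A)"
      by (rule Weierstrass_m_test_general[OF _ h]) (use b d(3) in blast)
    have sum_hol: "(\<lambda>z. \<Sum>x\<in>X. f x z) holomorphic_on S" if "X \<subseteq> A" for X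
      using that hol by (intro holomorphic_on_sum) auto
    have c: "\<forall>\<^sub>F X in finite_subsets_at_top A. continuous_on (cball z0 d) (\<lambda>z. \<Sum>x\<in>X. f x z) \<and>
        (\<lambda>z. \<Sum>x\<in>X. f x z) holomorphic_on ball z0 d"
      by (rule eventually_finite_subsets_at_top_weakI)
         (intro conjI holomorphic_on_imp_continuous_on holomorphic_on_subset[OF sum_hol] d(2) order_trans[OF ball_subset_cball d(2)])
    have "(\<lambda>z. infsum (\<lambda>x. f x z) A) holomorphic_on ball z0 d"
      by (rule holomorphic_uniform_limit[OF c u, THEN conjunct2]) auto
    then show ?thesis using d by auto
  qed
  then have "(\<lambda>z. infsum (\<lambda>x. f x z) A) analytic_on S"
    by (auto simp: analytic_on_def)
  then show ?thesis using analytic_imp_holomorphic by blast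
qed

section \<open>Gaussian sums and theta functions with characteristics\<close>

lemma summable_on_int_exp_abs: "(\<lambda>n::int. exp (- \<bar>real_of_int n\<bar>)) summable_on UNIV"
proof -
  have s: "summable (\<lambda>n. exp (-1::real) ^ n)" by (rule summable_geometric) auto
  have 1: "(\<lambda>n::nat. exp (- real n)) summable_on UNIV"
    by (rule summable_nonneg_imp_summable_on)
       (use s in \<open>auto simp: exp_of_nat_mult[symmetric]\<close>)
  have "(\<lambda>n::int. exp (- \<bar>real_of_int n\<bar>)) summable_on {0..}"
    by (rule summable_on_reindex_bij_witness[where S = "UNIV::nat set" and i = nat and j = int and g = "\<lambda>n. exp (- real n)", THEN iffD1]) (use 1 in auto)
  moreover have "(\<lambda>n::int. exp (- \<bar>real_of_int n\<bar>)) summable_on {..0}"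
    by (rule summable_on_reindex_bij_witness[where S = "UNIV::nat set" and j = "\<lambda>n. - int n" and i = "\<lambda>n. nat (- n)" and g = "\<lambda>n. exp (- real n)", THEN iffD1]) (use 1 in auto)
  ultimately have "(\<lambda>n::int. exp (- \<bar>real_of_int n\<bar>)) summable_on ({0..} \<union> {..0})"
    by (rule summable_on_union)
  also have "{0..} \<union> {..0::int} = UNIV" by auto
  finally show ?thesis .
qed

lemma summable_on_int_gauss:
  assumes a: "a > 0"
  shows "(\<lambda>n::int. exp (- a * (real_of_int n)\<^sup>2 + b * \<bar>real_of_int n\<bar> + c)) summable_on UNIV"
proof -
  \<comment> \<open>The constant \<open>(b+1)\<^sup>2 / (4*a)\<close> is the maximum of
    \<open>- a * x\<^sup>2 + (b+1) * x\<close>; the spare \<open>- x\<close> leaves a geometric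
    majorant.\<close>
  have ineq: "- a * x\<^sup>2 + b * x + c \<le> (b+1)\<^sup>2 / (4*a) + c - x" for x :: real
  proof -
    have "0 \<le> (2*a*x - (b+1))\<^sup>2 / (4*a)" using a by simp
    also have "\<dots> = a * x\<^sup>2 - (b+1) * x + (b+1)\<^sup>2/(4*a)" using a by (simp add: power2_eq_square field_simps)
    finally show ?thesis by (simp add: algebra_simps)
  qed
  have "(\<lambda>n::int. exp ((b+1)\<^sup>2/(4*a)+c) * exp (- \<bar>real_of_int n\<bar>)) summable_on UNIV"
    by (intro summable_on_cmult_right summable_on_int_exp_abs)
  then show ?thesis
  proof (rule summable_on_comparison_test)
    fix n :: int
    show "exp (- a * (real_of_int n)\<^sup>2 + b * \<bar>real_of_int n\<bar> + c) \<le> exp ((b+1)\<^sup>2/(4*a)+c) * exp (- \<bar>real_of_int n\<bar>)"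
      using ineq[of "\<bar>real_of_int n\<bar>"] by (simp add: exp_add[symmetric])
  qed auto
qed

text \<open>The terms of Jacobi's theta function with characteristics, without the constant factor
  \<open>exp (2 pi i x y)\<close>. A complex \<open>x\<close> is allowed so that the Fourier
  argument can use holomorphy in \<open>x\<close>.\<close>

definition thterm :: "complex \<Rightarrow> complex \<Rightarrow> complex \<Rightarrow> int \<Rightarrow> complex" where
  "thterm x y t n = exp (of_real pi * \<i> * t * (of_int n + x)\<^sup>2 + 2 * of_real pi * \<i> * of_int n * y)"

definition theta :: "complex \<Rightarrow> complex \<Rightarrow> complex \<Rightarrow> complex" where
  "theta x y t = infsum (thterm x y t) UNIV"

text \<open>The bound depends only on a region containing \<open>t\<close>, \<open>x\<close> and
  \<open>y\<close>, so it serves as majorant both for holomorphy in \<open>t\<close> and for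
  holomorphy in \<open>x\<close>.\<close>

lemma norm_thterm_le:
  assumes "Im t \<ge> a" "norm t \<le> T" "norm x \<le> X" "norm y \<le> Y"
  shows "norm (thterm x y t n) \<le> exp (- (pi * a) * (real_of_int n)\<^sup>2 + (2 * pi * (T * X + Y)) * \<bar>real_of_int n\<bar> + pi * (T * X\<^sup>2))"
proof -
  have "Re (of_real pi * \<i> * t * (of_int n + x)\<^sup>2 + 2 * of_real pi * \<i> * of_int n * y)
      = - (pi * Im t * (of_int n)\<^sup>2) - 2 * pi * of_int n * (Im (t * x) + Im y) - pi * Im (t * x\<^sup>2)"
    by (simp add: power2_eq_square algebra_simps)
  also have "\<dots> \<le> - (pi * a * (of_int n)\<^sup>2) + 2 * pi * \<bar>of_int n\<bar> * (T * X + Y) + pi * (T * X\<^sup>2)"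
  proof -
    have T0: "T \<ge> 0" "X \<ge> 0" using assms norm_ge_zero order_trans by blast+
    have "norm (t * x) \<le> T * X" unfolding norm_mult by (rule mult_mono) (use assms T0 in auto)
    then have 1: "\<bar>Im (t * x) + Im y\<bar> \<le> T * X + Y"
      using abs_Im_le_cmod[of "t*x"] abs_Im_le_cmod[of y] assms by linarith
    have "norm (t * x\<^sup>2) \<le> T * X\<^sup>2" unfolding norm_mult norm_power
      by (rule mult_mono) (use assms T0 in \<open>auto intro: power_mono\<close>)
    then have "- Im (t * x\<^sup>2) \<le> T * X\<^sup>2" using abs_Im_le_cmod[of "t*x\<^sup>2"] by linarith
    then have "pi * (- Im (t * x\<^sup>2)) \<le> pi * (T * X\<^sup>2)" by (rule mult_left_mono) simp
    then have 2: "- pi * Im (t * x\<^sup>2) \<le> pi * (T * X\<^sup>2)" by linarith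
    have "\<bar>- 2 * pi * of_int n * (Im (t * x) + Im y)\<bar> \<le> 2 * pi * \<bar>of_int n\<bar> * (T * X + Y)"
      unfolding abs_mult using 1 by (intro mult_mono) auto
    moreover have "pi * a * (of_int n)\<^sup>2 \<le> pi * Im t * (of_int n)\<^sup>2"
      using assms by (intro mult_right_mono mult_left_mono) auto
    ultimately show ?thesis using 2 by linarith
  qed
  finally show ?thesis by (simp add: thterm_def norm_exp_eq_Re algebra_simps)
qed

lemma thterm_abs_summable: "Im t > 0 \<Longrightarrow> (\<lambda>n. norm (thterm x y t n)) summable_on UNIV"
  by (rule summable_on_comparison_test[OF summable_on_int_gauss[of "pi * Im t"]], simp,
      rule norm_thterm_le) auto

lemma thterm_summable: "Im t > 0 \<Longrightarrow> thterm x y t summable_on UNIV"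
  using abs_summable_summable thterm_abs_summable by blast

lemma theta_holomorphic: "(\<lambda>t. theta x y t) holomorphic_on {t. Im t > 0}"
  unfolding theta_def
proof (rule holomorphic_on_infsum)
  show "open {t. Im t > 0}" by (simp add: open_halfspace_Im_gt)
  show "(\<lambda>t. thterm x y t n) holomorphic_on {t. Im t > 0}" for n
    unfolding thterm_def by (intro holomorphic_intros)
  fix z0 :: complex assume z0: "z0 \<in> {t. Im t > 0}"
  define r where "r = Im z0 / 2"
  have *: "Im t \<ge> Im z0 / 2" "norm t \<le> norm z0 + r" if "t \<in> cball z0 r \<inter> {t. Im t > 0}" for t
  proof -
    have "norm (z0 - t) \<le> r" using that by (simp add: dist_norm)
    then have "\<bar>Im (z0 - t)\<bar> \<le> r" "\<bar>norm z0 - norm t\<bar> \<le> r"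
      using abs_Im_le_cmod[of "z0 - t"] norm_triangle_ineq3[of z0 t] by linarith+
    then show "Im t \<ge> Im z0 / 2" "norm t \<le> norm z0 + r" by (auto simp: r_def abs_if split: if_splits)
  qed
  show "\<exists>r>0. \<exists>h. h summable_on UNIV \<and> (\<forall>n\<in>UNIV. \<forall>t\<in>cball z0 r \<inter> {t. Im t > 0}. norm (thterm x y t n) \<le> h n)"
    by (rule exI[of _ r], intro conjI exI[of _ "\<lambda>n. exp (- (pi * (Im z0 / 2)) * (real_of_int n)\<^sup>2 + (2 * pi * ((norm z0 + r) * norm x + norm y)) * \<bar>real_of_int n\<bar> + pi * ((norm z0 + r) * (norm x)\<^sup>2))"]
        summable_on_int_gauss ballI norm_thterm_le *) (use z0 in \<open>auto simp: r_def\<close>)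
qed

lemma theta_holomorphic_char:
  assumes "Im t > 0"
  shows "(\<lambda>x. theta x y t) holomorphic_on UNIV"
  unfolding theta_def
proof (rule holomorphic_on_infsum)
  show "(\<lambda>x. thterm x y t n) holomorphic_on UNIV" for n
    unfolding thterm_def by (intro holomorphic_intros)
  fix z0 :: complex
  have *: "norm t \<le> norm z0 + 1" if "t \<in> cball z0 1 \<inter> UNIV" for t :: complex
  proof -
    have "norm (z0 - t) \<le> 1" using that by (simp add: dist_norm)
    then show ?thesis using norm_triangle_ineq3[of z0 t] by linarith
  qed
  show "\<exists>r>0. \<exists>h. h summable_on UNIV \<and> (\<forall>n\<in>UNIV. \<forall>x\<in>cball z0 r \<inter> UNIV. norm (thterm x y t n) \<le> h n)"
    by (rule exI[of _ 1], intro conjI exI[of _ "\<lambda>n. exp (- (pi * Im t) * (real_of_int n)\<^sup>2 + (2 * pi * (norm t * (norm z0 + 1) + norm y)) * \<bar>real_of_int n\<bar> + pi * (norm t * (norm z0 + 1)\<^sup>2))"]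
        summable_on_int_gauss ballI norm_thterm_le *) (use assms in auto)
qed auto

section \<open>Fourier series of entire functions of period 1\<close>

lemma exp_2pi_i_int: "exp (2 * of_real pi * \<i> * of_int m) = 1"
  using exp_integer_2pi[of "of_int m"] by (simp add: mult_ac)

text \<open>The quotient \<open>(P z - P 0) / (exp (2 * pi * \<i> * z) - 1)\<close> extends holomorphically,
  so that the partial sums of the Fourier series telescope up to two coefficients of the quotient.\<close>

lemma periodic_quotient:
  assumes P: "P holomorphic_on UNIV" and per: "\<And>z. P (z + 1) = P z"
  obtains K where "K holomorphic_on ball (1/2) 1"
    and "\<And>z. z \<in> ball (1/2) 1 \<Longrightarrow> P z = P 0 + K z * (exp (2 * of_real pi * \<i> * z) - 1)"
proof -
  \<comment> \<open>The disc of radius 1 about 1/2 contains the interval \<open>[0,1]\<close>, and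
    its only integers are 0 and 1. There the denominator has simple zeros and the numerator vanishes
    by periodicity, so the value assigned is the limit.\<close>
  define K where "K = (\<lambda>z. if z \<in> {0,1} then deriv P z / (2 * of_real pi * \<i>)
      else (P z - P 0) / (exp (2 * of_real pi * \<i> * z) - 1))"
  have nz: "exp (2 * of_real pi * \<i> * z) \<noteq> 1" if z: "z \<in> ball (1/2) 1 - {0,1}" for z
  proof
    assume "exp (2 * of_real pi * \<i> * z) = 1"
    then obtain n :: int where "Im (2 * of_real pi * \<i> * z) = of_int (2 * n) * pi" "Re (2 * of_real pi * \<i> * z) = 0"
      unfolding exp_eq_1 by auto
    then have zn: "z = of_int n" by (auto simp: complex_eq_iff)
    have "norm (z - 1/2) < 1" using z by (simp add: dist_norm norm_minus_commute)
    then have "\<bar>real_of_int n - 1/2\<bar> < 1" unfolding zn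
    proof -
      have "(of_int n - 1 / 2 :: complex) = of_real (real_of_int n - 1/2)" by simp
      then show "norm (of_int n - 1 / 2 :: complex) < 1 \<Longrightarrow> \<bar>real_of_int n - 1/2\<bar> < 1" by (metis norm_of_real)
    qed
    then have "n = 0 \<or> n = 1" by (auto simp: abs_if split: if_splits)
    then show False using z zn by auto
  qed
  have P01: "P a = P 0" if "a \<in> {0,1}" for a using per[of 0] that by auto
  have lim: "(K \<longlongrightarrow> K a) (at a within ball (1/2) 1)" if a: "a \<in> {0,1}" for a
  proof -
    have e1: "exp (2 * of_real pi * \<i> * a) = 1" using a exp_2pi_i_int[of 0] exp_2pi_i_int[of 1] by auto
    have 1: "((\<lambda>z. (P z - P a) / (z - a)) \<longlongrightarrow> deriv P a) (at a)"
      using holomorphic_derivI[OF P open_UNIV UNIV_I] by (simp add: has_field_derivative_iff)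
    have "((\<lambda>z. exp (2 * of_real pi * \<i> * z)) has_field_derivative (2 * of_real pi * \<i>)) (at a)"
      by (rule derivative_eq_intros refl)+ (simp add: e1)
    then have 2: "((\<lambda>z. (exp (2 * of_real pi * \<i> * z) - 1) / (z - a)) \<longlongrightarrow> 2 * of_real pi * \<i>) (at a)"
      by (simp add: has_field_derivative_iff e1)
    have 3: "((\<lambda>z. ((P z - P a) / (z - a)) / ((exp (2 * of_real pi * \<i> * z) - 1) / (z - a))) \<longlongrightarrow> deriv P a / (2 * of_real pi * \<i>)) (at a)"
      by (rule tendsto_divide[OF 1 2]) auto
    have "\<forall>\<^sub>F z in at a. z \<in> ball a (1/2)" by (rule eventually_at_in_open') auto
    moreover have "\<forall>\<^sub>F z in at a. z \<noteq> a" by (rule eventually_neq_at_within)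
    ultimately have ev: "\<forall>\<^sub>F z in at a. K z = ((P z - P a) / (z - a)) / ((exp (2 * of_real pi * \<i> * z) - 1) / (z - a))"
    proof eventually_elim
      case (elim z)
      have "z \<notin> {0,1}" using a elim by (auto simp: dist_norm)
      then show ?case using elim P01[OF a] by (auto simp: K_def)
    qed
    have "(K \<longlongrightarrow> K a) (at a)"
      by (subst tendsto_cong[OF ev]) (use 3 a in \<open>auto simp: K_def\<close>)
    then show ?thesis by (rule tendsto_within_subset) auto
  qed
  have h: "K holomorphic_on ball (1/2) 1"
  proof (rule no_isolated_singularity'[where K = "{0,1}"])
    have "(\<lambda>z. (P z - P 0) / (exp (2 * of_real pi * \<i> * z) - 1)) holomorphic_on ball (1/2) 1 - {0,1}"
      by (intro holomorphic_intros holomorphic_on_subset[OF P]) (use nz in auto)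
    then show "K holomorphic_on ball (1/2) 1 - {0,1}"
      by (rule holomorphic_transform) (auto simp: K_def)
  qed (use lim in auto)
  show thesis
  proof (rule that[OF h])
    fix z :: complex assume z: "z \<in> ball (1/2) 1"
    show "P z = P 0 + K z * (exp (2 * of_real pi * \<i> * z) - 1)"
    proof (cases "z \<in> {0,1}")
      case True
      then show ?thesis using P01[OF True] exp_2pi_i_int[of 0] exp_2pi_i_int[of 1] by auto
    next
      case False
      then show ?thesis using nz[of z] z by (auto simp: K_def)
    qed
  qed
qed

definition fourier_coeff :: "(complex \<Rightarrow> complex) \<Rightarrow> int \<Rightarrow> complex" where
  "fourier_coeff f m = integral {0..1} (\<lambda>x::real. f (of_real x) * exp (- (2 * of_real pi * \<i> * of_int m * of_real x)))"

lemma unit_interval_in_ball: "x \<in> {0..1} \<Longrightarrow> complex_of_real x \<in> ball (1/2) 1"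
proof -
  assume x: "x \<in> {0..1}"
  have "complex_of_real x - 1/2 = complex_of_real (x - 1/2)" by simp
  then have "norm (complex_of_real x - 1/2) = \<bar>x - 1/2\<bar>" by (metis norm_of_real)
  also have "\<dots> < 1" using x by auto
  finally show ?thesis by (simp add: dist_norm norm_minus_commute)
qed

lemma continuous_on_unit_interval:
  assumes "f holomorphic_on ball (1/2) 1"
  shows "continuous_on {0..1} (\<lambda>x. f (complex_of_real x))"
proof (rule continuous_on_compose2[OF holomorphic_on_imp_continuous_on[OF assms]])
  show "complex_of_real ` {0..1} \<subseteq> ball (1/2) 1" using unit_interval_in_ball by blast
qed (intro continuous_intros)

text \<open>One integration by parts, with boundary terms that are merely bounded. The order
  \<open>1 / \<bar>m\<bar>\<close> suffices because only two coefficients of \<open>K\<close>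
  survive the telescoping.\<close>

lemma fourier_coeff_bound:
  assumes K: "K holomorphic_on ball (1/2) 1"
  obtains M where "\<And>m. m \<noteq> 0 \<Longrightarrow> norm (fourier_coeff K m) \<le> M / \<bar>of_int m\<bar>"
proof -
  define B where "B = ball (1/2::complex) 1"
  have sub: "complex_of_real ` {0..1} \<subseteq> B" using unit_interval_in_ball by (auto simp: B_def)
  have dK: "deriv K holomorphic_on B" using K holomorphic_deriv B_def by blast
  have cK: "continuous_on {0..1} (\<lambda>x. K (complex_of_real x))" and cdK: "continuous_on {0..1} (\<lambda>x. deriv K (complex_of_real x))"
    using K dK by (auto intro: continuous_on_unit_interval simp: B_def)
  have "compact ((\<lambda>x. K (complex_of_real x)) ` {0..1})" "compact ((\<lambda>x. deriv K (complex_of_real x)) ` {0..1})"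
    by (intro compact_continuous_image cK cdK compact_Icc)+
  then have "bounded ((\<lambda>x. K (complex_of_real x)) ` {0..1})" "bounded ((\<lambda>x. deriv K (complex_of_real x)) ` {0..1})"
    by (auto intro: compact_imp_bounded)
  then obtain M1 M2 where M1: "\<And>x. x \<in> {0..1} \<Longrightarrow> norm (K (complex_of_real x)) \<le> M1"
    and M2: "\<And>x. x \<in> {0..1} \<Longrightarrow> norm (deriv K (complex_of_real x)) \<le> M2"
    unfolding bounded_iff by (metis imageI)
  have "norm (fourier_coeff K m) \<le> ((M1 + M1 + M2) / (2 * pi)) / \<bar>of_int m\<bar>" if m: "m \<noteq> 0" for m
  proof -
    define e where "e = (\<lambda>x::real. exp (- (2 * of_real pi * \<i> * of_int m * of_real x)))"
    have ne: "norm (e x) = 1" for x unfolding e_def by (simp add: norm_exp_eq_Re)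
    define w where "w = - (2 * of_real pi * \<i> * of_int m)"
    have w0: "w \<noteq> 0" using m by (simp add: w_def)
    have fc: "fourier_coeff K m = integral {0..1} (\<lambda>x. K (of_real x) * e x)"
      by (simp add: fourier_coeff_def e_def)
    have ee: "e x = exp (w * of_real x)" for x by (simp add: e_def w_def)
    have nw: "norm w = 2 * pi * \<bar>of_int m\<bar>" by (simp add: w_def norm_mult)
    have ce: "continuous_on A e" for A unfolding e_def by (intro continuous_intros)
    have I1: "((\<lambda>x. K (of_real x) * e x + deriv K (of_real x) * e x / w) has_integral
       K (of_real 1) * e 1 / w - K (of_real 0) * e 0 / w) {0..1}"
    proof (rule fundamental_theorem_of_calculus)
      fix x :: real assume x: "x \<in> {0..1}"
      have "(K has_field_derivative deriv K (of_real x)) (at (of_real x))"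
        using K unit_interval_in_ball[OF x] by (intro holomorphic_derivI[of _ "ball (1/2) 1"]) auto
      moreover have "((\<lambda>z. exp (w * z)) has_field_derivative w * exp (w * of_real x)) (at (of_real x))"
        by (rule derivative_eq_intros refl)+ simp
      ultimately have "((\<lambda>z. K z * exp (w * z) / w) has_field_derivative
          (K (of_real x) * (w * exp (w * of_real x)) + deriv K (of_real x) * exp (w * of_real x)) / w) (at (of_real x))"
        by (intro DERIV_cdivide DERIV_mult')
      then have "((\<lambda>x. K (of_real x) * exp (w * of_real x) / w) has_vector_derivative
           (K (of_real x) * (w * exp (w * of_real x)) + deriv K (of_real x) * exp (w * of_real x)) / w) (at x within {0..1})"
        by (rule has_vector_derivative_real_field[THEN has_vector_derivative_at_within])
      then show "((\<lambda>x. K (of_real x) * e x / w) has_vector_derivative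
           (K (of_real x) * e x + deriv K (of_real x) * e x / w)) (at x within {0..1})"
        using w0 by (simp add: ee add_divide_distrib)
    qed simp
    have i1: "(\<lambda>x. K (of_real x) * e x) integrable_on {0..1}"
      by (rule integrable_continuous_interval, rule continuous_on_mult[OF cK ce])
    have i2: "(\<lambda>x. deriv K (of_real x) * e x) integrable_on {0..1}"
      by (rule integrable_continuous_interval, rule continuous_on_mult[OF cdK ce])
    have "integral {0..1} (\<lambda>x. K (of_real x) * e x) + integral {0..1} (\<lambda>x. deriv K (of_real x) * e x) / w
       = K (of_real 1) * e 1 / w - K (of_real 0) * e 0 / w"
      using integral_unique[OF I1] i1 i2 by (subst (asm) integral_add) (auto simp: integrable_on_divide)
    then have "fourier_coeff K m = (K (of_real 1) * e 1 - K (of_real 0) * e 0 - integral {0..1} (\<lambda>x. deriv K (of_real x) * e x)) / w"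
      by (simp add: fc diff_divide_distrib eq_diff_eq)
    then have "norm (fourier_coeff K m) = norm (K (of_real 1) * e 1 - K (of_real 0) * e 0 - integral {0..1} (\<lambda>x. deriv K (of_real x) * e x)) / norm w"
      by (simp add: norm_divide)
    also have "\<dots> \<le> (M1 + M1 + M2) / norm w"
    proof (rule divide_right_mono)
      have 1: "norm (integral {0..1} (\<lambda>x. deriv K (of_real x) * e x)) \<le> M2 * (1 - 0)"
        by (rule integral_bound[OF _ continuous_on_mult[OF cdK ce]]) (use M2 ne in \<open>auto simp: norm_mult\<close>)
      have 2: "norm (K (complex_of_real 1) * e 1) \<le> M1" "norm (K (complex_of_real 0) * e 0) \<le> M1"
        using M1[of 0] M1[of 1] ne by (auto simp: norm_mult)
      have "norm (a - b - c) \<le> norm a + norm b + norm c" for a b c :: complex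
        using norm_triangle_ineq4[of a b] norm_triangle_ineq4[of "a - b" c] by linarith
      then show "norm (K (of_real 1) * e 1 - K (of_real 0) * e 0 - integral {0..1} (\<lambda>x. deriv K (of_real x) * e x)) \<le> M1 + M1 + M2"
        by (rule order_trans) (use 1 2 in simp)
    qed simp
    finally have "norm (fourier_coeff K m) \<le> (M1 + M1 + M2) / norm w" .
    then show ?thesis by (simp only: nw divide_divide_eq_left)
  qed
  then show thesis by (rule that)
qed

lemma integral_exp_int:
  "integral {0..1} (\<lambda>x::real. exp (- (2 * of_real pi * \<i> * of_int m * of_real x))) = (if m = 0 then 1 else 0)"
proof (cases "m = 0")
  case False
  define w where "w = - (2 * of_real pi * \<i> * of_int m)"
  have w0: "w \<noteq> 0" using False by (simp add: w_def)
  have "((\<lambda>x::real. exp (w * of_real x)) has_integral exp (w * of_real 1) / w - exp (w * of_real 0) / w) {0..1}"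
  proof (rule fundamental_theorem_of_calculus)
    fix x :: real
    have "((\<lambda>z. exp (w * z) / w) has_field_derivative exp (w * of_real x)) (at (of_real x))"
      using w0 by (auto intro!: derivative_eq_intros)
    then show "((\<lambda>x. exp (w * of_real x) / w) has_vector_derivative exp (w * of_real x)) (at x within {0..1})"
      by (rule has_vector_derivative_real_field[THEN has_vector_derivative_at_within])
  qed simp
  moreover have "exp w = 1" unfolding w_def using exp_2pi_i_int[of "- m"] by simp
  ultimately have "((\<lambda>x::real. exp (w * of_real x)) has_integral 0) {0..1}" by simp
  then show ?thesis using False by (simp add: w_def integral_unique)
qed simp

lemma fourier_series_at_0:
  assumes P: "P holomorphic_on UNIV" and per: "\<And>z. P (z + 1) = P z"
  shows "(\<lambda>N. \<Sum>m\<in>{- int N..int N}. fourier_coeff P m) \<longlonglongrightarrow> P 0"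
proof -
  obtain K where K: "K holomorphic_on ball (1/2) 1"
    and eq: "\<And>z. z \<in> ball (1/2) 1 \<Longrightarrow> P z = P 0 + K z * (exp (2 * of_real pi * \<i> * z) - 1)"
    using periodic_quotient[OF P per] by metis
  obtain M where M: "\<And>m. m \<noteq> 0 \<Longrightarrow> norm (fourier_coeff K m) \<le> M / \<bar>of_int m\<bar>"
    using fourier_coeff_bound[OF K] by metis
  define e where "e = (\<lambda>m x. exp (- (2 * of_real pi * \<i> * of_int m * complex_of_real x)))"
  have cK: "continuous_on {0..1} (\<lambda>x. K (complex_of_real x))"
    by (rule continuous_on_unit_interval[OF K])
  have ce: "continuous_on A (e m)" for A m unfolding e_def by (intro continuous_intros)
  \<comment> \<open>Multiplication by \<open>exp (2 pi i z)\<close> shifts the index of a Fourier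
    coefficient by one, so the coefficients of \<open>P - P 0\<close> are differences of consecutive
    coefficients of \<open>K\<close>.\<close>
  have c: "fourier_coeff P m = (if m = 0 then P 0 else 0) + (fourier_coeff K (m - 1) - fourier_coeff K m)" for m
  proof -
    have "fourier_coeff P m = integral {0..1} (\<lambda>x. P 0 * e m x + (K (of_real x) * e (m - 1) x - K (of_real x) * e m x))"
      unfolding fourier_coeff_def
    proof (rule integral_cong)
      fix x :: real assume x: "x \<in> {0..1}"
      have "e (m - 1) x = exp (2 * of_real pi * \<i> * of_real x) * e m x"
        by (simp add: e_def exp_add[symmetric] algebra_simps)
      moreover have fold_e: "exp (- (2 * of_real pi * \<i> * of_int m * of_real x)) = e m x"
        by (simp add: e_def)
      ultimately show "P (of_real x) * exp (- (2 * of_real pi * \<i> * of_int m * of_real x)) =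
         P 0 * e m x + (K (of_real x) * e (m - 1) x - K (of_real x) * e m x)"
        unfolding eq[OF unit_interval_in_ball[OF x]] fold_e by (simp add: algebra_simps)
    qed
    also have "\<dots> = P 0 * integral {0..1} (e m) + (integral {0..1} (\<lambda>x. K (of_real x) * e (m-1) x) - integral {0..1} (\<lambda>x. K (of_real x) * e m x))"
      by (subst integral_add, (intro integrable_continuous_interval continuous_intros cK ce)+,
          subst integral_diff, (intro integrable_continuous_interval continuous_intros cK ce)+) simp
    finally show ?thesis using integral_exp_int[of m] by (simp add: fourier_coeff_def e_def)
  qed
  have "(\<Sum>m\<in>{- int N..int N}. fourier_coeff P m) = P 0 + (fourier_coeff K (- int N - 1) - fourier_coeff K (int N))" for N
  proof (induction N)
    case 0 then show ?case by (simp add: c)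
  next
    case (Suc N)
    have "{- int N - 1..int N + 1} = insert (- int N - 1) (insert (int N + 1) {- int N..int N})" by auto
    moreover have "fourier_coeff P (- int N - 1) = fourier_coeff K (- int N - 2) - fourier_coeff K (- int N - 1)"
      "fourier_coeff P (int N + 1) = fourier_coeff K (int N) - fourier_coeff K (int N + 1)"
      using c[of "- int N - 1"] c[of "int N + 1"] by (simp_all add: diff_diff_eq)
    ultimately have "(\<Sum>m\<in>{- int N - 1..int N + 1}. fourier_coeff P m)
        = P 0 + (fourier_coeff K (- int N - 2) - fourier_coeff K (int N + 1))"
      using Suc by simp
    moreover have "- int (Suc N) = - int N - 1" "int (Suc N) = int N + 1" "- int N - 1 - 1 = - int N - 2" by auto
    ultimately show ?case by metis
  qed
  moreover have "(\<lambda>N. P 0 + (fourier_coeff K (- int N - 1) - fourier_coeff K (int N))) \<longlonglongrightarrow> P 0 + (0 - 0)"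
  proof (intro tendsto_intros)
    have l: "(\<lambda>N. M / real N) \<longlonglongrightarrow> 0" by (rule lim_const_over_n)
    show "(\<lambda>N. fourier_coeff K (int N)) \<longlonglongrightarrow> 0"
      by (rule Lim_null_comparison[OF _ l])
         (rule eventually_sequentiallyI[of 1], use M[of "int N" for N] in force)
    have l2: "(\<lambda>N. M / real (Suc N)) \<longlonglongrightarrow> 0" using LIMSEQ_Suc[OF l] .
    show "(\<lambda>N. fourier_coeff K (- int N - 1)) \<longlonglongrightarrow> 0"
    proof (rule Lim_null_comparison[OF _ l2])
      have "norm (fourier_coeff K (- int N - 1)) \<le> M / real (Suc N)" for N
        using M[of "- int N - 1"] by (simp add: abs_if algebra_simps)
      then show "\<forall>\<^sub>F N in sequentially. norm (fourier_coeff K (- int N - 1)) \<le> M / real (Suc N)" by simp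
    qed
  qed
  ultimately show ?thesis by simp
qed

section \<open>Poisson summation for the Gaussian\<close>

lemma filterlim_int_intervals:
  "filterlim (\<lambda>N. {- int N..int N}) (finite_subsets_at_top UNIV) sequentially"
proof (rule filterlim_finite_subsets_at_top[THEN iffD2], intro allI impI)
  fix X :: "int set" assume X: "finite X \<and> X \<subseteq> UNIV"
  define N0 where "N0 = nat (Max (insert 0 (abs ` X)))"
  have "\<bar>x\<bar> \<le> int N0" if "x \<in> X" for x
    using X that Max_ge[of "insert 0 (abs ` X)" "\<bar>x\<bar>"] by (auto simp: N0_def)
  then have "X \<subseteq> {- int N..int N}" if "N \<ge> N0" for N
    using that by (force simp: abs_le_iff)
  then show "\<forall>\<^sub>F N in sequentially. finite {- int N..int N} \<and> X \<subseteq> {- int N..int N} \<and> {- int N..int N} \<subseteq> UNIV"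
    by (auto intro!: eventually_sequentiallyI[of N0])
qed

lemma has_sum_int_tendsto:
  assumes "(f has_sum s) (UNIV :: int set)"
  shows "(\<lambda>N. \<Sum>n\<in>{- int N..int N}. f n) \<longlonglongrightarrow> s"
  by (rule filterlim_compose[OF assms[unfolded has_sum_def] filterlim_int_intervals])

text \<open>Both sides are the limit of the integrals of \<open>g\<close> over
  \<open>[-N, N+1]\<close>: the left by uniform convergence of the periodized sum on the unit
  interval, the right by dominated convergence on the line.\<close>

lemma integral_periodization:
  fixes g :: "real \<Rightarrow> complex"
  assumes cont: "continuous_on UNIV g" and int: "integrable lborel g"
    and bound: "\<And>n x. x \<in> {0..1} \<Longrightarrow> norm (g (x + of_int n)) \<le> h n"
    and h: "h summable_on (UNIV :: int set)"
  shows "integral {0..1} (\<lambda>x. \<Sum>\<^sub>\<infinity>n::int. g (x + of_int n)) = (LINT x|lborel. g x)"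
proof -
  have u: "uniform_limit {0..1} (\<lambda>X x. \<Sum>n\<in>X. g (x + of_int n)) (\<lambda>x. \<Sum>\<^sub>\<infinity>n::int. g (x + of_int n)) (finite_subsets_at_top UNIV)"
    by (rule Weierstrass_m_test_general[OF _ h]) (use bound in auto)
  have cs: "continuous_on {0..1} (\<lambda>x. g (x + of_int n))" for n :: int
    by (rule continuous_on_compose2[OF cont]) (auto intro!: continuous_intros)
  have io: "g integrable_on {a..b}" for a b
    by (rule integrable_continuous_interval[OF continuous_on_subset[OF cont]]) auto
  obtain I J where I: "\<And>X. ((\<lambda>x. \<Sum>n\<in>X. g (x + of_int n)) has_integral I X) {0..1}"
    and J: "((\<lambda>x. \<Sum>\<^sub>\<infinity>n::int. g (x + of_int n)) has_integral J) {0..1}"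
    and lim: "(I \<longlongrightarrow> J) (finite_subsets_at_top (UNIV :: int set))"
    by (rule uniform_limit_integral[OF u]) (auto intro!: continuous_on_sum cs)
  have shift: "integral {0..1} (\<lambda>x. g (x + of_int n)) = integral {of_int n..of_int n + 1} g" for n :: int
    using integral_shift_real_ivl[of "of_int n" "of_int n" "of_int n + 1" g] by simp
  have IX: "I X = (\<Sum>n\<in>X. integral {of_int n..of_int n + 1} g)" if "finite X" for X
  proof -
    have "I X = integral {0..1} (\<lambda>x. \<Sum>n\<in>X. g (x + of_int n))"
      by (rule integral_unique[OF I, symmetric])
    also have "\<dots> = (\<Sum>n\<in>X. integral {0..1} (\<lambda>x. g (x + of_int n)))"
      by (rule integral_sum[OF that]) (rule integrable_continuous_interval[OF cs])
    finally show ?thesis by (simp add: shift)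
  qed
  have chunk: "(\<Sum>n\<in>{- int N..int N}. integral {of_int n..of_int n + 1} g) = integral {- real N..real N + 1} g" for N
  proof (induction N)
    case (Suc N)
    have "{- int (Suc N)..int (Suc N)} = insert (- int N - 1) (insert (int N + 1) {- int N..int N})" by auto
    then have "(\<Sum>n\<in>{- int (Suc N)..int (Suc N)}. integral {of_int n..of_int n + 1} g)
       = integral {- real N - 1..- real N} g + (integral {real N + 1..real N + 1 + 1} g + integral {- real N..real N + 1} g)"
      using Suc by simp
    also have "integral {- real N - 1..- real N} g + (integral {real N + 1..real N + 1 + 1} g + integral {- real N..real N + 1} g)
      = integral {- real N - 1..real N + 1 + 1} g"
      using Henstock_Kurzweil_Integration.integral_combine[OF _ _ io, of "- real N" "real N + 1" "real N + 1 + 1"]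
        Henstock_Kurzweil_Integration.integral_combine[OF _ _ io, of "- real N - 1" "- real N" "real N + 1 + 1"]
      by (simp add: add.assoc[symmetric] add.commute)
    also have "{- real N - 1..real N + 1 + 1} = {- real (Suc N)..real (Suc N) + 1}" by auto
    finally show ?case .
  qed simp
  have "(\<lambda>N. I {- int N..int N}) \<longlonglongrightarrow> J"
    by (rule filterlim_compose[OF lim filterlim_int_intervals])
  then have l1: "(\<lambda>N. integral {- real N..real N + 1} g) \<longlonglongrightarrow> J"
    by (simp add: IX chunk)
  have l2: "(\<lambda>N. LINT x|lborel. indicator {- real N..real N + 1} x *\<^sub>R g x) \<longlonglongrightarrow> (LINT x|lborel. g x)"
  proof (rule integral_dominated_convergence[where w = "\<lambda>x. norm (g x)"])
    show "AE x in lborel. (\<lambda>N. indicator {- real N..real N + 1} x *\<^sub>R g x) \<longlonglongrightarrow> g x"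
    proof (rule AE_I2)
      fix x :: real
      obtain M where M: "\<bar>x\<bar> \<le> real M" using real_arch_simple by blast
      have "\<forall>\<^sub>F N in sequentially. indicator {- real N..real N + 1} x *\<^sub>R g x = g x"
        by (rule eventually_sequentiallyI[of M]) (use M in \<open>auto simp: indicator_def\<close>)
      then show "(\<lambda>N. indicator {- real N..real N + 1} x *\<^sub>R g x) \<longlonglongrightarrow> g x"
        by (rule tendsto_eventually)
    qed
    show "AE x in lborel. norm (indicator {- real N..real N + 1} x *\<^sub>R g x) \<le> norm (g x)" for N
      by (simp add: indicator_def)
    show "(\<lambda>x. indicator {- real N..real N + 1} x *\<^sub>R g x) \<in> borel_measurable lborel" for N
      using int by (intro borel_measurable_scaleR borel_measurable_indicator) auto
  qed (use int in auto)
  have "(LINT x|lborel. indicator {- real N..real N + 1} x *\<^sub>R g x) = integral {- real N..real N + 1} g" for N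
  proof -
    have "set_integrable lborel {- real N..real N + 1} g"
      unfolding set_integrable_def by (rule integrable_mult_indicator[OF _ int]) auto
    from set_borel_integral_eq_integral(2)[OF this] show ?thesis by (simp add: set_lebesgue_integral_def)
  qed
  with l2 have "(\<lambda>N. integral {- real N..real N + 1} g) \<longlonglongrightarrow> (LINT x|lborel. g x)" by simp
  then have "J = (LINT x|lborel. g x)" using l1 LIMSEQ_unique by blast
  then show ?thesis using J by (simp add: integral_unique)
qed

text \<open>After scaling by \<open>c = sqrt (2 * pi * t)\<close>, the integral is the
  characteristic function of the standard normal distribution at
  \<open>r = 2 * pi * s / c\<close>.\<close>

lemma gauss_fourier:
  fixes t s :: real
  assumes t: "t > 0"
  shows "integrable lborel (\<lambda>x. complex_of_real (exp (- pi * t * x\<^sup>2)) * exp (\<i> * of_real (2 * pi * s * x)))"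
    and "(LINT x|lborel. complex_of_real (exp (- pi * t * x\<^sup>2)) * exp (\<i> * of_real (2 * pi * s * x)))
        = of_real (exp (- pi * s\<^sup>2 / t) / sqrt t)"
proof -
  define c where "c = sqrt (2 * pi * t)"
  have c: "c > 0" "c\<^sup>2 = 2 * pi * t" using t by (auto simp: c_def)
  have cf: "c / sqrt (2 * pi) = sqrt t" by (simp add: c_def real_sqrt_mult)
  define r where "r = 2 * pi * s / c"
  define f where "f = (\<lambda>x. std_normal_density x *\<^sub>R iexp (r * x))"
  have fc: "f (0 + c * x) = (1 / sqrt (2 * pi)) *\<^sub>R (complex_of_real (exp (- pi * t * x\<^sup>2)) * exp (\<i> * of_real (2 * pi * s * x)))" for x
  proof -
    have "(c * x)\<^sup>2 / 2 = pi * t * x\<^sup>2" "r * (c * x) = 2 * pi * s * x"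
      using c by (auto simp: power_mult_distrib r_def)
    then have "exp (- ((c * x)\<^sup>2 / 2)) = exp (- (pi * t * x\<^sup>2))" "iexp (r * (c * x)) = iexp (2 * pi * s * x)"
      by (simp_all only:)
    then show ?thesis
      by (simp add: f_def std_normal_density_def scaleR_conv_of_real del: of_real_mult mult_cancel_right)
  qed
  interpret prob_space std_normal_distribution by (rule prob_space_normal_density) simp
  have "integrable std_normal_distribution (\<lambda>x. iexp (r * x))"
    by (rule integrable_const_bound[of _ 1]) (auto simp: norm_exp_eq_Re)
  then have if1: "integrable lborel f"
    unfolding f_def by (subst (asm) integrable_density) auto
  have "char std_normal_distribution r = (LINT x|lborel. f x)"
    unfolding char_def f_def by (subst integral_density) auto
  then have If: "(LINT x|lborel. f x) = complex_of_real (exp (- (r\<^sup>2) / 2))"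
    by (simp add: char_std_normal_distribution)
  have i2: "integrable lborel (\<lambda>x. f (0 + c * x))"
    using if1 c by (subst lborel_integrable_real_affine_iff) auto
  then have "integrable lborel (\<lambda>x. sqrt (2 * pi) *\<^sub>R f (0 + c * x))" by (rule integrable_scaleR_right)
  moreover have eq: "(\<lambda>x. sqrt (2 * pi) *\<^sub>R f (0 + c * x)) = (\<lambda>x. complex_of_real (exp (- pi * t * x\<^sup>2)) * exp (\<i> * of_real (2 * pi * s * x)))"
    unfolding fc by (simp add: scaleR_conv_of_real fun_eq_iff)
  ultimately show "integrable lborel (\<lambda>x. complex_of_real (exp (- pi * t * x\<^sup>2)) * exp (\<i> * of_real (2 * pi * s * x)))"
    by simp
  have "(LINT x|lborel. f x) = \<bar>c\<bar> *\<^sub>R (LINT x|lborel. f (0 + c * x))"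
    using c by (intro lborel_integral_real_affine) auto
  then have "(LINT x|lborel. f (0 + c * x)) = (1 / c) *\<^sub>R complex_of_real (exp (- (r\<^sup>2) / 2))"
    using c If by (simp add: scaleR_conv_of_real)
  then have "(LINT x|lborel. sqrt (2 * pi) *\<^sub>R f (0 + c * x)) = (sqrt (2 * pi) / c) *\<^sub>R complex_of_real (exp (- (r\<^sup>2) / 2))"
    by simp
  also have "\<dots> = of_real (sqrt (2 * pi) / c * exp (- (r\<^sup>2 / 2)))" by (simp add: scaleR_conv_of_real)
  also have "r\<^sup>2 / 2 = pi * s\<^sup>2 / t"
    using c t by (simp add: r_def power_divide power_mult_distrib power2_eq_square)
  also have "sqrt (2 * pi) / c = 1 / sqrt t" using cf c t by (simp add: field_simps)
  finally show "(LINT x|lborel. complex_of_real (exp (- pi * t * x\<^sup>2)) * exp (\<i> * of_real (2 * pi * s * x)))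
        = of_real (exp (- pi * s\<^sup>2 / t) / sqrt t)"
    unfolding eq by simp
qed

lemma thterm_shift: "thterm (x + 1) 0 t n = thterm x 0 t (n + 1)"
  by (simp add: thterm_def algebra_simps)

lemma theta_periodic: "theta (x + 1) 0 t = theta x 0 t"
  unfolding theta_def
  by (rule infsum_reindex_bij_witness[where i = "\<lambda>n. n - 1" and j = "\<lambda>n. n + 1"]) (auto simp: thterm_shift)

lemma holomorphic_theta_shift:
  assumes "Im t > 0"
  shows "(\<lambda>z. theta (x + z) y t) holomorphic_on UNIV"
proof -
  have "((\<lambda>z. theta z y t) \<circ> (\<lambda>z. x + z)) holomorphic_on UNIV"
    by (rule holomorphic_on_compose[OF _ holomorphic_on_subset[OF theta_holomorphic_char[OF assms]]])
       (auto intro!: holomorphic_intros)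
  then show ?thesis by (simp add: o_def)
qed

text \<open>Unfolding: since \<open>exp (- 2 pi i m n) = 1\<close>, the integrand on the unit
  interval is, up to the phase \<open>exp (2 pi i m x)\<close>, the sum of the integer translates of
  one function \<open>g\<close> on the line.\<close>

lemma fourier_coeff_theta:
  fixes t x :: real
  assumes t: "t > 0"
  shows "fourier_coeff (\<lambda>z. theta (of_real x + z) 0 (\<i> * of_real t)) m = thterm 0 (of_real x) (\<i> / of_real t) m / of_real (sqrt t)"
proof -
  define G where "G = (\<lambda>v. complex_of_real (exp (- pi * t * v\<^sup>2)) * exp (\<i> * of_real (2 * pi * (- of_int m) * v)))"
  define g where "g = (\<lambda>v. G (x + 1 * v))"
  have iG: "integrable lborel G" and IG: "(LINT v|lborel. G v) = of_real (exp (- pi * (- of_int m)\<^sup>2 / t) / sqrt t)"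
    using gauss_fourier[OF t, of "- of_int m"] by (simp_all add: G_def)
  have ig: "integrable lborel g" unfolding g_def using iG by (subst lborel_integrable_real_affine_iff) auto
  have Ig: "(LINT v|lborel. g v) = (LINT v|lborel. G v)"
    unfolding g_def using lborel_integral_real_affine[of 1 G x] by simp
  have gt: "g (u + of_int n) = thterm (of_real x + of_real u) 0 (\<i> * of_real t) n * exp (- (2 * of_real pi * \<i> * of_int m * of_real u))
       * exp (- (2 * of_real pi * \<i> * of_int m * of_real x))" for u n
  proof -
    have e: "exp (- (2 * of_real pi * \<i> * of_int m * of_int n)) = 1"
      using exp_2pi_i_int[of "- (m * n)"] by (simp add: mult_ac)
    have "g (u + of_int n) = exp (complex_of_real (- pi * t * (x + (u + of_int n))\<^sup>2)) * exp (\<i> * of_real (2 * pi * (- of_int m) * (x + (u + of_int n))))"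
      by (simp only: g_def G_def exp_of_real mult_1)
    also have "\<i> * of_real (2 * pi * (- of_int m) * (x + (u + of_int n))) = - (2 * of_real pi * \<i> * of_int m * of_real u)
        + - (2 * of_real pi * \<i> * of_int m * of_real x) + - (2 * of_real pi * \<i> * of_int m * of_int n)"
      by (simp add: algebra_simps)
    also have "exp (complex_of_real (- pi * t * (x + (u + of_int n))\<^sup>2)) = thterm (of_real x + of_real u) 0 (\<i> * of_real t) n"
      unfolding thterm_def by (rule arg_cong[of _ _ exp]) (simp add: algebra_simps)
    finally show ?thesis unfolding exp_add e by simp
  qed
  have tp: "Im (\<i> * of_real t) > 0" using t by simp
  have P: "theta (of_real x + of_real u) 0 (\<i> * of_real t) * exp (- (2 * of_real pi * \<i> * of_int m * of_real u))
     = exp (2 * of_real pi * \<i> * of_int m * of_real x) * (\<Sum>\<^sub>\<infinity>n. g (u + of_int n))" for u :: real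
  proof -
    have "(\<Sum>\<^sub>\<infinity>n. g (u + of_int n)) = theta (of_real x + of_real u) 0 (\<i> * of_real t) * exp (- (2 * of_real pi * \<i> * of_int m * of_real u))
       * exp (- (2 * of_real pi * \<i> * of_int m * of_real x))"
      unfolding gt theta_def by (simp add: infsum_cmult_left')
    then show ?thesis by (simp add: exp_minus)
  qed
  define h where "h = (\<lambda>n::int. exp (- (pi * t) * (real_of_int n)\<^sup>2 + (2 * pi * (t * (\<bar>x\<bar> + 1) + 0)) * \<bar>real_of_int n\<bar> + pi * (t * (\<bar>x\<bar> + 1)\<^sup>2)))"
  have h: "h summable_on UNIV" unfolding h_def by (rule summable_on_int_gauss) (use t in auto)
  have b: "norm (g (u + of_int n)) \<le> h n" if u: "u \<in> {0..1}" for u n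
  proof -
    have "norm (complex_of_real x + of_real u) \<le> \<bar>x\<bar> + 1"
      using norm_triangle_ineq[of "complex_of_real x" "of_real u"] u by simp
    then have "norm (thterm (of_real x + of_real u) 0 (\<i> * of_real t) n) \<le> h n"
      unfolding h_def by (intro norm_thterm_le) (use t in \<open>auto simp: norm_mult\<close>)
    moreover have "norm (exp (- (2 * of_real pi * \<i> * of_int m * of_real u))) = 1" for u
      by (simp add: norm_exp_eq_Re)
    ultimately show ?thesis unfolding gt norm_mult by simp
  qed
  have cont: "continuous_on UNIV g" unfolding g_def G_def by (intro continuous_intros)
  have "fourier_coeff (\<lambda>z. theta (of_real x + z) 0 (\<i> * of_real t)) m
     = exp (2 * of_real pi * \<i> * of_int m * of_real x) * integral {0..1} (\<lambda>u. \<Sum>\<^sub>\<infinity>n. g (u + of_int n))"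
    unfolding fourier_coeff_def P by (rule integral_mult_right)
  also have "\<dots> = exp (2 * of_real pi * \<i> * of_int m * of_real x) * (LINT v|lborel. g v)"
    by (subst integral_periodization[OF cont ig b h]) auto
  also have "(LINT v|lborel. g v) = exp (complex_of_real (- pi * (of_int m)\<^sup>2 / t)) / of_real (sqrt t)"
    unfolding Ig IG exp_of_real by simp
  also have "exp (2 * of_real pi * \<i> * of_int m * of_real x) * (exp (complex_of_real (- pi * (of_int m)\<^sup>2 / t)) / of_real (sqrt t))
     = thterm 0 (of_real x) (\<i> / of_real t) m / of_real (sqrt t)"
    by (simp add: thterm_def exp_add[symmetric] algebra_simps)
  finally show ?thesis .
qed

text \<open>The characteristic \<open>x\<close> is built into the periodic function as a shift, so
  that convergence of Fourier series at the single point 0 gives the formula for every real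
  \<open>x\<close>.\<close>

lemma theta_inversion_imag:
  fixes t x :: real
  assumes t: "t > 0"
  shows "theta (of_real x) 0 (\<i> * of_real t) = theta 0 (of_real x) (\<i> / of_real t) / of_real (sqrt t)"
proof -
  have "(\<lambda>N. \<Sum>m\<in>{- int N..int N}. fourier_coeff (\<lambda>z. theta (of_real x + z) 0 (\<i> * of_real t)) m) \<longlonglongrightarrow> theta (of_real x + 0) 0 (\<i> * of_real t)"
  proof (rule fourier_series_at_0)
    show "(\<lambda>z. theta (of_real x + z) 0 (\<i> * of_real t)) holomorphic_on UNIV"
      by (rule holomorphic_theta_shift) (use t in simp)
    show "theta (of_real x + (z + 1)) 0 (\<i> * of_real t) = theta (of_real x + z) 0 (\<i> * of_real t)" for z
      using theta_periodic[of "of_real x + z"] by (simp add: add.assoc)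
  qed
  then have 1: "(\<lambda>N. \<Sum>m\<in>{- int N..int N}. thterm 0 (of_real x) (\<i> / of_real t) m / of_real (sqrt t)) \<longlonglongrightarrow> theta (of_real x) 0 (\<i> * of_real t)"
    unfolding fourier_coeff_theta[OF t] by simp
  have "Im (\<i> / of_real t) > 0" using t by (simp add: Im_divide_of_real)
  then have "(thterm 0 (of_real x) (\<i> / of_real t) has_sum theta 0 (of_real x) (\<i> / of_real t)) UNIV"
    unfolding theta_def by (intro has_sum_infsum thterm_summable)
  then have "((\<lambda>m. thterm 0 (of_real x) (\<i> / of_real t) m / of_real (sqrt t)) has_sum theta 0 (of_real x) (\<i> / of_real t) / of_real (sqrt t)) UNIV"
    by (rule has_sum_divide_const)
  from has_sum_int_tendsto[OF this] 1 show ?thesis using LIMSEQ_unique by blast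
qed

abbreviation upper_half_plane :: "complex set" where
  "upper_half_plane \<equiv> {t. Im t > 0}"

lemma Im_minus_inverse: "Im (- (1 / t)) = Im t / (norm t)\<^sup>2"
  by (cases "t = 0") (simp_all add: Im_divide cmod_power2)

lemma Im_minus_inverse_pos: "Im t > 0 \<Longrightarrow> Im (- (1 / t)) > 0"
  unfolding Im_minus_inverse by (metis divide_pos_pos norm_eq_zero zero_less_power zero_complex.simps(2) norm_ge_zero order_less_irrefl less_eq_real_def)

text \<open>Both sides are holomorphic in \<open>t\<close> and agree on the positive imaginary axis,
  so the identity theorem applies. The principal root is holomorphic here because
  \<open>- \<i> * t\<close> has positive real part.\<close>

lemma theta_inversion:
  fixes x :: real
  assumes t: "Im t > 0"
  shows "theta (of_real x) 0 t = theta 0 (of_real x) (- (1 / t)) / csqrt (- \<i> * t)"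
proof -
  define f where "f = (\<lambda>t. theta (of_real x) 0 t - theta 0 (of_real x) (- (1 / t)) / csqrt (- \<i> * t))"
  have "(\<lambda>t. - (1 / t)) holomorphic_on upper_half_plane" by (intro holomorphic_intros) auto
  then have "((\<lambda>t. theta 0 (of_real x) t) \<circ> (\<lambda>t. - (1 / t))) holomorphic_on upper_half_plane"
    by (rule holomorphic_on_compose[OF _ holomorphic_on_subset[OF theta_holomorphic]])
       (use Im_minus_inverse_pos in auto)
  then have "f holomorphic_on upper_half_plane"
    unfolding f_def
    by (intro holomorphic_intros theta_holomorphic) (auto simp: o_def complex_nonpos_Reals_iff)
  moreover have "\<i> islimpt {t. Re t = 0 \<and> Im t > 0}"
    unfolding islimpt_approachable
  proof (intro allI impI)
    fix e :: real assume e: "e > 0"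
    show "\<exists>x'\<in>{t. Re t = 0 \<and> Im t > 0}. x' \<noteq> \<i> \<and> dist x' \<i> < e"
      by (rule bexI[of _ "\<i> * of_real (1 + e / 2)"]) (use e in \<open>auto simp: dist_norm complex_eq_iff cmod_def\<close>)
  qed
  moreover have "f z = 0" if z: "z \<in> {t. Re t = 0 \<and> Im t > 0}" for z
  proof -
    define y where "y = Im z"
    have y: "y > 0" "z = \<i> * of_real y" unfolding y_def using z by (auto simp: complex_eq_iff)
    have 1: "- (1 / z) = \<i> / of_real y" using y(1) by (simp add: y(2) complex_eq_iff Re_divide Im_divide power2_eq_square)
    have 2: "- \<i> * z = of_real y" by (simp add: y(2))
    have 3: "csqrt (of_real y) = of_real (sqrt y)" by (rule of_real_sqrt[symmetric]) (use y(1) in simp)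
    show ?thesis unfolding f_def 1 2 3 using theta_inversion_imag[OF y(1), of x] by (simp add: y(2))
  qed
  ultimately have "f t = 0"
    using t by (intro analytic_continuation[of f upper_half_plane "{t. Re t = 0 \<and> Im t > 0}" \<i> t])
      (auto simp: open_halfspace_Im_gt convex_halfspace_Im_gt convex_connected)
  then show ?thesis by (simp add: f_def)
qed

section \<open>The Jacobi triple product\<close>

definition euler_prod :: "complex \<Rightarrow> complex" where
  "euler_prod q = prodinf (\<lambda>n. 1 - q ^ Suc n)"

definition odd_prod :: "complex \<Rightarrow> complex" where
  "odd_prod q = prodinf (\<lambda>n. 1 - q ^ (2 * n + 1))"

lemma convergent_prod_geometric:
  fixes q a :: complex
  assumes "norm q < 1" and "\<And>n. k n \<ge> n"
  shows "convergent_prod (\<lambda>n. 1 + a * q ^ k n)"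
proof -
  have "summable (\<lambda>n. norm (a * q ^ k n))"
  proof (rule summable_comparison_test')
    show "summable (\<lambda>n. norm a * norm q ^ n)" using assms by (intro summable_mult summable_geometric) auto
    show "norm (norm (a * q ^ k n)) \<le> norm a * norm q ^ n" for n
      using assms by (auto simp: norm_mult norm_power intro!: mult_left_mono power_decreasing)
  qed
  then show ?thesis
    by (intro abs_convergent_prod_imp_convergent_prod summable_imp_abs_convergent_prod) simp
qed

lemma prodinf_geometric_LIMSEQ:
  fixes q a :: complex
  assumes "norm q < 1" and "\<And>n. k n \<ge> n"
  shows "(\<lambda>N. \<Prod>n<N. 1 + a * q ^ k n) \<longlonglongrightarrow> prodinf (\<lambda>n. 1 + a * q ^ k n)"
  using convergent_prod_LIMSEQ[OF convergent_prod_geometric[OF assms]]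
  by (simp add: LIMSEQ_lessThan_iff_atMost)

lemma euler_prod_LIMSEQ: "norm q < 1 \<Longrightarrow> (\<lambda>N. \<Prod>n<N. 1 - q ^ Suc n) \<longlonglongrightarrow> euler_prod q"
  using prodinf_geometric_LIMSEQ[of q Suc "-1"] by (simp add: euler_prod_def)

lemma odd_prod_LIMSEQ: "norm q < 1 \<Longrightarrow> (\<lambda>N. \<Prod>n<N. 1 - q ^ (2 * n + 1)) \<longlonglongrightarrow> odd_prod q"
  using prodinf_geometric_LIMSEQ[of q "\<lambda>n. 2 * n + 1" "-1"] by (simp add: odd_prod_def)

lemma power_neq_1:
  fixes q :: complex
  assumes "norm q < 1"
  shows "q ^ Suc n \<noteq> 1"
proof
  assume "q ^ Suc n = 1"
  then have "norm q ^ Suc n = 1" by (metis norm_one norm_power)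
  moreover have "norm q ^ Suc n \<le> norm q" using assms by (simp add: mult_left_le power_le_one)
  ultimately show False using assms by simp
qed

lemma euler_prod_nonzero: "norm q < 1 \<Longrightarrow> euler_prod q \<noteq> 0"
  unfolding euler_prod_def
  using convergent_prod_geometric[of q Suc "-1"] power_neq_1[of q]
  by (intro prodinf_nonzero) auto

lemma norm_power_less_1: "norm q < 1 \<Longrightarrow> n > 0 \<Longrightarrow> norm (q ^ n) < (1 :: real)" for q :: complex
  by (simp add: norm_power power_less_one_iff)

lemma euler_prod_split:
  assumes q: "norm q < 1"
  shows "euler_prod q = euler_prod (q\<^sup>2) * odd_prod q"
proof -
  have e: "(q\<^sup>2) ^ Suc n = q ^ (2 * n + 2)" for n
    unfolding power_mult[symmetric] by simp
  have f: "(\<Prod>n<2*N. 1 - q ^ Suc n) = (\<Prod>n<N. 1 - (q\<^sup>2) ^ Suc n) * (\<Prod>n<N. 1 - q ^ (2 * n + 1))" for N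
    unfolding e by (induction N) (simp_all add: mult_ac)
  have "(\<lambda>N. \<Prod>n<2*N. 1 - q ^ Suc n) \<longlonglongrightarrow> euler_prod q"
    using LIMSEQ_subseq_LIMSEQ[OF euler_prod_LIMSEQ[OF q], of "\<lambda>N. 2 * N"] by (simp add: strict_mono_def o_def)
  moreover have "(\<lambda>N. \<Prod>n<2*N. 1 - q ^ Suc n) \<longlonglongrightarrow> euler_prod (q\<^sup>2) * odd_prod q"
    unfolding f by (intro tendsto_mult euler_prod_LIMSEQ odd_prod_LIMSEQ q norm_power_less_1) auto
  ultimately show ?thesis using LIMSEQ_unique by blast
qed

lemma odd_prod_mult_minus:
  assumes q: "norm q < 1"
  shows "odd_prod q * odd_prod (- q) = odd_prod (q\<^sup>2)"
proof -
  have f: "(\<Prod>n<N. 1 - q ^ (2 * n + 1)) * (\<Prod>n<N. 1 - (- q) ^ (2 * n + 1)) = (\<Prod>n<N. 1 - (q\<^sup>2) ^ (2 * n + 1))" for N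
    unfolding prod.distrib[symmetric]
    by (rule prod.cong) (simp_all add: algebra_simps power_mult[symmetric] power_add[symmetric] power2_eq_square power_mult_distrib)
  have "(\<lambda>N. (\<Prod>n<N. 1 - q ^ (2 * n + 1)) * (\<Prod>n<N. 1 - (- q) ^ (2 * n + 1))) \<longlonglongrightarrow> odd_prod q * odd_prod (- q)"
    using q by (intro tendsto_mult odd_prod_LIMSEQ) auto
  moreover have "(\<lambda>N. (\<Prod>n<N. 1 - (q\<^sup>2) ^ (2 * n + 1))) \<longlonglongrightarrow> odd_prod (q\<^sup>2)"
    by (intro odd_prod_LIMSEQ norm_power_less_1 q) auto
  ultimately show ?thesis unfolding f using LIMSEQ_unique by blast
qed

lemma prodinf_one_plus_power:
  assumes q: "norm q < 1"
  shows "prodinf (\<lambda>n. 1 + q ^ Suc n) * euler_prod q = euler_prod (q\<^sup>2)"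
proof -
  have f: "(\<Prod>n<N. 1 + q ^ Suc n) * (\<Prod>n<N. 1 - q ^ Suc n) = (\<Prod>n<N. 1 - (q\<^sup>2) ^ Suc n)" for N
    unfolding prod.distrib[symmetric]
    by (rule prod.cong) (simp_all add: algebra_simps power_mult[symmetric] power_add[symmetric] power2_eq_square power_mult_distrib)
  have "(\<lambda>N. (\<Prod>n<N. 1 + q ^ Suc n)) \<longlonglongrightarrow> prodinf (\<lambda>n. 1 + q ^ Suc n)"
    using prodinf_geometric_LIMSEQ[OF q, of Suc 1] by simp
  then have "(\<lambda>N. (\<Prod>n<N. 1 + q ^ Suc n) * (\<Prod>n<N. 1 - q ^ Suc n)) \<longlonglongrightarrow> prodinf (\<lambda>n. 1 + q ^ Suc n) * euler_prod q"
    using q by (intro tendsto_mult euler_prod_LIMSEQ) auto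
  moreover have "(\<lambda>N. (\<Prod>n<N. 1 - (q\<^sup>2) ^ Suc n)) \<longlonglongrightarrow> euler_prod (q\<^sup>2)"
    by (intro euler_prod_LIMSEQ norm_power_less_1 q) auto
  ultimately show ?thesis unfolding f using LIMSEQ_unique by blast
qed

section \<open>Gaussian binomial coefficients and the finite triple product\<close>

definition qpoch :: "complex \<Rightarrow> nat \<Rightarrow> complex" where
  "qpoch q n = (\<Prod>i<n. 1 - q ^ Suc i)"

definition inv_qpoch :: "complex \<Rightarrow> int \<Rightarrow> complex" where
  "inv_qpoch q n = (if n < 0 then 0 else 1 / qpoch q (nat n))"

lemma inv_qpoch_pred:
  assumes "norm q < 1"
  shows "inv_qpoch q (n - 1) = (1 - q powi n) * inv_qpoch q n"
proof (cases "n > 0")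
  case True
  then obtain m where m: "n = int (Suc m)" by (metis gr0_implies_Suc zero_less_imp_eq_int)
  have "nat n = Suc m" "nat (n - 1) = m" using m by auto
  moreover have "q powi n = q ^ Suc m" using m by (metis power_int_of_nat)
  ultimately show ?thesis using power_neq_1[OF assms, of m] m
    by (auto simp: inv_qpoch_def qpoch_def)
next
  case False
  then show ?thesis by (cases "n = 0") (auto simp: inv_qpoch_def)
qed

text \<open>Writing the Gaussian binomial coefficients with \<open>inv_qpoch\<close>, which vanishes at negative
  arguments, makes their recurrence valid for all integers \<open>j\<close>, without boundary cases.\<close>

definition central_qbinomial :: "complex \<Rightarrow> nat \<Rightarrow> int \<Rightarrow> complex" where
  "central_qbinomial q N j = qpoch q (2 * N) * inv_qpoch q (int N + j) * inv_qpoch q (int N - j)"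

text \<open>Two steps of the q-Pascal rule at once, which keeps the index centred. The three
  coefficients match the expansion of the factor pair that \<open>finite_triple_product\<close> adds
  in passing from \<open>N\<close> to \<open>Suc N\<close>.\<close>

lemma central_qbinomial_Suc:
  assumes q: "norm q < 1" "q \<noteq> 0"
  shows "central_qbinomial q (Suc N) j = (1 + q ^ (2 * N + 1)) * central_qbinomial q N j
    + q powi (int N + 1 - j) * central_qbinomial q N (j - 1)
    + q powi (int N + 1 + j) * central_qbinomial q N (j + 1)"
proof -
  define a where "a = inv_qpoch q (int N + 1 + j)"
  define b where "b = inv_qpoch q (int N + 1 - j)"
  define s where "s = q ^ N"
  define t where "t = q powi j"
  have t0: "t \<noteq> 0" using q by (simp add: t_def)
  have p: "q powi (int N + 1 + j) = q * s * t" "q powi (int N + j) = s * t"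
    "q powi (int N + 1 - j) = q * s / t" "q powi (int N - j) = s / t"
    using q by (simp_all add: power_int_add power_int_diff s_def t_def)
  have A: "inv_qpoch q (int N + j) = (1 - q * s * t) * a"
    using inv_qpoch_pred[OF q(1), of "int N + 1 + j"] unfolding p a_def[symmetric] by (simp add: add_ac)
  have A2: "inv_qpoch q (int N + (j - 1)) = (1 - s * t) * (1 - q * s * t) * a"
    using inv_qpoch_pred[OF q(1), of "int N + j"] unfolding p A by (simp add: add_diff_eq)
  have B: "inv_qpoch q (int N - j) = (1 - q * s / t) * b"
    using inv_qpoch_pred[OF q(1), of "int N + 1 - j"] unfolding p b_def[symmetric] by simp
  have B2: "inv_qpoch q (int N - (j + 1)) = (1 - s / t) * (1 - q * s / t) * b"
    using inv_qpoch_pred[OF q(1), of "int N - j"] unfolding p B by (simp add: diff_diff_eq)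
  have e: "inv_qpoch q (int N + (j + 1)) = a" "inv_qpoch q (int N - (j - 1)) = b"
     "inv_qpoch q (int (Suc N) + j) = a" "inv_qpoch q (int (Suc N) - j) = b"
    by (simp_all add: a_def b_def algebra_simps)
  have s1: "s\<^sup>2 = q ^ (2 * N)" unfolding s_def power_mult[symmetric] by (simp add: mult.commute)
  have s2: "q ^ (2 * N + 1) = q * s\<^sup>2" by (simp add: s1)
  have g: "qpoch q (2 * Suc N) = qpoch q (2 * N) * (1 - q * s\<^sup>2) * (1 - q\<^sup>2 * s\<^sup>2)"
    unfolding s1 by (simp add: qpoch_def power2_eq_square mult_ac)
  \<comment> \<open>Naming the quotient \<open>q^(N - j)\<close> clears all divisions, and the
    recurrence becomes a polynomial identity.\<close>
  define d where "d = s / t"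
  have d: "s / t = d" "q * s / t = q * d" "s = d * t" using t0 by (simp_all add: d_def)
  show ?thesis
    unfolding central_qbinomial_def A A2 B B2 e g s2 p d(1,2) unfolding d(3)
    by (simp add: algebra_simps power2_eq_square)
qed

text \<open>The factor pair added by induction is \<open>1 + u\<^sup>2 + u * z + u / z\<close> with
  \<open>u = p ^ (2 * N + 1)\<close>, where \<open>z\<close> and \<open>1 / z\<close> shift the
  summation index. The sum runs over all integers, although almost all terms vanish, so that the
  limit in \<open>N\<close> is taken over a fixed index set.\<close>

lemma finite_triple_product:
  fixes p z :: complex
  assumes p: "norm p < 1" "p \<noteq> 0" and z: "z \<noteq> 0"
  shows "((\<lambda>j. central_qbinomial (p\<^sup>2) N j * (p powi (j\<^sup>2) * z powi j)) has_sum
     (\<Prod>m<N. (1 + z * p ^ (2 * m + 1)) * (1 + inverse z * p ^ (2 * m + 1)))) UNIV"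
proof (induction N)
  case 0
  have "central_qbinomial (p\<^sup>2) 0 j = (if j = 0 then 1 else 0)" for j
    by (auto simp: central_qbinomial_def inv_qpoch_def qpoch_def)
  then show ?case
    by (intro has_sum_finite_neutralI[of "{0}"]) auto
next
  case (Suc N)
  define c where "c = (\<lambda>j. central_qbinomial (p\<^sup>2) N j * (p powi (j\<^sup>2) * z powi j))"
  define T where "T = (\<Prod>m<N. (1 + z * p ^ (2 * m + 1)) * (1 + inverse z * p ^ (2 * m + 1)))"
  have c: "(c has_sum T) UNIV" using Suc by (simp add: c_def T_def)
  have cm: "((\<lambda>j. c (j - 1)) has_sum T) UNIV"
    by (rule has_sum_reindex_bij_witness[where i = "\<lambda>j. j + 1" and j = "\<lambda>j. j - 1" and h = c and s' = T, THEN iffD2]) (use c in auto)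
  have cp: "((\<lambda>j. c (j + 1)) has_sum T) UNIV"
    by (rule has_sum_reindex_bij_witness[where i = "\<lambda>j. j - 1" and j = "\<lambda>j. j + 1" and h = c and s' = T, THEN iffD2]) (use c in auto)
  define u where "u = p ^ (2 * N + 1)"
  have "((\<lambda>j. (1 + u\<^sup>2) * c j + u * z * c (j - 1) + u / z * c (j + 1)) has_sum (1 + u\<^sup>2) * T + u * z * T + u / z * T) UNIV"
    by (intro has_sum_add has_sum_cmult_right c cm cp)
  also have "(1 + u\<^sup>2) * T + u * z * T + u / z * T = T * ((1 + z * u) * (1 + inverse z * u))"
    using z by (simp add: field_simps power2_eq_square)
  also have "(\<lambda>j. (1 + u\<^sup>2) * c j + u * z * c (j - 1) + u / z * c (j + 1))
     = (\<lambda>j. central_qbinomial (p\<^sup>2) (Suc N) j * (p powi (j\<^sup>2) * z powi j))"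
  proof
    fix j :: int
    have P: "(p\<^sup>2) powi k = p powi (2 * k)" for k by (simp add: power_int_mult)
    have u: "u = p powi (2 * int N + 1)" unfolding u_def
      using power_int_of_nat[of p "2 * N + 1"] by (simp only: of_nat_add of_nat_mult of_nat_numeral of_nat_1)
    have e1: "(p\<^sup>2) ^ (2 * N + 1) = u\<^sup>2" by (simp only: u_def power_mult[symmetric] mult.commute)
    have pa: "p powi m * p powi n = p powi (m + n)" for m n using p by (simp add: power_int_add)
    have e2: "p powi (2 * (int N + 1 - j)) * p powi (j\<^sup>2) = u * p powi ((j - 1)\<^sup>2)"
      unfolding u pa by (rule arg_cong[of _ _ "power_int p"]) (simp add: power2_eq_square algebra_simps)
    have e3: "p powi (2 * (int N + 1 + j)) * p powi (j\<^sup>2) = u * p powi ((j + 1)\<^sup>2)"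
      unfolding u pa by (rule arg_cong[of _ _ "power_int p"]) (simp add: power2_eq_square algebra_simps)
    have S: "central_qbinomial (p\<^sup>2) (Suc N) j = (1 + u\<^sup>2) * central_qbinomial (p\<^sup>2) N j
        + p powi (2 * (int N + 1 - j)) * central_qbinomial (p\<^sup>2) N (j - 1)
        + p powi (2 * (int N + 1 + j)) * central_qbinomial (p\<^sup>2) N (j + 1)"
      using central_qbinomial_Suc[of "p\<^sup>2" N j] p unfolding e1 P by (simp add: norm_power_less_1)
    have z1: "z powi j = z * z powi (j - 1)" "z powi j = z powi (j + 1) / z"
      using z by (simp_all add: power_int_diff power_int_add)
    have "central_qbinomial (p\<^sup>2) (Suc N) j * (p powi (j\<^sup>2) * z powi j)
      = (1 + u\<^sup>2) * c j + (p powi (2 * (int N + 1 - j)) * p powi (j\<^sup>2)) * central_qbinomial (p\<^sup>2) N (j - 1) * z powi j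
        + (p powi (2 * (int N + 1 + j)) * p powi (j\<^sup>2)) * central_qbinomial (p\<^sup>2) N (j + 1) * z powi j"
      unfolding S c_def by (simp add: algebra_simps)
    also have "\<dots> = (1 + u\<^sup>2) * c j + u * z * c (j - 1) + u / z * c (j + 1)"
      unfolding e2 e3 c_def by (subst (1) z1(1), subst z1(2)) (simp add: mult_ac)
    finally show "(1 + u\<^sup>2) * c j + u * z * c (j - 1) + u / z * c (j + 1) = central_qbinomial (p\<^sup>2) (Suc N) j * (p powi (j\<^sup>2) * z powi j)" ..
  qed
  finally show ?case by (simp add: T_def u_def)
qed

lemma summable_jacobi_terms:
  fixes p z :: complex
  assumes p: "norm p < 1" "p \<noteq> 0" and z: "z \<noteq> 0"
  shows "(\<lambda>j. norm (p powi (j\<^sup>2) * z powi j)) summable_on UNIV"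
proof (rule summable_on_comparison_test[OF summable_on_int_gauss[of "- ln (norm p)" "\<bar>ln (norm z)\<bar>" 0]])
  show "0 < - ln (norm p)" using p by simp
  fix j :: int
  have e: "x powi n = exp (of_int n * ln x)" if "x > 0" for x :: real and n
    using that exp_power_int[of "ln x" n] by simp
  have "norm (p powi (j\<^sup>2) * z powi j) = exp (of_int (j\<^sup>2) * ln (norm p)) * exp (of_int j * ln (norm z))"
    using p z by (simp add: norm_mult norm_power_int e del: of_int_power)
  also have "\<dots> \<le> exp (- (- ln (norm p)) * (of_int j)\<^sup>2 + \<bar>ln (norm z)\<bar> * \<bar>of_int j\<bar> + 0)"
    unfolding exp_add[symmetric] using abs_ge_self[of "of_int j * ln (norm z)"]
    by (simp add: abs_mult mult.commute)
  finally show "norm (p powi (j\<^sup>2) * z powi j) \<le> exp (- (- ln (norm p)) * (of_int j)\<^sup>2 + \<bar>ln (norm z)\<bar> * \<bar>of_int j\<bar> + 0)" .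
qed auto

lemma qpoch_LIMSEQ: "norm q < 1 \<Longrightarrow> qpoch q \<longlonglongrightarrow> euler_prod q"
  unfolding qpoch_def[abs_def] by (rule euler_prod_LIMSEQ)

lemma inv_qpoch_tendsto:
  assumes q: "norm q < 1" and f: "filterlim (\<lambda>N. nat (f N)) sequentially sequentially"
    and ev: "\<forall>\<^sub>F N in sequentially. f N \<ge> 0"
  shows "(\<lambda>N. inv_qpoch q (f N)) \<longlonglongrightarrow> 1 / euler_prod q"
proof -
  have "(\<lambda>N. 1 / qpoch q (nat (f N))) \<longlonglongrightarrow> 1 / euler_prod q"
    by (intro tendsto_divide tendsto_const euler_prod_nonzero[OF q] filterlim_compose[OF qpoch_LIMSEQ[OF q] f])
  moreover have "\<forall>\<^sub>F N in sequentially. inv_qpoch q (f N) = 1 / qpoch q (nat (f N))"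
    using ev by eventually_elim (simp add: inv_qpoch_def)
  ultimately show ?thesis by (simp add: tendsto_cong)
qed

lemma filterlim_nat_add: "filterlim (\<lambda>N. nat (int N + j)) sequentially sequentially"
  unfolding filterlim_at_top
proof
  fix Z :: nat
  show "\<forall>\<^sub>F N in sequentially. Z \<le> nat (int N + j)"
    by (rule eventually_sequentiallyI[of "Z + nat \<bar>j\<bar>"]) auto
qed

lemma central_qbinomial_tendsto:
  assumes q: "norm q < 1"
  shows "(\<lambda>N. central_qbinomial q N j) \<longlonglongrightarrow> 1 / euler_prod q"
proof -
  have ev: "\<forall>\<^sub>F N in sequentially. int N + j \<ge> 0" for j
    by (rule eventually_sequentiallyI[of "nat \<bar>j\<bar>"]) auto
  have "(\<lambda>N. qpoch q (2 * N)) \<longlonglongrightarrow> euler_prod q"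
    using LIMSEQ_subseq_LIMSEQ[OF qpoch_LIMSEQ[OF q], of "\<lambda>N. 2 * N"] by (simp add: strict_mono_def o_def)
  then have "(\<lambda>N. central_qbinomial q N j) \<longlonglongrightarrow> euler_prod q * (1 / euler_prod q) * (1 / euler_prod q)"
    unfolding central_qbinomial_def
    using inv_qpoch_tendsto[OF q filterlim_nat_add ev, of j] inv_qpoch_tendsto[OF q filterlim_nat_add ev, of "- j"]
    by (intro tendsto_mult) auto
  then show ?thesis using euler_prod_nonzero[OF q] by simp
qed

text \<open>Supplies the majorant, uniform in \<open>N\<close> and \<open>j\<close>, for the limit
  in the triple product: \<open>qpoch\<close> and its reciprocal both converge, hence are
  bounded.\<close>

lemma central_qbinomial_bounded:
  assumes q: "norm q < 1"
  obtains M where "\<And>N j. norm (central_qbinomial q N j) \<le> M"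
proof -
  have "Bseq (qpoch q)" using qpoch_LIMSEQ[OF q] convergentI convergent_imp_Bseq by blast
  then obtain A where A: "\<And>n. norm (qpoch q n) \<le> A" unfolding Bseq_def by auto
  have "(\<lambda>n. 1 / qpoch q n) \<longlonglongrightarrow> 1 / euler_prod q"
    by (intro tendsto_divide tendsto_const euler_prod_nonzero[OF q] qpoch_LIMSEQ[OF q])
  then have "Bseq (\<lambda>n. 1 / qpoch q n)" using convergentI convergent_imp_Bseq by blast
  then obtain B where B: "B > 0" "\<And>n. norm (1 / qpoch q n) \<le> B" unfolding Bseq_def by auto
  have B': "norm (inv_qpoch q n) \<le> B" for n unfolding inv_qpoch_def using B by auto
  have "norm (central_qbinomial q N j) \<le> A * B * B" for N j
    unfolding central_qbinomial_def norm_mult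
    by (intro mult_mono A B') (use B order_trans[OF norm_ge_zero A[of 0]] in auto)
  then show thesis by (rule that)
qed

text \<open>Dominated convergence in \<open>finite_triple_product\<close>, where every Gaussian
  coefficient tends to \<open>1 / euler_prod (p\<^sup>2)\<close>.\<close>

theorem jacobi_triple_product:
  fixes p z :: complex
  assumes p: "norm p < 1" "p \<noteq> 0" and z: "z \<noteq> 0"
  shows "(\<Sum>\<^sub>\<infinity>j. p powi (j\<^sup>2) * z powi j) =
    euler_prod (p\<^sup>2) * (prodinf (\<lambda>m. 1 + z * p ^ (2 * m + 1)) * prodinf (\<lambda>m. 1 + inverse z * p ^ (2 * m + 1)))"
proof -
  have p2: "norm (p\<^sup>2) < 1" using p norm_power_less_1 by simp
  obtain M where M: "\<And>N j. norm (central_qbinomial (p\<^sup>2) N j) \<le> M"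
    using central_qbinomial_bounded[OF p2] by metis
  have l1: "(\<lambda>N. \<Sum>\<^sub>\<infinity>j. central_qbinomial (p\<^sup>2) N j * (p powi (j\<^sup>2) * z powi j))
     \<longlonglongrightarrow> (\<Sum>\<^sub>\<infinity>j. 1 / euler_prod (p\<^sup>2) * (p powi (j\<^sup>2) * z powi j))"
  proof (rule infsum_dominated_tendsto)
    show "(\<lambda>j. M * norm (p powi (j\<^sup>2) * z powi j)) summable_on UNIV"
      by (intro summable_on_cmult_right summable_jacobi_terms p z)
    show "(\<lambda>N. central_qbinomial (p\<^sup>2) N j * (p powi (j\<^sup>2) * z powi j)) \<longlonglongrightarrow> 1 / euler_prod (p\<^sup>2) * (p powi (j\<^sup>2) * z powi j)" for j
      by (intro tendsto_mult tendsto_const central_qbinomial_tendsto p2)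
    show "norm (central_qbinomial (p\<^sup>2) N j * (p powi (j\<^sup>2) * z powi j)) \<le> M * norm (p powi (j\<^sup>2) * z powi j)" for N j
      using M by (subst norm_mult) (intro mult_right_mono, auto)
  qed
  have eq: "(\<Sum>\<^sub>\<infinity>j. central_qbinomial (p\<^sup>2) N j * (p powi (j\<^sup>2) * z powi j)) =
      (\<Prod>m<N. 1 + z * p ^ (2 * m + 1)) * (\<Prod>m<N. 1 + inverse z * p ^ (2 * m + 1))" for N
    using infsumI[OF finite_triple_product[OF p z, of N]] by (simp only: prod.distrib)
  have l2: "(\<lambda>N. (\<Prod>m<N. 1 + z * p ^ (2 * m + 1)) * (\<Prod>m<N. 1 + inverse z * p ^ (2 * m + 1)))
    \<longlonglongrightarrow> prodinf (\<lambda>m. 1 + z * p ^ (2 * m + 1)) * prodinf (\<lambda>m. 1 + inverse z * p ^ (2 * m + 1))"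
    using p by (intro tendsto_mult prodinf_geometric_LIMSEQ) auto
  have "(\<Sum>\<^sub>\<infinity>j. 1 / euler_prod (p\<^sup>2) * (p powi (j\<^sup>2) * z powi j)) = prodinf (\<lambda>m. 1 + z * p ^ (2 * m + 1)) * prodinf (\<lambda>m. 1 + inverse z * p ^ (2 * m + 1))"
    by (rule LIMSEQ_unique[OF l1[unfolded eq] l2])
  then have "(\<Sum>\<^sub>\<infinity>j. p powi (j\<^sup>2) * z powi j) / euler_prod (p\<^sup>2) = prodinf (\<lambda>m. 1 + z * p ^ (2 * m + 1)) * prodinf (\<lambda>m. 1 + inverse z * p ^ (2 * m + 1))"
    by (subst (asm) infsum_cmult_right') simp
  then show ?thesis using euler_prod_nonzero[OF p2] by (simp add: field_simps)
qed

section \<open>Gauss's product formulas for the theta constants\<close>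

lemma gauss_theta4:
  assumes p: "norm p < 1" "p \<noteq> 0"
  shows "(\<Sum>\<^sub>\<infinity>j. p powi (j\<^sup>2) * (-1) powi j) = euler_prod p ^ 2 / euler_prod (p\<^sup>2)"
proof -
  have p2: "norm (p\<^sup>2) < 1" using p norm_power_less_1 by simp
  have "(\<Sum>\<^sub>\<infinity>j. p powi (j\<^sup>2) * (-1) powi j) = euler_prod (p\<^sup>2) * (odd_prod p * odd_prod p)"
    using jacobi_triple_product[OF p, of "-1"] by (simp add: odd_prod_def)
  then show ?thesis using euler_prod_split[OF p(1)] euler_prod_nonzero[OF p2]
    by (simp add: power2_eq_square)
qed

lemma gauss_theta3:
  assumes p: "norm p < 1" "p \<noteq> 0"
  shows "(\<Sum>\<^sub>\<infinity>j. p powi (j\<^sup>2)) = euler_prod (p\<^sup>2) ^ 5 / (euler_prod p ^ 2 * euler_prod (p ^ 4) ^ 2)"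
proof -
  have p2: "norm (p\<^sup>2) < 1" "norm (p ^ 4) < 1" using p norm_power_less_1 by simp_all
  have "(\<Sum>\<^sub>\<infinity>j. p powi (j\<^sup>2)) = euler_prod (p\<^sup>2) * (odd_prod (- p) * odd_prod (- p))"
    using jacobi_triple_product[OF p, of 1] by (simp add: odd_prod_def)
  moreover have "euler_prod p = euler_prod (p\<^sup>2) * odd_prod p" by (rule euler_prod_split[OF p(1)])
  moreover have "euler_prod (p\<^sup>2) = euler_prod (p ^ 4) * odd_prod (p\<^sup>2)"
    using euler_prod_split[OF p2(1)] by (simp add: power_mult[symmetric])
  moreover have "odd_prod p * odd_prod (- p) = odd_prod (p\<^sup>2)" by (rule odd_prod_mult_minus[OF p(1)])
  moreover have "euler_prod p \<noteq> 0" "euler_prod (p\<^sup>2) \<noteq> 0" "euler_prod (p ^ 4) \<noteq> 0"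
    using euler_prod_nonzero p p2 by auto
  \<comment> \<open>Here \<open>m\<close> stands for \<open>odd_prod (- p)\<close>. Eliminating
    \<open>o1\<close> and \<open>o2\<close> gives \<open>m * (e1 * e4) = e2\<^sup>2\<close>, which
    is then squared.\<close>
  moreover have "e2 * (m * m) = e2 ^ 5 / (e1\<^sup>2 * e4\<^sup>2)" if "e1 = e2 * o1" "e2 = e4 * o2" "o1 * m = o2" "e1 \<noteq> 0" "e2 \<noteq> 0" "e4 \<noteq> 0"
    for e1 e2 e4 o1 o2 m :: complex
  proof -
    have "m * (e1 * e4) = e2 ^ 2"
      using that(1-3) by (simp add: power2_eq_square mult_ac)
    then have "(m * (e1 * e4))\<^sup>2 = (e2\<^sup>2)\<^sup>2" by simp
    then have "m * m * (e1\<^sup>2 * e4\<^sup>2) = e2 ^ 4" by (simp add: power_mult_distrib power2_eq_square power4_eq_xxxx mult_ac)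
    then show ?thesis using that by (simp add: field_simps eval_nat_numeral)
  qed
  ultimately show ?thesis by metis
qed

text \<open>The triple product at \<open>z = p\<close>. Its second product then begins with the
  factor \<open>1 + 1\<close>, the source of the 2.\<close>

lemma gauss_theta2:
  assumes p: "norm p < 1" "p \<noteq> 0"
  shows "(\<Sum>\<^sub>\<infinity>j. p powi (j\<^sup>2 + j)) = 2 * euler_prod (p ^ 4) ^ 2 / euler_prod (p\<^sup>2)"
proof -
  have p2: "norm (p\<^sup>2) < 1" using p norm_power_less_1 by simp
  define R where "R = prodinf (\<lambda>n. 1 + (p\<^sup>2) ^ Suc n)"
  have R: "R * euler_prod (p\<^sup>2) = euler_prod (p ^ 4)"
    using prodinf_one_plus_power[OF p2] by (simp add: R_def power_mult[symmetric])
  have l1: "(\<lambda>N. \<Prod>n<Suc N. 1 + (p\<^sup>2) ^ n) \<longlonglongrightarrow> prodinf (\<lambda>n. 1 + (p\<^sup>2) ^ n)"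
    using LIMSEQ_Suc[OF prodinf_geometric_LIMSEQ[OF p2, of "\<lambda>n. n" 1]] by simp
  have eq: "(\<Prod>n<Suc N. 1 + (p\<^sup>2) ^ n) = 2 * (\<Prod>n<N. 1 + (p\<^sup>2) ^ Suc n)" for N
    by (subst prod.lessThan_Suc_shift) simp
  have l2: "(\<lambda>N. 2 * (\<Prod>n<N. 1 + (p\<^sup>2) ^ Suc n)) \<longlonglongrightarrow> 2 * R"
    unfolding R_def using prodinf_geometric_LIMSEQ[OF p2, of Suc 1] by (intro tendsto_mult tendsto_const) simp
  have R2: "prodinf (\<lambda>n. 1 + (p\<^sup>2) ^ n) = 2 * R" by (rule LIMSEQ_unique[OF l1[unfolded eq] l2])
  have "(\<Sum>\<^sub>\<infinity>j. p powi (j\<^sup>2 + j)) = (\<Sum>\<^sub>\<infinity>j. p powi (j\<^sup>2) * p powi j)"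
    by (rule infsum_cong) (use p in \<open>auto intro: power_int_add\<close>)
  also have "\<dots> = euler_prod (p\<^sup>2) * (prodinf (\<lambda>m. 1 + p * p ^ (2 * m + 1)) * prodinf (\<lambda>m. 1 + inverse p * p ^ (2 * m + 1)))"
    by (rule jacobi_triple_product[OF p p(2)])
  also have "(\<lambda>m. 1 + p * p ^ (2 * m + 1)) = (\<lambda>n. 1 + (p\<^sup>2) ^ Suc n)"
    by (simp add: power_mult power2_eq_square power_mult_distrib mult_ac)
  also have "(\<lambda>m. 1 + inverse p * p ^ (2 * m + 1)) = (\<lambda>n. 1 + (p\<^sup>2) ^ n)"
    using p by (simp add: power_mult fun_eq_iff)
  finally show ?thesis unfolding R2 R_def[symmetric] R[symmetric] using euler_prod_nonzero[OF p2]
    by (simp add: power2_eq_square)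
qed

section \<open>A uniqueness principle for modular forms\<close>

lemma upper_half_plane_domain: "open upper_half_plane" "connected upper_half_plane"
  by (auto simp: open_halfspace_Im_gt convex_halfspace_Im_gt convex_connected)

text \<open>Absence of zero divisors: \<open>f\<close> is nonzero on a neighbourhood of
  \<open>z0\<close>, so \<open>g\<close> vanishes there, and analytic continuation spreads this over
  the connected set.\<close>

lemma holomorphic_mult_eq_0:
  assumes f: "f holomorphic_on S" and g: "g holomorphic_on S" and S: "open S" "connected S"
    and fg: "\<And>z. z \<in> S \<Longrightarrow> f z * g z = 0" and z0: "z0 \<in> S" "f z0 \<noteq> (0::complex)" and z: "z \<in> S"
  shows "g z = 0"
proof -
  have "open (f -` (- {0}) \<inter> S)"
    using continuous_on_open_vimage[OF S(1), of f] holomorphic_on_imp_continuous_on[OF f]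
      open_Compl[OF closed_singleton[of 0]] by blast
  then show ?thesis
    using analytic_continuation_open[of "f -` (- {0}) \<inter> S" S g "\<lambda>_. 0" z] z0 z S g fg by auto
qed

lemma norm_periodic_int:
  fixes f :: "complex \<Rightarrow> complex"
  assumes T: "\<And>t. Im t > 0 \<Longrightarrow> norm (f (t + 1)) = norm (f t)" and t: "Im t > 0"
  shows "norm (f (t + of_int n)) = norm (f t)"
proof (induction n rule: int_induct[where k = 0])
  case (step1 i)
  then show ?case using T[of "t + of_int i"] t by (simp add: algebra_simps)
next
  case (step2 i)
  then show ?case using T[of "t + of_int (i - 1)"] t by (simp add: algebra_simps)
qed simp

text \<open>Inverting a point with \<open>\<bar>Re t\<bar> \<le> 1/2\<close> and \<open>Im t < 1/2\<close> more than doubles its imaginary part.\<close>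

lemma modular_reduction:
  fixes f :: "complex \<Rightarrow> complex"
  assumes T: "\<And>t. Im t > 0 \<Longrightarrow> norm (f (t + 1)) = norm (f t)"
    and S: "\<And>t. Im t > 0 \<Longrightarrow> norm (f (- (1 / t))) = norm (f t)"
    and t: "Im t > 0"
  obtains t' where "Im t' \<ge> 1/2" "\<bar>Re t'\<bar> \<le> 1/2" "norm (f t') = norm (f t)"
proof -
  have "\<exists>t'. Im t' \<ge> 1/2 \<and> \<bar>Re t'\<bar> \<le> 1/2 \<and> norm (f t') = norm (f t)" if "Im t > 0" "Im t \<ge> (1/2) ^ n" for n t
    using that
  proof (induction n arbitrary: t)
    case (0 t)
    have "norm (f (t + of_int (- round (Re t)))) = norm (f t)" by (rule norm_periodic_int[of f, OF T]) (use 0 in auto)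
    moreover have "\<bar>Re (t + of_int (- round (Re t)))\<bar> \<le> 1/2"
      using of_int_round_abs_le[of "Re t"] by (simp add: abs_minus_commute)
    moreover have "Im (t + of_int (- round (Re t))) \<ge> 1/2" using 0 by simp
    ultimately show ?case by blast
  next
    case (Suc n t)
    define u where "u = t + of_int (- round (Re t))"
    have u: "norm (f u) = norm (f t)" unfolding u_def by (rule norm_periodic_int[of f, OF T]) (use Suc in auto)
    have Re: "\<bar>Re u\<bar> \<le> 1/2"
      using of_int_round_abs_le[of "Re t"] by (simp add: u_def abs_minus_commute)
    have Im: "Im u = Im t" by (simp add: u_def)
    show ?case
    proof (cases "Im u \<ge> 1/2")
      case True
      then show ?thesis using u Re by blast
    next
      case False
      have pos: "Im u > 0" using Suc Im by simp
      have "(Re u)\<^sup>2 \<le> (1/2)\<^sup>2" "(Im u)\<^sup>2 \<le> (1/2)\<^sup>2"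
        using Re False pos by (auto simp: abs_le_square_iff[symmetric])
      then have "(norm u)\<^sup>2 \<le> 1/2" unfolding cmod_power2 by (simp add: power_divide)
      moreover have "(norm u)\<^sup>2 > 0" using pos by auto
      ultimately have "2 * Im u \<le> Im u / (norm u)\<^sup>2" using pos by (simp add: field_simps)
      then have "Im (- (1 / u)) \<ge> 2 * Im u" unfolding Im_minus_inverse .
      then have "Im (- (1 / u)) > 0" "Im (- (1 / u)) \<ge> (1/2) ^ n" using Suc pos Im by auto
      from Suc.IH[OF this] show ?thesis using S[OF pos] u by metis
    qed
  qed
  moreover obtain n where "(1/2) ^ n < Im t" using real_arch_pow_inv[OF t, of "1/2"] by auto
  ultimately show thesis using that t less_imp_le by blast
qed

text \<open>Because of the decay, a nonzero modulus attains its maximum over a strip on a compact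
  box, and \<open>modular_reduction\<close> makes this a maximum over the half-plane. Then
  \<open>f\<close> is constant, and the decay rules out a nonzero constant. Invariance is asked of
  the modulus only, which makes sign characters harmless.\<close>

theorem modular_invariant_cusp_zero:
  fixes f :: "complex \<Rightarrow> complex"
  assumes hol: "f holomorphic_on upper_half_plane"
    and T: "\<And>t. Im t > 0 \<Longrightarrow> norm (f (t + 1)) = norm (f t)"
    and S: "\<And>t. Im t > 0 \<Longrightarrow> norm (f (- (1 / t))) = norm (f t)"
    and decay: "\<And>t. Im t \<ge> 1 \<Longrightarrow> norm (f t) \<le> M * exp (- (s * Im t))" and s: "s > 0"
    and t: "Im t > 0"
  shows "f t = 0"
proof (rule ccontr)
  assume nz: "f t \<noteq> 0"
  have "filterlim (\<lambda>y. s * y) at_top at_top"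
    by (rule filterlim_tendsto_pos_mult_at_top[OF tendsto_const s filterlim_ident])
  then have "filterlim (\<lambda>y. - (s * y)) at_bot at_top" by (simp only: filterlim_uminus_at_top)
  then have "((\<lambda>y. M * exp (- (s * y))) \<longlongrightarrow> M * 0) at_top"
    by (intro tendsto_mult tendsto_const filterlim_compose[OF exp_at_bot])
  then have ev: "\<forall>\<^sub>F y in at_top. M * exp (- (s * y)) < e" if "e > 0" for e
    using that by (simp add: order_tendstoD(2))
  have small: "\<exists>Y\<ge>1. \<forall>t. Im t \<ge> Y \<longrightarrow> norm (f t) < e" if e: "e > 0" for e
  proof -
    from ev[OF e] obtain Y0 where Y0: "\<forall>y\<ge>Y0. M * exp (- (s * y)) < e"
      unfolding eventually_at_top_linorder by blast
    have "norm (f t) < e" if "Im t \<ge> max 1 Y0" for t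
      by (rule le_less_trans[OF decay]) (use Y0 that in auto)
    then show ?thesis by (intro exI[of _ "max 1 Y0"]) auto
  qed
  \<comment> \<open>Points above height \<open>Y\<close> have a smaller modulus than the given point
    \<open>t\<close>, so they cannot compete with the maximum over the box \<open>K\<close>.\<close>
  obtain Y where Y: "Y \<ge> 1" and Y2: "\<And>u. Im u \<ge> Y \<Longrightarrow> norm (f u) < norm (f t)"
    using small[of "norm (f t)"] nz by auto
  define K where "K = cbox (Complex (-1/2) (1/2)) (Complex (1/2) Y)"
  have K: "u \<in> K \<longleftrightarrow> \<bar>Re u\<bar> \<le> 1/2 \<and> 1/2 \<le> Im u \<and> Im u \<le> Y" for u
    by (auto simp: K_def in_cbox_complex_iff abs_le_iff)
  have KH: "K \<subseteq> upper_half_plane" by (auto simp: K)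
  have "\<exists>t1\<in>K. \<forall>u\<in>K. norm (f u) \<le> norm (f t1)"
  proof (rule continuous_attains_sup)
    show "compact K" by (simp add: K_def)
    show "K \<noteq> {}" using K[of "\<i>"] Y by auto
    show "continuous_on K (\<lambda>u. norm (f u))"
      by (intro continuous_on_norm holomorphic_on_imp_continuous_on holomorphic_on_subset[OF hol KH])
  qed
  then obtain t1 where t1: "t1 \<in> K" "\<And>u. u \<in> K \<Longrightarrow> norm (f u) \<le> norm (f t1)" by blast
  have red: "norm (f u) \<le> norm (f t1) \<or> norm (f u) < norm (f t)" if u: "Im u > 0" for u
  proof -
    obtain u' where u': "Im u' \<ge> 1/2" "\<bar>Re u'\<bar> \<le> 1/2" "norm (f u') = norm (f u)"
      using modular_reduction[OF T S u] by blast
    show ?thesis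
    proof (cases "Im u' \<le> Y")
      case True
      then show ?thesis using t1(2)[of u'] u' K by auto
    next
      case False
      then show ?thesis using Y2[of u'] u' by auto
    qed
  qed
  have "norm (f t) \<le> norm (f t1)" using red[OF t] by auto
  then have max: "norm (f u) \<le> norm (f t1)" if "Im u > 0" for u using red[OF that] by auto
  have "f constant_on upper_half_plane"
    by (rule maximum_modulus_principle[OF hol upper_half_plane_domain upper_half_plane_domain(1) order_refl, of t1])
       (use max t1 KH in auto)
  then obtain c where c: "\<And>u. Im u > 0 \<Longrightarrow> f u = c" by (auto simp: constant_on_def)
  have "Im (\<i> * of_real Y) > 0" using Y by simp
  then show False using Y2[of "\<i> * of_real Y"] c[of "\<i> * of_real Y"] c[OF t] by simp
qed

text \<open>Translation and inversion permute \<open>a t\<close>, \<open>b t\<close> and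
  \<open>b (t + 1)\<close> up to signs and factors \<open>t ^ 12\<close>. Their product has weight
  36, like the cube of \<open>D\<close>, so the quotient falls under the preceding principle once
  its decay is checked.\<close>

lemma gamma02_form_unique:
  fixes a b D :: "complex \<Rightarrow> complex"
  assumes hol: "a holomorphic_on upper_half_plane" "b holomorphic_on upper_half_plane" "D holomorphic_on upper_half_plane"
    and D0: "\<And>t. Im t > 0 \<Longrightarrow> D t \<noteq> 0"
    and DT: "\<And>t. Im t > 0 \<Longrightarrow> D (t + 1) = D t" and DS: "\<And>t. Im t > 0 \<Longrightarrow> D (- (1 / t)) = t ^ 12 * D t"
    and Dlow: "\<And>t. Im t \<ge> 1 \<Longrightarrow> norm (D t) \<ge> m * exp (- (2 * pi * Im t))" and m: "m > 0"
    and aT: "\<And>t. Im t > 0 \<Longrightarrow> a (t + 1) = a t" and aS: "\<And>t. Im t > 0 \<Longrightarrow> a (- (1 / t)) = t ^ 12 * b t"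
    and bT: "\<And>t. Im t > 0 \<Longrightarrow> b (t + 2) = - b t"
    and ab: "\<And>t. Im t \<ge> 1 \<Longrightarrow> norm (a t) \<le> Ma * exp (- (4 * pi * Im t))"
    and bb: "\<And>t. Im t \<ge> 1 \<Longrightarrow> norm (b t) \<le> Mb * exp (- (3/2 * pi * Im t))"
    and t: "Im t > 0"
  shows "a t = 0"
proof (rule ccontr)
  assume nz: "a t \<noteq> 0"
  have bS: "b (- (1 / t)) = t ^ 12 * a t" if t: "Im t > 0" for t
  proof -
    have t0: "t \<noteq> 0" using t by auto
    have "a t = (- (1 / t)) ^ 12 * b (- (1 / t))" using aS[OF Im_minus_inverse_pos[OF t]] t0 by simp
    then show ?thesis using t0 by (simp add: power_divide)
  qed
  have dS: "b (- (1 / t) + 1) = - (t ^ 12 * b (t + 1))" if t: "Im t > 0" for t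
  proof -
    have t0: "t \<noteq> 0" "t - 1 \<noteq> 0" using t by (auto simp: complex_eq_iff)
    \<comment> \<open>With \<open>S\<close> for inversion and \<open>T\<close> for translation by 1,
      this follows the relation \<open>T S = S T^-1 S T^-1\<close>: here \<open>u\<close> is
      \<open>S (t - 1)\<close>, \<open>s\<close> is \<open>u - 1\<close>, and \<open>S s\<close> is
      \<open>S t + 1\<close>.\<close>
    define u where "u = - (1 / (t - 1))"
    have u: "Im u > 0" unfolding u_def by (rule Im_minus_inverse_pos) (use t in simp)
    define s where "s = u - 1"
    have s: "Im s > 0" using u by (simp add: s_def)
    have st: "s * (t - 1) = - t" using t0 by (simp add: s_def u_def field_simps)
    have s0: "s \<noteq> 0" using s by auto
    have "- (1 / s) = - (1 / t) + 1" using st s0 t0 by (simp add: field_simps)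
    then have "b (- (1 / t) + 1) = s ^ 12 * a s" using bS[OF s] by simp
    also have "a s = a u" using aT[OF s] by (simp add: s_def)
    also have "a u = (t - 1) ^ 12 * b (t - 1)" unfolding u_def by (rule aS) (use t in simp)
    also have "b (t - 1) = - b (t + 1)" using bT[of "t - 1"] t by (simp add: algebra_simps)
    also have "s ^ 12 * ((t - 1) ^ 12 * - b (t + 1)) = - ((s * (t - 1)) ^ 12 * b (t + 1))" by (simp add: power_mult_distrib)
    finally show ?thesis unfolding st by simp
  qed
  have sh: "(\<lambda>t. b (t + 1)) holomorphic_on upper_half_plane"
  proof -
    have "(b \<circ> (\<lambda>t. t + 1)) holomorphic_on upper_half_plane"
      by (rule holomorphic_on_compose[OF _ holomorphic_on_subset[OF hol(2)]]) (auto intro!: holomorphic_intros)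
    then show ?thesis by (simp add: o_def)
  qed
  define f where "f = (\<lambda>t. a t * b t * b (t + 1) / D t ^ 3)"
  have f0: "f t = 0" if "Im t > 0" for t
  proof (rule modular_invariant_cusp_zero[of f "Ma * Mb * Mb / m ^ 3" pi])
    show "f holomorphic_on upper_half_plane"
      unfolding f_def by (intro holomorphic_intros hol sh) (use D0 in auto)
    show "norm (f (t + 1)) = norm (f t)" if "Im t > 0" for t
      using bT[OF that] by (simp add: f_def aT[OF that] DT[OF that] norm_mult norm_divide add.assoc)
    show "norm (f (- (1 / t))) = norm (f t)" if t: "Im t > 0" for t
    proof -
      have "t \<noteq> 0" using t by auto
      have "f (- (1 / t)) = - ((t ^ 12) ^ 3 * (a t * b t * b (t + 1))) / ((t ^ 12) ^ 3 * D t ^ 3)"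
        unfolding f_def aS[OF t] bS[OF t] dS[OF t] DS[OF t] by (simp add: power_mult_distrib power3_eq_cube mult_ac)
      also have "\<dots> = - f t" using \<open>t \<noteq> 0\<close> by (simp add: f_def)
      finally show ?thesis by simp
    qed
    show "norm (f t) \<le> Ma * Mb * Mb / m ^ 3 * exp (- (pi * Im t))" if t: "Im t \<ge> 1" for t
    proof -
      have M0: "0 \<le> Ma * exp (- (4 * pi * Im t))" "0 \<le> Mb * exp (- (3/2 * pi * Im t))"
        using order_trans[OF norm_ge_zero ab[OF t]] order_trans[OF norm_ge_zero bb[OF t]] by auto
      have b1: "norm (b (t + 1)) \<le> Mb * exp (- (3/2 * pi * Im t))" using bb[of "t + 1"] t by simp
      have "norm (f t) \<le> (Ma * exp (- (4 * pi * Im t))) * (Mb * exp (- (3/2 * pi * Im t))) * (Mb * exp (- (3/2 * pi * Im t))) / (m * exp (- (2 * pi * Im t))) ^ 3"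
        unfolding f_def norm_divide norm_mult norm_power
        by (intro frac_le mult_mono power_mono ab bb b1 t Dlow mult_nonneg_nonneg norm_ge_zero M0) (use m in auto)
      also have "\<dots> = Ma * Mb * Mb / m ^ 3 * (exp (- (4 * pi * Im t)) * exp (- (3/2 * pi * Im t)) * exp (- (3/2 * pi * Im t)) / exp (- (2 * pi * Im t)) ^ 3)"
        by (simp add: power_mult_distrib)
      \<comment> \<open>In units of \<open>pi * Im t\<close> the exponents add up to 4 + 3/2 + 3/2 -
        3 * 2 = 1, which is positive.\<close>
      also have "exp (- (4 * pi * Im t)) * exp (- (3/2 * pi * Im t)) * exp (- (3/2 * pi * Im t)) / exp (- (2 * pi * Im t)) ^ 3 = exp (- (pi * Im t))"
        unfolding exp_of_nat_mult[symmetric] exp_add[symmetric] exp_diff[symmetric] by (rule arg_cong[of _ _ exp]) (simp add: algebra_simps)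
      finally show ?thesis .
    qed
  qed (use that pi_gt_zero in auto)
  have "a t * (b t * b (t + 1)) = 0" if "Im t > 0" for t
    using f0[OF that] D0[OF that] by (simp add: f_def)
  \<comment> \<open>Zero divisors are excluded twice: \<open>a\<close> is nonzero at
    \<open>t\<close>, hence \<open>b\<close> is nonzero at \<open>- (1 / t)\<close>. So the third
    factor would vanish identically, which fails at \<open>u = - (1 / t) - 1\<close>.\<close>
  then have "b u * b (u + 1) = 0" if "Im u > 0" for u
    by (intro holomorphic_mult_eq_0[OF hol(1) _ upper_half_plane_domain, of "\<lambda>t. b t * b (t + 1)" t u])
       (use nz t that in \<open>auto intro!: holomorphic_intros hol sh\<close>)
  moreover have bnz: "b (- (1 / t)) \<noteq> 0" using bS[OF t] nz t by auto
  ultimately have "b (u + 1) = 0" if "Im u > 0" for u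
    by (intro holomorphic_mult_eq_0[OF hol(2) sh upper_half_plane_domain, of "- (1 / t)" u])
       (use Im_minus_inverse_pos[OF t] that in \<open>auto simp del: Im_divide\<close>)
  from this[of "- (1 / t) - 1"] bnz Im_minus_inverse_pos[OF t] show False by simp
qed

section \<open>Theta constants\<close>

text \<open>Split \<open>exp (- (y * e))\<close> into \<open>exp (- ((y - \<delta>) * e))\<close>,
  where \<open>e \<ge> s\<close> yields the decay, and \<open>exp (- (\<delta> * e))\<close>, whose
  sum does not depend on \<open>y\<close>. Theta constants and lattice sums are both estimated this
  way.\<close>

lemma infsum_exp_decay:
  fixes e :: "'a \<Rightarrow> real" and g :: "'a \<Rightarrow> complex"
  assumes sum: "(\<lambda>x. exp (- (\<delta> * e x))) summable_on A" and e: "\<And>x. x \<in> A \<Longrightarrow> e x \<ge> s"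
    and g: "\<And>x. x \<in> A \<Longrightarrow> norm (g x) \<le> exp (- (y * e x))" and y: "y \<ge> \<delta>"
  shows "norm (infsum g A) \<le> (exp (\<delta> * s) * (\<Sum>\<^sub>\<infinity>x\<in>A. exp (- (\<delta> * e x)))) * exp (- (s * y))"
proof -
  have le: "norm (g x) \<le> exp (\<delta> * s) * exp (- (s * y)) * exp (- (\<delta> * e x))" if x: "x \<in> A" for x
  proof -
    have "(y - \<delta>) * s \<le> (y - \<delta>) * e x" using e[OF x] y by (intro mult_left_mono) auto
    then have "- (y * e x) \<le> \<delta> * s + - (s * y) + - (\<delta> * e x)" by (simp add: algebra_simps)
    then have "exp (- (y * e x)) \<le> exp (\<delta> * s) * exp (- (s * y)) * exp (- (\<delta> * e x))"
      unfolding exp_add[symmetric] by simp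
    then show ?thesis using g[OF x] by linarith
  qed
  have cs: "(\<lambda>x. exp (\<delta> * s) * exp (- (s * y)) * exp (- (\<delta> * e x))) summable_on A"
    by (rule summable_on_cmult_right[OF sum])
  have "(\<lambda>x. norm (g x)) summable_on A"
    by (rule summable_on_comparison_test[OF cs le]) auto
  then have gs: "g summable_on A" by (rule abs_summable_summable)
  have "norm (infsum g A) \<le> (\<Sum>\<^sub>\<infinity>x\<in>A. exp (\<delta> * s) * exp (- (s * y)) * exp (- (\<delta> * e x)))"
    by (rule norm_infsum_le[OF has_sum_infsum[OF gs] has_sum_infsum[OF cs] le])
  also have "\<dots> = exp (\<delta> * s) * exp (- (s * y)) * (\<Sum>\<^sub>\<infinity>x\<in>A. exp (- (\<delta> * e x)))"
    by (rule infsum_cmult_right')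
  finally show ?thesis by (simp add: mult_ac)
qed

lemma norm_thterm_real:
  "norm (thterm (of_real x) (of_real y) t n) = exp (- (Im t * (pi * (of_int n + x)\<^sup>2)))"
proof -
  have "(of_int n + of_real x :: complex)\<^sup>2 = of_real ((of_int n + x)\<^sup>2)" by simp
  then show ?thesis unfolding thterm_def norm_exp_eq_Re by (simp add: mult_ac)
qed

lemma theta_decay:
  assumes "\<delta> > 0" and "\<And>n. n \<in> A \<Longrightarrow> (of_int n + x)\<^sup>2 \<ge> s"
  obtains M where "\<And>t. Im t \<ge> \<delta> \<Longrightarrow> norm (infsum (thterm (of_real x) (of_real y) t) A) \<le> M * exp (- (pi * s * Im t))"
proof -
  have "(\<lambda>n. norm (thterm (of_real x) (of_real y) (\<i> * of_real \<delta>) n)) summable_on A"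
    by (rule summable_on_subset[OF thterm_abs_summable]) (use assms in auto)
  then have s: "(\<lambda>n. exp (- (\<delta> * (pi * (of_int n + x)\<^sup>2)))) summable_on A"
    unfolding norm_thterm_real by simp
  show thesis
    by (rule that, rule infsum_exp_decay[OF s, of "pi * s"]) (use assms norm_thterm_real in auto)
qed

definition theta2 :: "complex \<Rightarrow> complex" where "theta2 = theta (1/2) 0"
definition theta3 :: "complex \<Rightarrow> complex" where "theta3 = theta 0 0"
definition theta4 :: "complex \<Rightarrow> complex" where "theta4 = theta 0 (1/2)"

lemma theta234_holomorphic:
  "theta2 holomorphic_on upper_half_plane" "theta3 holomorphic_on upper_half_plane" "theta4 holomorphic_on upper_half_plane"
  using theta_holomorphic[of "1/2" 0] theta_holomorphic[of 0 0] theta_holomorphic[of 0 "1/2"]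
  by (simp_all add: theta2_def theta3_def theta4_def)

lemma exp_pi_i_square: "exp (of_real pi * \<i> * (of_int n)\<^sup>2) = exp (of_real pi * \<i> * of_int n)"
proof -
  have "even (n\<^sup>2 - n)" by simp
  then obtain k where k: "n\<^sup>2 - n = 2 * k" by blast
  have "(of_int n)\<^sup>2 = (of_int n + 2 * of_int k :: complex)"
    using arg_cong[OF k, of "of_int :: int \<Rightarrow> complex"] by (simp add: algebra_simps)
  then have "exp (of_real pi * \<i> * (of_int n)\<^sup>2) = exp (of_real pi * \<i> * of_int n + 2 * of_real pi * \<i> * of_int k)"
    by (simp add: algebra_simps)
  then show ?thesis unfolding exp_add exp_2pi_i_int by simp
qed

lemma theta3_plus_1: "theta3 (t + 1) = theta4 t"
  unfolding theta3_def theta4_def theta_def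
proof (rule infsum_cong)
  fix n :: int
  have "thterm 0 0 (t + 1) n = exp (of_real pi * \<i> * t * (of_int n)\<^sup>2) * exp (of_real pi * \<i> * (of_int n)\<^sup>2)"
    unfolding thterm_def exp_add[symmetric] by (simp add: algebra_simps)
  also have "\<dots> = thterm 0 (1/2) t n"
    unfolding exp_pi_i_square unfolding thterm_def exp_add[symmetric] by (simp add: mult_ac)
  finally show "thterm 0 0 (t + 1) n = thterm 0 (1/2) t n" .
qed

lemma theta4_plus_1: "theta4 (t + 1) = theta3 t"
proof -
  have "thterm 0 (1/2) (t + 1) n = thterm 0 0 t n" for n
  proof -
    have "exp (of_real pi * \<i> * of_int n) * exp (of_real pi * \<i> * of_int n) = 1"
      using exp_2pi_i_int[of n] by (simp add: exp_add[symmetric] mult_ac)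
    moreover have "thterm 0 (1/2) (t + 1) n = thterm 0 0 t n * (exp (of_real pi * \<i> * (of_int n)\<^sup>2) * exp (of_real pi * \<i> * of_int n))"
      unfolding thterm_def exp_add[symmetric] by (simp add: algebra_simps)
    ultimately show ?thesis by (simp add: exp_pi_i_square)
  qed
  then show ?thesis unfolding theta3_def theta4_def theta_def by (intro infsum_cong) simp
qed

lemma theta2_plus_1: "theta2 (t + 1) = exp (of_real pi * \<i> / 4) * theta2 t"
proof -
  have "thterm (1/2) 0 (t + 1) n = exp (of_real pi * \<i> / 4) * thterm (1/2) 0 t n" for n
  proof -
    have "exp (of_real pi * \<i> * (of_int n + 1/2)\<^sup>2) = exp (of_real pi * \<i> * (of_int n)\<^sup>2 + of_real pi * \<i> * of_int n + of_real pi * \<i> / 4)"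
      by (rule arg_cong[of _ _ exp]) (simp add: power2_eq_square algebra_simps)
    also have "\<dots> = exp (of_real pi * \<i> * of_int n + of_real pi * \<i> * of_int n) * exp (of_real pi * \<i> / 4)"
      unfolding exp_add exp_pi_i_square by simp
    also have "of_real pi * \<i> * of_int n + of_real pi * \<i> * of_int n = 2 * of_real pi * \<i> * of_int n" by simp
    finally have *: "exp (of_real pi * \<i> * (of_int n + 1/2)\<^sup>2) = exp (of_real pi * \<i> / 4)"
      by (simp add: exp_2pi_i_int)
    have "thterm (1/2) 0 (t + 1) n = exp (of_real pi * \<i> * (of_int n + 1/2)\<^sup>2) * thterm (1/2) 0 t n"
      unfolding thterm_def exp_add[symmetric] by (rule arg_cong[of _ _ exp]) (simp add: algebra_simps)
    then show ?thesis unfolding * .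
  qed
  then show ?thesis unfolding theta2_def theta_def by (subst infsum_cmult_right'[symmetric]) (intro infsum_cong)
qed

lemma csqrt_power4: "csqrt z ^ 4 = z\<^sup>2"
  using power2_csqrt[of z] by (metis mult_2 numeral_Bit0 power_add power2_eq_square)

text \<open>Fourth powers remove the square root, since
  \<open>csqrt (- \<i> * t) ^ 4 = - (t\<^sup>2)\<close> whatever the branch. The formula for
  \<open>theta2\<close> is the one for \<open>theta4\<close> read at
  \<open>- (1 / t)\<close>.\<close>

lemma theta_inversion_power4:
  assumes t: "Im t > 0"
  shows "theta3 (- (1 / t)) ^ 4 = - (t\<^sup>2) * theta3 t ^ 4" (is ?th3)
    and "theta4 (- (1 / t)) ^ 4 = - (t\<^sup>2) * theta2 t ^ 4" (is ?th4)
    and "theta2 (- (1 / t)) ^ 4 = - (t\<^sup>2) * theta4 t ^ 4" (is ?th2)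
proof -
  have t0: "t \<noteq> 0" using t by auto
  have inv: "theta 0 (of_real x) (- (1 / t)) ^ 4 = - (t\<^sup>2) * theta (of_real x) 0 t ^ 4" if t: "Im t > 0" for x t
  proof -
    have "t \<noteq> 0" using t by auto
    then have "theta 0 (of_real x) (- (1 / t)) = csqrt (- \<i> * t) * theta (of_real x) 0 t"
      using theta_inversion[OF t, of x] by simp
    then have "theta 0 (of_real x) (- (1 / t)) ^ 4 = csqrt (- \<i> * t) ^ 4 * theta (of_real x) 0 t ^ 4"
      by (simp only: power_mult_distrib)
    also have "csqrt (- \<i> * t) ^ 4 = - (t\<^sup>2)" unfolding csqrt_power4 by (simp add: power_mult_distrib)
    finally show ?thesis .
  qed
  show ?th3 using inv[OF t, of 0] by (simp add: theta3_def)
  show ?th4 using inv[OF t, of "1/2"] by (simp add: theta2_def theta4_def)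
  have "theta4 t ^ 4 = - ((- (1 / t))\<^sup>2) * theta2 (- (1 / t)) ^ 4"
    using inv[OF Im_minus_inverse_pos[OF t], of "1/2"] t0 by (simp add: theta2_def theta4_def)
  then show ?th2 using t0 by (simp add: power_divide field_simps)
qed

lemma nome_props:
  assumes "Im t > 0"
  shows "norm (exp (of_real pi * \<i> * t)) < 1" "exp (of_real pi * \<i> * t) \<noteq> 0"
  using assms by (simp_all add: norm_exp_eq_Re)

lemma theta_products:
  assumes t: "Im t > 0"
  defines "p \<equiv> exp (of_real pi * \<i> * t)"
  shows "theta3 t = euler_prod (p\<^sup>2) ^ 5 / (euler_prod p ^ 2 * euler_prod (p ^ 4) ^ 2)"
    and "theta4 t = euler_prod p ^ 2 / euler_prod (p\<^sup>2)"
    and "theta2 t = exp (of_real pi * \<i> * t / 4) * (2 * euler_prod (p ^ 4) ^ 2 / euler_prod (p\<^sup>2))"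
proof -
  have p: "norm p < 1" "p \<noteq> 0" unfolding p_def using nome_props[OF t] by auto
  have pw: "p powi n = exp (of_real pi * \<i> * t * of_int n)" for n
    unfolding p_def exp_power_int by (simp add: mult_ac)
  have "theta3 t = (\<Sum>\<^sub>\<infinity>j. p powi (j\<^sup>2))"
    unfolding theta3_def theta_def pw by (intro infsum_cong) (simp add: thterm_def)
  then show "theta3 t = euler_prod (p\<^sup>2) ^ 5 / (euler_prod p ^ 2 * euler_prod (p ^ 4) ^ 2)"
    using gauss_theta3[OF p] by simp
  have m1: "(-1) powi j = exp (of_real pi * \<i> * of_int j)" for j
    using exp_power_int[of "of_real pi * \<i>" j] by (simp add: mult.commute)
  have "theta4 t = (\<Sum>\<^sub>\<infinity>j. p powi (j\<^sup>2) * (-1) powi j)"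
    unfolding theta4_def theta_def pw m1 by (rule infsum_cong) (simp add: thterm_def exp_add mult_ac)
  then show "theta4 t = euler_prod p ^ 2 / euler_prod (p\<^sup>2)"
    using gauss_theta4[OF p] by simp
  have "thterm (1/2) 0 t n = exp (of_real pi * \<i> * t / 4) * p powi (n\<^sup>2 + n)" for n
    unfolding thterm_def pw exp_add[symmetric]
    by (rule arg_cong[of _ _ exp]) (simp add: power2_eq_square algebra_simps)
  then have "theta2 t = exp (of_real pi * \<i> * t / 4) * (\<Sum>\<^sub>\<infinity>j. p powi (j\<^sup>2 + j))"
    unfolding theta2_def theta_def by (subst infsum_cmult_right'[symmetric]) (intro infsum_cong)
  then show "theta2 t = exp (of_real pi * \<i> * t / 4) * (2 * euler_prod (p ^ 4) ^ 2 / euler_prod (p\<^sup>2))"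
    using gauss_theta2[OF p] by simp
qed

section \<open>The discriminant form\<close>

definition Delta :: "complex \<Rightarrow> complex" where
  "Delta t = exp (2 * of_real pi * \<i> * t) * euler_prod (exp (2 * of_real pi * \<i> * t)) ^ 24"

lemma theta_euler_nonzero:
  assumes "norm p < 1" shows "euler_prod p \<noteq> 0" "euler_prod (p\<^sup>2) \<noteq> 0" "euler_prod (p ^ 4) \<noteq> 0"
  using assms euler_prod_nonzero norm_power_less_1 by auto

text \<open>The product formulas collapse \<open>theta2 t * theta3 t * theta4 t\<close> to
  \<open>2 * r * euler_prod (p\<^sup>2) ^ 3\<close>, twice the cube of the eta function; the eighth
  power is \<open>256 * Delta t\<close>. Holomorphy and weight 12 of \<open>Delta\<close> are read
  off from the theta side.\<close>

lemma Delta_eq_theta: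
  assumes t: "Im t > 0"
  shows "Delta t = (theta2 t ^ 4 * theta3 t ^ 4 * theta4 t ^ 4)\<^sup>2 / 256"
proof -
  define p where "p = exp (of_real pi * \<i> * t)"
  define r where "r = exp (of_real pi * \<i> * t / 4)"
  have p: "norm p < 1" unfolding p_def using nome_props[OF t] by auto
  note nz = theta_euler_nonzero[OF p]
  have r: "r ^ 8 = exp (2 * of_real pi * \<i> * t)" unfolding r_def exp_of_nat_mult[symmetric] by (simp add: mult_ac)
  have p2: "p\<^sup>2 = exp (2 * of_real pi * \<i> * t)" unfolding p_def exp_of_nat_mult[symmetric] by (simp add: mult_ac)
  have "theta2 t * theta3 t * theta4 t = 2 * r * euler_prod (p\<^sup>2) ^ 3"
    unfolding theta_products[OF t, folded p_def r_def] using nz by (simp add: field_simps eval_nat_numeral)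
  then have "(theta2 t * theta3 t * theta4 t) ^ 8 = 256 * r ^ 8 * euler_prod (p\<^sup>2) ^ 24"
    by (simp add: power_mult_distrib power_mult[symmetric])
  moreover have "(theta2 t ^ 4 * theta3 t ^ 4 * theta4 t ^ 4)\<^sup>2 = (theta2 t * theta3 t * theta4 t) ^ 8"
    by (simp add: power_mult_distrib power_mult[symmetric])
  ultimately show ?thesis by (simp add: Delta_def r p2)
qed

lemma Delta_holomorphic: "Delta holomorphic_on upper_half_plane"
proof -
  have "(\<lambda>t. (theta2 t ^ 4 * theta3 t ^ 4 * theta4 t ^ 4)\<^sup>2 / 256) holomorphic_on upper_half_plane"
    by (intro holomorphic_intros theta234_holomorphic) auto
  then show ?thesis by (rule holomorphic_transform) (simp add: Delta_eq_theta)
qed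

lemma Delta_nonzero: "Im t > 0 \<Longrightarrow> Delta t \<noteq> 0"
  unfolding Delta_def by (simp add: euler_prod_nonzero norm_exp_eq_Re)

lemma Delta_plus_1: "Delta (t + 1) = Delta t"
proof -
  have "exp (2 * of_real pi * \<i> * (t + 1)) = exp (2 * of_real pi * \<i> * t)"
    using exp_2pi_i_int[of 1] by (simp add: ring_distribs exp_add)
  then show ?thesis by (simp add: Delta_def)
qed

lemma Delta_inversion:
  assumes t: "Im t > 0" shows "Delta (- (1 / t)) = t ^ 12 * Delta t"
proof -
  have "Delta (- (1 / t)) = ((- (t\<^sup>2) * theta4 t ^ 4) * (- (t\<^sup>2) * theta3 t ^ 4) * (- (t\<^sup>2) * theta2 t ^ 4))\<^sup>2 / 256"
    unfolding Delta_eq_theta[OF Im_minus_inverse_pos[OF t]] theta_inversion_power4[OF t] ..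
  also have "\<dots> = t ^ 12 * ((theta2 t ^ 4 * theta3 t ^ 4 * theta4 t ^ 4)\<^sup>2 / 256)"
    by (simp add: power_mult_distrib power_mult[symmetric] power_add[symmetric] mult_ac)
  finally show ?thesis unfolding Delta_eq_theta[OF t] .
qed

text \<open>Factor by factor, \<open>norm (1 - q ^ n)\<close> is at least
  \<open>1 - norm q ^ n\<close>, hence at least \<open>1 - r ^ n\<close>. This bounds the product in
  \<open>Delta\<close> away from 0 uniformly up to the cusp.\<close>

lemma norm_euler_prod_mono:
  assumes q: "norm q \<le> r" and r: "r < 1"
  shows "norm (euler_prod (of_real r)) \<le> norm (euler_prod q)"
proof -
  have r0: "r \<ge> 0" using q norm_ge_zero order_trans by blast
  have l1: "(\<lambda>N. norm (\<Prod>n<N. 1 - complex_of_real r ^ Suc n)) \<longlonglongrightarrow> norm (euler_prod (of_real r))"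
    by (intro tendsto_norm euler_prod_LIMSEQ) (use r r0 in auto)
  have l2: "(\<lambda>N. norm (\<Prod>n<N. 1 - q ^ Suc n)) \<longlonglongrightarrow> norm (euler_prod q)"
    by (intro tendsto_norm euler_prod_LIMSEQ) (use q r in auto)
  have "norm (\<Prod>n<N. 1 - complex_of_real r ^ Suc n) \<le> norm (\<Prod>n<N. 1 - q ^ Suc n)" for N
    unfolding prod_norm[symmetric]
  proof (intro prod_mono conjI norm_ge_zero)
    fix n
    have "1 - complex_of_real r ^ Suc n = of_real (1 - r ^ Suc n)" by simp
    then have "norm (1 - complex_of_real r ^ Suc n) = 1 - r ^ Suc n"
      using r r0 by (simp only: norm_of_real) (simp add: power_le_one mult_le_one)
    also have "\<dots> \<le> 1 - norm q ^ Suc n" using power_mono[OF q norm_ge_zero, of "Suc n"] by linarith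
    also have "\<dots> \<le> norm (1 - q ^ Suc n)" using norm_triangle_ineq2[of 1 "q ^ Suc n"] by (simp add: norm_power norm_mult)
    finally show "norm (1 - complex_of_real r ^ Suc n) \<le> norm (1 - q ^ Suc n)" .
  qed
  then show ?thesis using LIMSEQ_le[OF l1 l2] by blast
qed

lemma Delta_lower_bound:
  obtains m where "m > 0" "\<And>t. Im t \<ge> 1 \<Longrightarrow> norm (Delta t) \<ge> m * exp (- (2 * pi * Im t))"
proof
  define r where "r = exp (- (2 * pi))"
  have r: "r < 1" "r > 0" by (auto simp: r_def)
  show "norm (euler_prod (of_real r)) ^ 24 > 0" using euler_prod_nonzero[of "of_real r"] r by simp
  show "norm (Delta t) \<ge> norm (euler_prod (of_real r)) ^ 24 * exp (- (2 * pi * Im t))" if t: "Im t \<ge> 1" for t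
  proof -
    define q where "q = exp (2 * of_real pi * \<i> * t)"
    have nq: "norm q = exp (- (2 * pi * Im t))" by (simp add: q_def norm_exp_eq_Re)
    have "norm q \<le> r" using t by (simp add: nq r_def)
    then have "norm (euler_prod (of_real r)) ^ 24 \<le> norm (euler_prod q) ^ 24"
      using norm_euler_prod_mono r by (intro power_mono) auto
    then show ?thesis
      unfolding Delta_def q_def[symmetric] norm_mult norm_power nq by (simp add: mult.commute)
  qed
qed

section \<open>Behaviour of the theta constants at the cusp\<close>

lemma theta2_decay:
  obtains M where "\<And>t. Im t \<ge> 1/2 \<Longrightarrow> norm (theta2 t) \<le> M * exp (- (pi / 4 * Im t))"
proof -
  have sq: "(of_int n + 1/2)\<^sup>2 \<ge> (1/4 :: real)" for n
  proof -
    have "n * (n + 1) \<ge> 0" by (simp add: zero_le_mult_iff) linarith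
    then have "0 \<le> real_of_int (n * (n + 1))" by linarith
    then show ?thesis by (simp add: power2_eq_square algebra_simps)
  qed
  obtain M where "\<And>t. Im t \<ge> 1/2 \<Longrightarrow> norm (infsum (thterm (of_real (1/2)) (of_real 0) t) UNIV) \<le> M * exp (- (pi * (1/4) * Im t))"
    using theta_decay[of "1/2" UNIV "1/4" "1/2" 0] sq by auto
  then show thesis by (intro that[of M]) (simp add: theta2_def theta_def)
qed

text \<open>The term at \<open>n = 0\<close> equals 1 and all others have
  \<open>n\<^sup>2 \<ge> 1\<close>. The range reaches down to \<open>Im t = 1/2\<close> because
  \<open>ref_form_dual\<close> evaluates theta constants at \<open>t / 2\<close>.\<close>

lemma theta_minus_1_decay:
  obtains M where "\<And>t. Im t \<ge> 1/2 \<Longrightarrow> norm (theta 0 (of_real y) t - 1) \<le> M * exp (- (pi * Im t))"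
proof -
  have sq: "(of_int n + 0)\<^sup>2 \<ge> (1 :: real)" if "n \<in> - {0}" for n :: int
  proof -
    have "1 \<le> n\<^sup>2" using that by (simp add: int_one_le_iff_zero_less)
    then have "1 \<le> real_of_int (n\<^sup>2)" by linarith
    then show ?thesis by simp
  qed
  obtain M where M: "\<And>t. Im t \<ge> 1/2 \<Longrightarrow> norm (infsum (thterm (of_real 0) (of_real y) t) (- {0})) \<le> M * exp (- (pi * 1 * Im t))"
    using theta_decay[of "1/2" "- {0}" 1 0 y] sq by auto
  have "theta 0 (of_real y) t - 1 = infsum (thterm (of_real 0) (of_real y) t) (- {0})" if "Im t \<ge> 1/2" for t
  proof -
    have "infsum (thterm 0 (of_real y) t) (insert 0 (- {0})) = thterm 0 (of_real y) t 0 + infsum (thterm 0 (of_real y) t) (- {0})"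
      by (rule infsum_insert) (use that in \<open>auto intro: summable_on_subset[OF thterm_summable]\<close>)
    moreover have "insert 0 (- {0::int}) = UNIV" by auto
    ultimately show ?thesis by (simp add: theta_def thterm_def)
  qed
  then show thesis using M by (intro that[of M]) simp
qed

lemma theta34_minus_1_decay:
  obtains M where "M \<ge> 0" "\<And>t. Im t \<ge> 1/2 \<Longrightarrow> norm (theta3 t - 1) \<le> M * exp (- (pi * Im t))"
    "\<And>t. Im t \<ge> 1/2 \<Longrightarrow> norm (theta4 t - 1) \<le> M * exp (- (pi * Im t))"
proof -
  obtain M3 where M3: "\<And>t. Im t \<ge> 1/2 \<Longrightarrow> norm (theta 0 (of_real 0) t - 1) \<le> M3 * exp (- (pi * Im t))"
    using theta_minus_1_decay[of 0] by blast
  obtain M4 where M4: "\<And>t. Im t \<ge> 1/2 \<Longrightarrow> norm (theta 0 (of_real (1/2)) t - 1) \<le> M4 * exp (- (pi * Im t))"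
    using theta_minus_1_decay[of "1/2"] by blast
  show thesis
  proof (rule that[of "\<bar>M3\<bar> + \<bar>M4\<bar>"])
    fix t :: complex assume t: "Im t \<ge> 1/2"
    have "M3 * exp (- (pi * Im t)) \<le> (\<bar>M3\<bar> + \<bar>M4\<bar>) * exp (- (pi * Im t))"
      "M4 * exp (- (pi * Im t)) \<le> (\<bar>M3\<bar> + \<bar>M4\<bar>) * exp (- (pi * Im t))"
      by (rule mult_right_mono; simp)+
    moreover have "norm (theta3 t - 1) \<le> M3 * exp (- (pi * Im t))" "norm (theta4 t - 1) \<le> M4 * exp (- (pi * Im t))"
      using M3[OF t] M4[OF t] by (simp_all add: theta3_def theta4_def)
    ultimately show "norm (theta3 t - 1) \<le> (\<bar>M3\<bar> + \<bar>M4\<bar>) * exp (- (pi * Im t))"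
      "norm (theta4 t - 1) \<le> (\<bar>M3\<bar> + \<bar>M4\<bar>) * exp (- (pi * Im t))"
      by linarith+
  qed simp
qed

lemma norm_power_minus_1_le:
  fixes w :: complex
  assumes "norm (w - 1) \<le> B"
  shows "norm (w ^ n - 1) \<le> n * (1 + B) ^ n * norm (w - 1)"
proof -
  have B: "B \<ge> 0" using assms norm_ge_zero order_trans by blast
  have w: "norm w \<le> 1 + B" using norm_triangle_ineq[of "w - 1" 1] assms by simp
  have "norm (\<Sum>i<n. w ^ i) \<le> (\<Sum>i<n. (1 + B) ^ n)"
  proof (rule sum_norm_le)
    fix i assume "i \<in> {..<n}"
    then have "(1 + B) ^ i \<le> (1 + B) ^ n" using B by (intro power_increasing) auto
    then show "norm (w ^ i) \<le> (1 + B) ^ n"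
      using power_mono[OF w norm_ge_zero, of i] by (simp add: norm_power)
  qed
  then have "norm (\<Sum>i<n. w ^ i) \<le> n * (1 + B) ^ n" by simp
  then have "norm (w - 1) * norm (\<Sum>i<n. w ^ i) \<le> norm (w - 1) * (n * (1 + B) ^ n)"
    by (rule mult_left_mono) simp
  then show ?thesis
    unfolding power_diff_1_eq norm_mult by (simp add: mult_ac)
qed

text \<open>The difference \<open>E\<close> of the two sides has weight 2 up to sign and decays like
  \<open>exp (- (pi * Im t))\<close>. Its sixth power has the weight of \<open>Delta\<close>, and
  the quotient decays with exponent 6 - 2 = 4, so \<open>modular_invariant_cusp_zero\<close>
  applies.\<close>

theorem jacobi_theta_identity:
  assumes t: "Im t > 0"
  shows "theta3 t ^ 4 = theta2 t ^ 4 + theta4 t ^ 4"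
proof -
  define E where "E = (\<lambda>t. theta2 t ^ 4 - theta3 t ^ 4 + theta4 t ^ 4)"
  obtain m where m: "m > 0" "\<And>t. Im t \<ge> 1 \<Longrightarrow> norm (Delta t) \<ge> m * exp (- (2 * pi * Im t))"
    using Delta_lower_bound by blast
  obtain M where M: "M \<ge> 0" "\<And>t. Im t \<ge> 1/2 \<Longrightarrow> norm (theta3 t - 1) \<le> M * exp (- (pi * Im t))"
    "\<And>t. Im t \<ge> 1/2 \<Longrightarrow> norm (theta4 t - 1) \<le> M * exp (- (pi * Im t))"
    using theta34_minus_1_decay by blast
  obtain N where N: "\<And>t. Im t \<ge> 1/2 \<Longrightarrow> norm (theta2 t) \<le> N * exp (- (pi / 4 * Im t))"
    using theta2_decay by blast
  define L where "L = N ^ 4 + 8 * (1 + M) ^ 4 * M"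
  have Eb: "norm (E t) \<le> L * exp (- (pi * Im t))" if t: "Im t \<ge> 1" for t
  proof -
    have e1: "M * exp (- (pi * Im t)) \<le> M" using M(1) t by (simp add: mult_left_le)
    have "norm (theta2 t ^ 4) \<le> (N * exp (- (pi / 4 * Im t))) ^ 4"
      unfolding norm_power by (rule power_mono[OF N]) (use t in auto)
    also have "\<dots> = N ^ 4 * exp (- (pi * Im t))"
      unfolding power_mult_distrib exp_of_nat_mult[symmetric] by simp
    finally have 2: "norm (theta2 t ^ 4) \<le> N ^ 4 * exp (- (pi * Im t))" .
    have 34: "norm (w ^ 4 - 1) \<le> 4 * (1 + M) ^ 4 * (M * exp (- (pi * Im t)))" if "norm (w - 1) \<le> M * exp (- (pi * Im t))" for w :: complex
      by (rule order_trans[OF norm_power_minus_1_le[of w M 4]], use that e1 in linarith)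
         (use that M in \<open>auto intro!: mult_left_mono\<close>)
    have Eeq: "E t = theta2 t ^ 4 - (theta3 t ^ 4 - 1) + (theta4 t ^ 4 - 1)" by (simp add: E_def)
    have "norm (E t) \<le> norm (theta2 t ^ 4) + norm (theta3 t ^ 4 - 1) + norm (theta4 t ^ 4 - 1)"
      using norm_triangle_ineq[of "theta2 t ^ 4 - (theta3 t ^ 4 - 1)" "theta4 t ^ 4 - 1"]
        norm_triangle_ineq4[of "theta2 t ^ 4" "theta3 t ^ 4 - 1"] unfolding Eeq by linarith
    also have "\<dots> \<le> N ^ 4 * exp (- (pi * Im t)) + 4 * (1 + M) ^ 4 * (M * exp (- (pi * Im t))) + 4 * (1 + M) ^ 4 * (M * exp (- (pi * Im t)))"
      by (intro add_mono 2 34 M(2) M(3)) (use t in auto)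
    also have "\<dots> = L * exp (- (pi * Im t))" by (simp add: L_def algebra_simps)
    finally show ?thesis .
  qed
  have ET: "E (t + 1) = - E t" for t
  proof -
    have "exp (of_real pi * \<i> / 4) ^ 4 = -1"
      unfolding exp_of_nat_mult[symmetric] using exp_pi_i by (simp add: mult_ac)
    then show ?thesis
      by (simp add: E_def theta2_plus_1 theta3_plus_1 theta4_plus_1 power_mult_distrib)
  qed
  have ES: "E (- (1 / t)) = - (t\<^sup>2) * E t" if "Im t > 0" for t
    by (simp add: E_def theta_inversion_power4[OF that] algebra_simps del: minus_mult_left[symmetric])
  define f where "f = (\<lambda>t. E t ^ 6 / Delta t)"
  have "f t = 0"
  proof (rule modular_invariant_cusp_zero[of f "L ^ 6 / m" "4 * pi"])
    show "f holomorphic_on upper_half_plane"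
      unfolding f_def E_def by (intro holomorphic_intros theta234_holomorphic Delta_holomorphic) (use Delta_nonzero in auto)
    show "norm (f (t + 1)) = norm (f t)" for t
      by (simp add: f_def ET Delta_plus_1)
    show "norm (f (- (1 / t))) = norm (f t)" if t: "Im t > 0" for t
    proof -
      have "t \<noteq> 0" using t by auto
      have "f (- (1 / t)) = (- (t\<^sup>2) * E t) ^ 6 / (t ^ 12 * Delta t)"
        unfolding f_def ES[OF t] Delta_inversion[OF t] ..
      also have "(- (t\<^sup>2) * E t) ^ 6 = t ^ 12 * E t ^ 6"
        by (simp add: power_mult_distrib power_mult[symmetric])
      finally show ?thesis using \<open>t \<noteq> 0\<close> by (simp add: f_def)
    qed
    show "norm (f t) \<le> L ^ 6 / m * exp (- (4 * pi * Im t))" if t: "Im t \<ge> 1" for t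
    proof -
      have "norm (f t) \<le> (L * exp (- (pi * Im t))) ^ 6 / (m * exp (- (2 * pi * Im t)))"
        unfolding f_def norm_divide norm_power
        by (intro frac_le power_mono Eb t m(2) zero_le_power order_trans[OF norm_ge_zero Eb[OF t]] norm_ge_zero) (use m in auto)
      also have "\<dots> = L ^ 6 / m * (exp (- (pi * Im t)) ^ 6 / exp (- (2 * pi * Im t)))"
        by (simp add: power_mult_distrib)
      also have "exp (- (pi * Im t)) ^ 6 / exp (- (2 * pi * Im t)) = exp (- (4 * pi * Im t))"
        unfolding exp_of_nat_mult[symmetric] exp_diff[symmetric] by (rule arg_cong[of _ _ exp]) simp
      finally show ?thesis .
    qed
  qed (use t in auto)
  then have "E t = 0" using Delta_nonzero[OF t] by (simp add: f_def)
  then show ?thesis by (simp add: E_def algebra_simps)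
qed

section \<open>The reference form\<close>

text \<open>With \<open>x\<close>, \<open>y\<close>, \<open>z\<close> the fourth powers of
  \<open>theta3\<close>, \<open>theta4\<close>, \<open>theta2\<close> at \<open>2 * t\<close>, the
  claim multiplied by \<open>2 * q * phi(q)^24\<close> asks for
  \<open>2 * (x * y)^3 - y^6 - 3 * x * z * y^4\<close>. The factored form used here is easy to
  transform under inversion.\<close>

definition ref_form :: "complex \<Rightarrow> complex" where
  "ref_form t = theta4 (2 * t) ^ 12 * (theta3 (2 * t) ^ 12 + theta2 (2 * t) ^ 12)"

text \<open>The image of \<open>ref_form\<close> under inversion, with \<open>t ^ 12\<close>
  removed. Each term contains six fourth powers of theta constants, each contributing
  \<open>(t / 2)\<^sup>2\<close>; this leaves the denominator \<open>2 ^ 12\<close>.\<close>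

definition ref_form_dual :: "complex \<Rightarrow> complex" where
  "ref_form_dual t = theta2 (t / 2) ^ 12 * (theta3 (t / 2) ^ 12 + theta4 (t / 2) ^ 12) / 2 ^ 12"

lemma holomorphic_theta_scaled:
  fixes c :: real
  assumes f: "f holomorphic_on upper_half_plane" and c: "c > 0"
  shows "(\<lambda>t. f (of_real c * t)) holomorphic_on upper_half_plane"
proof -
  have "(f \<circ> (\<lambda>t. of_real c * t)) holomorphic_on upper_half_plane"
    by (rule holomorphic_on_compose[OF _ holomorphic_on_subset[OF f]]) (use c in \<open>auto intro!: holomorphic_intros\<close>)
  then show ?thesis by (simp add: o_def)
qed

lemma ref_form_holomorphic: "ref_form holomorphic_on upper_half_plane"
  unfolding ref_form_def
  using holomorphic_theta_scaled[OF theta234_holomorphic(1), of 2] holomorphic_theta_scaled[OF theta234_holomorphic(2), of 2]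
    holomorphic_theta_scaled[OF theta234_holomorphic(3), of 2]
  by (auto intro!: holomorphic_intros)

lemma ref_form_dual_holomorphic: "ref_form_dual holomorphic_on upper_half_plane"
proof -
  have "(\<lambda>t. g (t / 2)) holomorphic_on upper_half_plane" if "g holomorphic_on upper_half_plane" for g
    using holomorphic_theta_scaled[OF that, of "1/2"] by simp
  from this[OF theta234_holomorphic(1)] this[OF theta234_holomorphic(2)] this[OF theta234_holomorphic(3)]
  show ?thesis unfolding ref_form_dual_def by (auto intro!: holomorphic_intros)
qed

lemma power_12: "x ^ 12 = (x ^ 4) ^ 3" for x :: complex
  by (simp add: power_mult[symmetric])

lemma exp_pi_i_quarter_power12: "exp (of_real pi * \<i> / 4) ^ 12 = -1"
proof -
  have "exp (of_real pi * \<i> / 4) ^ 12 = exp (of_real pi * \<i> + 2 * of_real pi * \<i> * of_int 1)"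
    unfolding exp_of_nat_mult[symmetric] by (rule arg_cong[of _ _ exp]) simp
  then show ?thesis unfolding exp_add exp_2pi_i_int using exp_pi_i by (simp add: mult.commute)
qed

lemma ref_form_plus_1: "ref_form (t + 1) = ref_form t"
proof -
  have "2 * (t + 1) = (2 * t + 1) + 1" by simp
  then show ?thesis
    by (simp only: ref_form_def theta2_plus_1 theta3_plus_1 theta4_plus_1 power_mult_distrib)
       (simp add: exp_pi_i_quarter_power12)
qed

lemma ref_form_dual_plus_2: "ref_form_dual (t + 2) = - ref_form_dual t"
proof -
  have "(t + 2) / 2 = t / 2 + 1" by simp
  then show ?thesis
    by (simp only: ref_form_dual_def theta2_plus_1 theta3_plus_1 theta4_plus_1 power_mult_distrib) (simp add: add.commute exp_pi_i_quarter_power12)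
qed

lemma ref_form_inversion:
  assumes t: "Im t > 0"
  shows "ref_form (- (1 / t)) = t ^ 12 * ref_form_dual t"
proof -
  have u: "Im (t / 2) > 0" using t by simp
  have "2 * - (1 / t) = - (1 / (t / 2))" by simp
  then have "ref_form (- (1 / t)) = (- ((t/2)\<^sup>2) * theta2 (t/2) ^ 4) ^ 3 * ((- ((t/2)\<^sup>2) * theta3 (t/2) ^ 4) ^ 3 + (- ((t/2)\<^sup>2) * theta4 (t/2) ^ 4) ^ 3)"
    by (simp only: ref_form_def power_12 theta_inversion_power4[OF u])
  also have "\<dots> = t ^ 12 * ref_form_dual t"
    unfolding ref_form_dual_def power_12 by (simp add: power_mult_distrib power_divide power_mult[symmetric] power_add[symmetric] field_simps)
  finally show ?thesis .
qed

text \<open>Two readings of one form. The first consists of the eta quotients of the claim. The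
  second exhibits \<open>1 + O(q^2)\<close>: \<open>theta4 (4 * t)\<close> deviates from 1 in order
  2, and \<open>theta2 (2 * t) ^ 12\<close> has order 3.\<close>

lemma ref_form_products:
  assumes t: "Im t > 0"
  defines "q \<equiv> exp (2 * of_real pi * \<i> * t)"
  shows "ref_form t = 2 * (euler_prod (q\<^sup>2) ^ 2 / euler_prod (q ^ 4)) ^ 24 - (euler_prod q ^ 2 / euler_prod (q\<^sup>2)) ^ 24 - 48 * q * euler_prod q ^ 24"
    and "ref_form t = theta4 (4 * t) ^ 24 + theta4 (2 * t) ^ 12 * theta2 (2 * t) ^ 12"
proof -
  have t2: "Im (2 * t) > 0" and t4: "Im (4 * t) > 0" using t by auto
  have q: "exp (of_real pi * \<i> * (2 * t)) = q" by (simp add: q_def mult_ac)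
  have q4: "exp (of_real pi * \<i> * (4 * t)) = q\<^sup>2" unfolding q_def exp_of_nat_mult[symmetric] by (simp add: mult_ac)
  have nq: "norm q < 1" using nome_props[OF t2] q by simp
  note nz = theta_euler_nonzero[OF nq]
  define e1 e2 e4 where "e1 = euler_prod q" and "e2 = euler_prod (q\<^sup>2)" and "e4 = euler_prod (q ^ 4)"
  have e0: "e1 \<noteq> 0" "e2 \<noteq> 0" "e4 \<noteq> 0" using nz by (auto simp: e1_def e2_def e4_def)
  define r where "r = exp (of_real pi * \<i> * (2 * t) / 4)"
  have r4: "r ^ 4 = q" unfolding r_def q_def exp_of_nat_mult[symmetric] by (simp add: mult_ac)
  have th3: "theta3 (2 * t) = e2 ^ 5 / (e1\<^sup>2 * e4\<^sup>2)" and th4: "theta4 (2 * t) = e1\<^sup>2 / e2" and th2: "theta2 (2 * t) = r * (2 * e4\<^sup>2 / e2)"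
    using theta_products[OF t2] unfolding q by (simp_all add: e1_def e2_def e4_def r_def)
  have th44: "theta4 (4 * t) = e2\<^sup>2 / e4"
    using theta_products(2)[OF t4] unfolding q4 by (simp add: e2_def e4_def power_mult[symmetric])
  have th34: "theta3 (2 * t) * theta4 (2 * t) = theta4 (4 * t) ^ 2"
    unfolding th3 th4 th44 using e0 by (simp add: field_simps eval_nat_numeral)
  then show 2: "ref_form t = theta4 (4 * t) ^ 24 + theta4 (2 * t) ^ 12 * theta2 (2 * t) ^ 12"
    by (simp add: ref_form_def ring_distribs power_mult_distrib[symmetric] mult.commute power_mult[symmetric])
  define x y z where "x = theta3 (2 * t) ^ 4" and "y = theta4 (2 * t) ^ 4" and "z = theta2 (2 * t) ^ 4"
  have xyz: "x = z + y" using jacobi_theta_identity[OF t2] by (simp add: x_def y_def z_def)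
  have zz: "z = 16 * q * (e4 ^ 8 / e2 ^ 4)" unfolding z_def th2 by (simp add: power_mult_distrib power_divide power_mult[symmetric] r4)
  have xx: "x = e2 ^ 20 / (e1 ^ 8 * e4 ^ 8)" unfolding x_def th3 by (simp add: power_mult_distrib power_divide power_mult[symmetric])
  have yy: "y = e1 ^ 8 / e2 ^ 4" unfolding y_def th4 by (simp add: power_divide power_mult[symmetric])
  \<comment> \<open>This is 16 times \<open>Delta t\<close>. Taken three times, it is the source of
    the 48 here and of the 24 in the claim.\<close>
  have D: "x * z * y ^ 4 = 16 * q * e1 ^ 24"
  proof -
    have "b ^ 5 / (a * c) * (16 * q * (c / b)) * (a / b) ^ 4 = 16 * q * a ^ 3" if "a \<noteq> 0" "b \<noteq> 0" "c \<noteq> 0" for a b c :: complex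
      using that by (simp add: field_simps eval_nat_numeral)
    from this[of "e1 ^ 8" "e2 ^ 4" "e4 ^ 8"] show ?thesis
      unfolding xx yy zz using e0 by (simp add: power_mult[symmetric])
  qed
  have "(x * y) ^ 3 = theta4 (4 * t) ^ 24" unfolding x_def y_def
    by (simp add: power_mult_distrib[symmetric] th34 power_mult[symmetric])
  moreover have "y ^ 6 = (e1\<^sup>2 / e2) ^ 24" unfolding y_def th4 by (simp add: power_mult[symmetric])
  moreover have "ref_form t = y ^ 3 * (x ^ 3 + z ^ 3)" unfolding ref_form_def power_12 x_def y_def z_def ..
  \<comment> \<open>From \<open>x - y = z\<close> follows
    \<open>x^3 - y^3 = z^3 + 3 * x * y * z\<close>.\<close>
  moreover have "y ^ 3 * (x ^ 3 + z ^ 3) = 2 * (x * y) ^ 3 - y ^ 6 - 3 * (x * z * y ^ 4)"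
    unfolding xyz by (simp add: power_mult_distrib algebra_simps eval_nat_numeral)
  ultimately show "ref_form t = 2 * (euler_prod (q\<^sup>2) ^ 2 / euler_prod (q ^ 4)) ^ 24 - (euler_prod q ^ 2 / euler_prod (q\<^sup>2)) ^ 24 - 48 * q * euler_prod q ^ 24"
    unfolding D th44 by (simp add: e1_def e2_def e4_def)
qed

lemma ref_form_decay:
  obtains M where "\<And>t. Im t \<ge> 1 \<Longrightarrow> norm (ref_form t - 1) \<le> M * exp (- (4 * pi * Im t))"
proof -
  obtain M where M: "M \<ge> 0" "\<And>t. Im t \<ge> 1/2 \<Longrightarrow> norm (theta3 t - 1) \<le> M * exp (- (pi * Im t))"
    "\<And>t. Im t \<ge> 1/2 \<Longrightarrow> norm (theta4 t - 1) \<le> M * exp (- (pi * Im t))"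
    using theta34_minus_1_decay by blast
  obtain N where N: "\<And>t. Im t \<ge> 1/2 \<Longrightarrow> norm (theta2 t) \<le> N * exp (- (pi / 4 * Im t))"
    using theta2_decay by blast
  have N0: "N \<ge> 0" using order_trans[OF norm_ge_zero N[of \<i>]] by (simp add: zero_le_mult_iff)
  have "norm (ref_form t - 1) \<le> (24 * (1 + M) ^ 24 * M + (1 + M) ^ 12 * N ^ 12) * exp (- (4 * pi * Im t))" if t: "Im t \<ge> 1" for t
  proof -
    have e1: "M * exp (- (pi * Im u)) \<le> M" if "Im u \<ge> 1/2" for u using M(1) that by (simp add: mult_left_le)
    have a: "norm (theta4 (4 * t) - 1) \<le> M * exp (- (4 * pi * Im t))" using M(3)[of "4 * t"] t by (simp add: mult_ac)
    have "norm (theta4 (4 * t) ^ 24 - 1) \<le> 24 * (1 + M) ^ 24 * norm (theta4 (4 * t) - 1)"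
      using norm_power_minus_1_le[of "theta4 (4 * t)" M 24] order_trans[OF M(3) e1, of "4 * t"] t by simp
    also have "\<dots> \<le> 24 * (1 + M) ^ 24 * (M * exp (- (4 * pi * Im t)))"
      using a M by (intro mult_left_mono) auto
    finally have 1: "norm (theta4 (4 * t) ^ 24 - 1) \<le> 24 * (1 + M) ^ 24 * (M * exp (- (4 * pi * Im t)))" .
    have "norm (theta4 (2 * t) - 1) \<le> M" using order_trans[OF M(3) e1, of "2 * t"] t by simp
    then have w: "norm (theta4 (2 * t)) \<le> 1 + M" using norm_triangle_ineq[of "theta4 (2 * t) - 1" 1] by simp
    have "norm (theta4 (2 * t) ^ 12 * theta2 (2 * t) ^ 12) \<le> (1 + M) ^ 12 * (N * exp (- (pi / 4 * Im (2 * t)))) ^ 12"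
      unfolding norm_mult norm_power by (intro mult_mono power_mono w N) (use t M N0 in auto)
    also have "(N * exp (- (pi / 4 * Im (2 * t)))) ^ 12 = N ^ 12 * exp (- (6 * pi * Im t))"
      unfolding power_mult_distrib exp_of_nat_mult[symmetric] by (simp add: mult_ac)
    also have "(1 + M) ^ 12 * (N ^ 12 * exp (- (6 * pi * Im t))) \<le> (1 + M) ^ 12 * (N ^ 12 * exp (- (4 * pi * Im t)))"
      using M N0 t by (intro mult_left_mono) auto
    finally have 2: "norm (theta4 (2 * t) ^ 12 * theta2 (2 * t) ^ 12) \<le> (1 + M) ^ 12 * (N ^ 12 * exp (- (4 * pi * Im t)))" .
    have "ref_form t - 1 = (theta4 (4 * t) ^ 24 - 1) + theta4 (2 * t) ^ 12 * theta2 (2 * t) ^ 12"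
      using ref_form_products(2)[of t] t by simp
    then have "norm (ref_form t - 1) \<le> norm (theta4 (4 * t) ^ 24 - 1) + norm (theta4 (2 * t) ^ 12 * theta2 (2 * t) ^ 12)"
      using norm_triangle_ineq by metis
    then show ?thesis using 1 2 by (simp add: algebra_simps)
  qed
  then show thesis by (rule that)
qed

text \<open>All decay comes from \<open>theta2 (t / 2) ^ 12\<close>, with exponent 12 * (1/4) *
  (1/2) = 3/2; the other factor is bounded.\<close>

lemma ref_form_dual_decay:
  obtains M where "\<And>t. Im t \<ge> 1 \<Longrightarrow> norm (ref_form_dual t) \<le> M * exp (- (3/2 * pi * Im t))"
proof -
  obtain M where M: "M \<ge> 0" "\<And>t. Im t \<ge> 1/2 \<Longrightarrow> norm (theta3 t - 1) \<le> M * exp (- (pi * Im t))"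
    "\<And>t. Im t \<ge> 1/2 \<Longrightarrow> norm (theta4 t - 1) \<le> M * exp (- (pi * Im t))"
    using theta34_minus_1_decay by blast
  obtain N where N: "\<And>t. Im t \<ge> 1/2 \<Longrightarrow> norm (theta2 t) \<le> N * exp (- (pi / 4 * Im t))"
    using theta2_decay by blast
  have N0: "N \<ge> 0" using order_trans[OF norm_ge_zero N[of \<i>]] by (simp add: zero_le_mult_iff)
  have "norm (ref_form_dual t) \<le> (N ^ 12 * ((1 + M) ^ 12 + (1 + M) ^ 12) / 2 ^ 12) * exp (- (3/2 * pi * Im t))" if t: "Im t \<ge> 1" for t
  proof -
    have u: "Im (t / 2) \<ge> 1/2" using t by simp
    have e1: "M * exp (- (pi * Im (t / 2))) \<le> M" using M(1) t by (simp add: mult_left_le)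
    have w: "norm w \<le> 1 + M" if "norm (w - 1) \<le> M * exp (- (pi * Im (t / 2)))" for w :: complex
      using norm_triangle_ineq[of "w - 1" 1] that e1 by simp
    have "norm (theta3 (t/2) ^ 12 + theta4 (t/2) ^ 12) \<le> norm (theta3 (t/2)) ^ 12 + norm (theta4 (t/2)) ^ 12"
      using norm_triangle_ineq[of "theta3 (t/2) ^ 12" "theta4 (t/2) ^ 12"] by (simp add: norm_power)
    also have "\<dots> \<le> (1 + M) ^ 12 + (1 + M) ^ 12"
      by (intro add_mono power_mono w M(2) M(3) u norm_ge_zero)
    finally have 34: "norm (theta3 (t/2) ^ 12 + theta4 (t/2) ^ 12) \<le> (1 + M) ^ 12 + (1 + M) ^ 12" .
    have "norm (theta2 (t/2) ^ 12 * (theta3 (t/2) ^ 12 + theta4 (t/2) ^ 12)) \<le> (N * exp (- (pi / 4 * Im (t/2)))) ^ 12 * ((1 + M) ^ 12 + (1 + M) ^ 12)"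
      unfolding norm_mult norm_power[of "theta2 _"] by (intro mult_mono power_mono N 34 u) (use M N0 in auto)
    also have "(N * exp (- (pi / 4 * Im (t/2)))) ^ 12 = N ^ 12 * exp (- (3/2 * pi * Im t))"
      unfolding power_mult_distrib exp_of_nat_mult[symmetric] by (simp add: mult_ac)
    finally show ?thesis by (simp add: ref_form_dual_def norm_divide field_simps)
  qed
  then show thesis by (rule that)
qed

section \<open>Self-dual codes\<close>

lemma carrier_residue_module: "carrier (residue_module m n) = (\<Pi>\<^sub>E j\<in>{1..n}. {0..m - 1})"
  by (simp add: residue_module_def residue_ring_def)

lemma zero_residue_module: "\<zero>\<^bsub>residue_module m n\<^esub> = (\<lambda>j\<in>{1..n}. 0)"
  by (simp add: residue_module_def residue_ring_def)

lemma finite_residue_module: "finite (carrier (residue_module m n))"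
  unfolding carrier_residue_module by (intro finite_PiE) auto

lemma is_code_subset: "is_code k n C \<Longrightarrow> C \<subseteq> carrier (residue_module (2 * k) n)"
proof -
  assume "is_code k n C"
  then have "subgroup C (add_monoid (residue_module (2 * k) n))" unfolding is_code_def submodule_def by blast
  from subgroup.subset[OF this] show ?thesis by simp
qed

lemma is_code_finite: "is_code k n C \<Longrightarrow> finite C"
  by (rule finite_subset[OF is_code_subset finite_residue_module])

lemma is_code_zero: "is_code k n C \<Longrightarrow> (\<lambda>j\<in>{1..n}. 0) \<in> C"
proof -
  assume "is_code k n C"
  then have "subgroup C (add_monoid (residue_module (2 * k) n))" unfolding is_code_def submodule_def by blast
  from subgroup.one_closed[OF this] show ?thesis by (simp add: zero_residue_module)
qed

lemma is_code_add:
  assumes "is_code k n C" "x \<in> C" "y \<in> C"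
  shows "(\<lambda>j\<in>{1..n}. (x j + y j) mod (2 * k)) \<in> C"
proof -
  have "subgroup C (add_monoid (residue_module (2 * k) n))" using assms(1) unfolding is_code_def submodule_def by blast
  from subgroup.m_closed[OF this assms(2,3)] show ?thesis by (simp add: residue_module_def residue_ring_def)
qed

section \<open>Euclidean weights and integral lifts of codewords\<close>

lemma centred_rep_props:
  assumes k: "k > 0"
  shows "- k < centred_rep k a" "centred_rep k a \<le> k" "[centred_rep k a = a] (mod 2 * k)"
proof -
  \<comment> \<open>Adding \<open>k - 1\<close> before the reduction moves the window
    \<open>{0..2 * k - 1}\<close> to \<open>{- k + 1..k}\<close>.\<close>
  define m where "m = (a + k - 1) mod (2 * k) - k + 1"
  have mr: "0 \<le> (a + k - 1) mod (2 * k)" "(a + k - 1) mod (2 * k) < 2 * k" using k by auto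
  have "[m + (k - 1) = a + (k - 1)] (mod 2 * k)" by (simp add: m_def cong_def algebra_simps)
  then have m: "- k < m \<and> m \<le> k \<and> [m = a] (mod 2 * k)"
    using mr unfolding cong_add_rcancel by (auto simp: m_def)
  have "m' = m" if m': "- k < m' \<and> m' \<le> k \<and> [m' = a] (mod 2 * k)" for m'
  proof -
    have "[m' = m] (mod 2 * k)" using cong_trans[of m' a "2 * k" m] m m' cong_sym[of m a "2 * k"] by blast
    then have d: "2 * k dvd m' - m" by (simp only: cong_iff_dvd_diff)
    have l: "\<bar>m' - m\<bar> < 2 * k" using m m' by auto
    show ?thesis
    proof (rule ccontr)
      assume "m' \<noteq> m"
      then have "m' - m \<noteq> 0" by simp
      from dvd_imp_le_int[OF this d] l k show False by simp
    qed
  qed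
  then have "centred_rep k a = m" unfolding centred_rep_def by (intro the_equality m)
  then show "- k < centred_rep k a" "centred_rep k a \<le> k" "[centred_rep k a = a] (mod 2 * k)" using m by blast+
qed

lemma centred_rep_abs_le:
  assumes k: "k > 0" and c: "[x = a] (mod 2 * k)"
  shows "\<bar>centred_rep k a\<bar> \<le> \<bar>x\<bar>"
proof -
  define m where "m = centred_rep k a"
  have m: "- k < m" "m \<le> k" "[m = a] (mod 2 * k)" using centred_rep_props[OF k] by (auto simp: m_def)
  have "[x = m] (mod 2 * k)" using c m cong_trans cong_sym by blast
  then obtain l where l: "x = m + 2 * k * l" by (metis cong_iff_lin cong_sym mult.commute)
  show ?thesis unfolding m_def[symmetric]
  proof (cases "l = 0")
    case False
    then have "2 * k * 1 \<le> 2 * k * \<bar>l\<bar>" using k by (intro mult_left_mono) auto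
    moreover have "\<bar>2 * k * l\<bar> = 2 * k * \<bar>l\<bar>" using k by (simp add: abs_mult)
    ultimately have "\<bar>2 * k * l\<bar> \<ge> 2 * k" by simp
    then show "\<bar>m\<bar> \<le> \<bar>x\<bar>" using l m by linarith
  qed (use l in simp)
qed

text \<open>In the square of \<open>y + 2 * k * l\<close>, both the cross term and the last term are
  multiples of \<open>4 * k\<close>. Hence the Type II condition may be tested on any integral lift
  of a codeword, not only on the centred one.\<close>

lemma cong_square_double:
  assumes "[x = y] (mod 2 * k)"
  shows "[x\<^sup>2 = y\<^sup>2] (mod 4 * (k :: int))"
proof -
  obtain l where l: "x = y + 2 * k * l" using assms by (metis cong_iff_lin cong_sym mult.commute)
  have "x\<^sup>2 - y\<^sup>2 = 4 * k * (y * l + k * l\<^sup>2)" unfolding l by (simp add: power2_eq_square algebra_simps)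
  then show ?thesis by (simp add: cong_iff_dvd_diff)
qed

lemma euclidean_weight_le:
  assumes k: "k > 0" and c: "\<And>j. j \<in> {1..n} \<Longrightarrow> [x j = c j] (mod 2 * k)"
  shows "euclidean_weight k n c \<le> (\<Sum>j\<in>{1..n}. (x j)\<^sup>2)"
  unfolding euclidean_weight_def
proof (rule sum_mono)
  fix j assume "j \<in> {1..n}"
  from centred_rep_abs_le[OF k c[OF this]] show "(centred_rep k (c j))\<^sup>2 \<le> (x j)\<^sup>2"
    by (simp only: abs_le_square_iff)
qed

lemma euclidean_weight_cong:
  assumes k: "k > 0" and c: "\<And>j. j \<in> {1..n} \<Longrightarrow> [x j = c j] (mod 2 * k)"
  shows "[euclidean_weight k n c = (\<Sum>j\<in>{1..n}. (x j)\<^sup>2)] (mod 4 * k)"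
  unfolding euclidean_weight_def
proof (intro cong_sum cong_square_double)
  fix j assume "j \<in> {1..n}"
  then show "[centred_rep k (c j) = x j] (mod 2 * k)"
    by (intro cong_trans[OF centred_rep_props(3)[OF k] cong_sym[OF c]])
qed

lemma type_II_square_sum:
  assumes k: "k > 0" and C: "type_II_code k n C" and c: "c \<in> C" and x: "\<And>j. j \<in> {1..n} \<Longrightarrow> [x j = c j] (mod 2 * k)"
  shows "4 * k dvd (\<Sum>j\<in>{1..n}. (x j)\<^sup>2)"
proof -
  have "[euclidean_weight k n c = 0] (mod 4 * k)"
    using C c unfolding type_II_code_def cong_0_iff by blast
  then have "[(\<Sum>j\<in>{1..n}. (x j)\<^sup>2) = 0] (mod 4 * k)"
    using cong_trans[OF cong_sym[OF euclidean_weight_cong[of k n x c, OF k x]]] by blast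
  then show ?thesis by (simp only: cong_0_iff)
qed

text \<open>The Construction A lattice has no nonzero vector of norm below 4. Centred
  representatives are the shortest lifts, which settles nonzero codewords. A nonzero lift of the
  zero word has an entry of absolute value at least \<open>2 * k\<close>, and
  \<open>(2 * k)\<^sup>2 \<ge> 8 * k\<close> because \<open>k \<ge> 2\<close>.\<close>

lemma extremal_square_sum:
  assumes k: "k \<ge> 2" and C: "extremal_type_II_code_24 k C" and c: "c \<in> C"
    and x: "\<And>j. j \<in> {1..24} \<Longrightarrow> [x j = c j] (mod 2 * k)" and nz: "\<exists>j\<in>{1..24}. x j \<noteq> 0"
  shows "8 * k \<le> (\<Sum>j\<in>{1..24}. (x j)\<^sup>2)"
proof (cases "c = (\<lambda>j\<in>{1..24}. 0)")
  case True
  obtain j where j: "j \<in> {1..24}" "x j \<noteq> 0" using nz by blast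
  have d: "2 * k dvd x j" using x[OF j(1)] j True by (simp add: cong_0_iff)
  have "2 * k \<le> \<bar>x j\<bar>" using dvd_imp_le_int[OF j(2) d] k by simp
  then have "(2 * k)\<^sup>2 \<le> (x j)\<^sup>2" using k abs_le_square_iff[of "2 * k" "x j"] by simp
  moreover have "8 * k \<le> (2 * k)\<^sup>2" using k by (simp add: power2_eq_square)
  moreover have "(x j)\<^sup>2 \<le> (\<Sum>j\<in>{1..24}. (x j)\<^sup>2)" by (rule member_le_sum) (use j in auto)
  ultimately show ?thesis by linarith
next
  case False
  have code: "is_code k 24 C" using C by (simp add: extremal_type_II_code_24_def type_II_code_def self_dual_code_def)
  have "Min (euclidean_weight k 24 ` (C - {\<lambda>j\<in>{1..24}. 0})) = 8 * k"
    using C unfolding extremal_type_II_code_24_def min_euclidean_weight_def zero_residue_module by blast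
  moreover have "Min (euclidean_weight k 24 ` (C - {\<lambda>j\<in>{1..24}. 0})) \<le> euclidean_weight k 24 c"
    by (rule Min_le) (use is_code_finite[OF code] c False in auto)
  ultimately show ?thesis using euclidean_weight_le[of k 24 x c, OF _ x] k by linarith
qed

lemma self_dual_inner_product:
  assumes "self_dual_code k n C" "x \<in> C" "y \<in> C"
  shows "[(\<Sum>j\<in>{1..n}. x j * y j) = 0] (mod 2 * k)"
  using assms unfolding self_dual_code_def dual_code_def by blast

lemma self_dual_memI:
  assumes "self_dual_code k n C" "y \<in> carrier (residue_module (2 * k) n)"
    "\<And>x. x \<in> C \<Longrightarrow> [(\<Sum>j\<in>{1..n}. x j * y j) = 0] (mod 2 * k)"
  shows "y \<in> C"
  using assms unfolding self_dual_code_def dual_code_def by blast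

text \<open>The shifted lattice \<open>\<Lambda> + v/2\<close> has no vector shorter than a half of a norm-6 vector of \<open>\<Lambda>\<close>:
  twice the vector is in \<open>\<Lambda>\<close>, and its norm is 2 modulo 4 because \<open>k\<close> is odd.\<close>

lemma extremal_shifted_square_sum:
  assumes k: "k \<ge> 2" "odd k" and C: "extremal_type_II_code_24 k C" and c: "c \<in> C" and i: "i \<in> {1..24}"
    and x: "\<And>j. j \<in> {1..24} \<Longrightarrow> [x j = c j + (if j = i then k else 0)] (mod 2 * k)"
  shows "3 * k \<le> (\<Sum>j\<in>{1..24}. (x j)\<^sup>2)"
proof -
  have k0: "k > 0" using k by simp
  have II: "type_II_code k 24 C" and code: "is_code k 24 C"
    using C by (auto simp: extremal_type_II_code_24_def type_II_code_def self_dual_code_def)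
  define S where "S = (\<Sum>j\<in>{1..24}. (x j)\<^sup>2)"
  define y where "y = (\<lambda>j. x j - (if j = i then k else 0))"
  have y: "[y j = c j] (mod 2 * k)" if "j \<in> {1..24}" for j
    using x[OF that] by (simp add: y_def cong_iff_dvd_diff algebra_simps)
  have "(\<Sum>j\<in>{1..24}. (y j)\<^sup>2) = (\<Sum>j\<in>{1..24}. (x j)\<^sup>2 + (if j = i then k\<^sup>2 - 2 * k * x j else 0))"
    by (rule sum.cong) (auto simp: y_def power2_eq_square algebra_simps)
  also have "\<dots> = S + (k\<^sup>2 - 2 * k * x i)" using i by (simp add: S_def sum.distrib)
  finally obtain l where l: "S + (k\<^sup>2 - 2 * k * x i) = 4 * k * l"
    using type_II_square_sum[OF k0 II c y] by (metis dvd_def)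
  \<comment> \<open>The cofactor of \<open>k\<close> is odd because \<open>k\<close> is.\<close>
  then have Sk: "S = k * (4 * l - k + 2 * x i)" by (simp add: power2_eq_square algebra_simps)
  define z where "z = (\<lambda>j\<in>{1..24}. (c j + c j) mod (2 * k))"
  have z: "z \<in> C" unfolding z_def by (rule is_code_add[OF code c c])
  have "[2 * x j = z j] (mod 2 * k)" if j: "j \<in> {1..24}" for j
  proof -
    have "[2 * x j = 2 * (c j + (if j = i then k else 0))] (mod 2 * k)" by (rule cong_scalar_left[OF x[OF j]])
    also have "[2 * (c j + (if j = i then k else 0)) = c j + c j] (mod 2 * k)" by (simp add: cong_iff_dvd_diff)
    finally show ?thesis using j by (simp add: z_def cong_def)
  qed
  \<comment> \<open>The shifted lattice avoids the origin: a zero vector would force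
    \<open>k = 4 * l\<close>, against the parity of \<open>k\<close>.\<close>
  moreover have "\<exists>j\<in>{1..24}. 2 * x j \<noteq> 0"
  proof (rule ccontr)
    assume "\<not> ?thesis"
    then have "S = 0" "x i = 0" using i by (auto simp: S_def)
    then have "k = 4 * l" using Sk k by simp
    then show False using k by simp
  qed
  ultimately have "8 * k \<le> (\<Sum>j\<in>{1..24}. (2 * x j)\<^sup>2)"
    by (intro extremal_square_sum[OF k(1) C z]) auto
  also have "\<dots> = 4 * S" by (simp add: S_def sum_distrib_left power_mult_distrib)
  finally have "k * 2 \<le> k * (4 * l - k + 2 * x i)" using Sk by simp
  then have "2 \<le> 4 * l - k + 2 * x i" using k0 by simp
  moreover have "odd (4 * l - k + 2 * x i)" using k by simp
  \<comment> \<open>Extremality applied to the doubled vector yields only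
    \<open>2 * k \<le> S\<close>; the odd cofactor raises the 2 to 3.\<close>
  ultimately have "3 \<le> 4 * l - k + 2 * x i" by presburger
  then have "k * 3 \<le> S" unfolding Sk using k0 by (intro mult_left_mono) auto
  then show ?thesis by (simp add: S_def)
qed

section \<open>Characters modulo \<open>2 * k\<close> and orthogonality on a self-dual code\<close>

definition root_unity :: "int \<Rightarrow> int \<Rightarrow> complex" where
  "root_unity k a = exp (of_real pi * \<i> * of_int a / of_int k)"

lemma root_unity_add: "root_unity k (a + b) = root_unity k a * root_unity k b"
  unfolding root_unity_def exp_add[symmetric]
  by (rule arg_cong[of _ _ exp]) (simp add: add_divide_distrib ring_distribs)

lemma root_unity_sum: "finite A \<Longrightarrow> root_unity k (\<Sum>j\<in>A. f j) = (\<Prod>j\<in>A. root_unity k (f j))"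
proof (induction A rule: finite_induct)
  case empty
  show ?case by (simp add: root_unity_def)
next
  case (insert a A)
  then show ?case by (simp add: root_unity_add)
qed

lemma root_unity_multiple: "k \<noteq> 0 \<Longrightarrow> root_unity k (2 * k * a) = 1"
proof -
  assume "k \<noteq> 0"
  then have "of_real pi * \<i> * of_int (2 * k * a) / of_int k = 2 * of_real pi * \<i> * of_int a" by simp
  then show ?thesis unfolding root_unity_def by (simp only: exp_2pi_i_int)
qed

lemma root_unity_cong:
  assumes "k \<noteq> 0" "[a = b] (mod 2 * k)"
  shows "root_unity k a = root_unity k b"
proof -
  obtain l where "a = b + 2 * k * l" using assms(2) by (metis cong_iff_lin cong_sym mult.commute)
  then show ?thesis using root_unity_multiple[OF assms(1), of l] by (simp add: root_unity_add)
qed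

lemma root_unity_eq_1:
  assumes k: "k \<noteq> 0" and "root_unity k a = 1"
  shows "[a = 0] (mod 2 * k)"
proof -
  obtain n where "Im (of_real pi * \<i> * of_int a / of_int k) = of_int (2 * n) * pi"
    using assms(2) unfolding root_unity_def exp_eq_1 by auto
  moreover have "of_real pi * \<i> * of_int a / of_int k = \<i> * of_real (pi * of_int a / of_int k)" by simp
  ultimately have "pi * (of_int a / of_int k) = pi * of_int (2 * n)" by simp
  then have "real_of_int a = of_int (2 * n) * of_int k" using k by (simp add: field_simps)
  then have "a = 2 * n * k" by (metis of_int_eq_iff of_int_mult)
  then show ?thesis by (simp add: cong_0_iff)
qed

text \<open>The sign \<open>(-1)^a\<close> is the character of index \<open>k\<close>. The twist by
  \<open>tau i\<close> is therefore a pairing with the vector \<open>k e_i\<close>, which becomes a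
  translation by that vector after the Fourier transform.\<close>

lemma root_unity_half: "k \<noteq> 0 \<Longrightarrow> root_unity k (k * a) = (-1) powi (a mod 2)"
proof -
  assume k: "k \<noteq> 0"
  have "root_unity k (k * a) = root_unity k (k * (a mod 2))"
  proof (rule root_unity_cong[OF k])
    have "k * a - k * (a mod 2) = 2 * k * (a div 2)"
      unfolding right_diff_distrib[symmetric] minus_mod_eq_mult_div by simp
    then show "[k * a = k * (a mod 2)] (mod 2 * k)" by (simp add: cong_iff_dvd_diff)
  qed
  also have "\<dots> = (-1) powi (a mod 2)"
  proof -
    have "a mod 2 = 0 \<or> a mod 2 = 1" by presburger
    then show ?thesis using k exp_pi_i by (auto simp: root_unity_def)
  qed
  finally show ?thesis .
qed

lemma root_unity_complete_sum:
  assumes k: "k > 0" and c: "c \<in> {0..2 * k - 1}"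
  shows "(\<Sum>s\<in>{0..2 * k - 1}. root_unity k (c * s)) = (if c = 0 then of_int (2 * k) else 0)"
proof (cases "c = 0")
  case True
  then show ?thesis using k by (simp add: root_unity_def)
next
  case False
  define w where "w = root_unity k c"
  have "\<not> [c = 0] (mod 2 * k)" using False c by (simp add: cong_def)
  then have w1: "w \<noteq> 1" using root_unity_eq_1[of k c] k by (auto simp: w_def)
  have wn: "root_unity k (c * int n) = w ^ n" for n
    by (induction n) (simp_all add: w_def ring_distribs root_unity_add, simp add: root_unity_def)
  have "(\<Sum>s\<in>{0..2 * k - 1}. root_unity k (c * s)) = (\<Sum>n<nat (2 * k). w ^ n)"
    by (rule sum.reindex_bij_witness[of _ int nat]) (auto simp: wn[symmetric])
  also have "\<dots> = 0"
  proof -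
    have "w ^ nat (2 * k) = 1"
      using wn[of "nat (2 * k)"] root_unity_multiple[of k c] k by (simp add: mult_ac)
    then show ?thesis unfolding geometric_sum[OF w1] by simp
  qed
  finally show ?thesis using False by simp
qed

text \<open>For \<open>s\<close> outside the dual code, some \<open>c0\<close> has a character value
  other than 1. Translation by \<open>c0\<close> permutes \<open>C\<close> and multiplies the sum by
  that value, so the sum is 0. By self-duality the dual code is \<open>C\<close> itself.\<close>

lemma code_character_sum:
  assumes k: "k > 0" and C: "self_dual_code k n C" and s: "s \<in> carrier (residue_module (2 * k) n)"
  shows "(\<Sum>c\<in>C. root_unity k (\<Sum>j\<in>{1..n}. c j * s j)) = (if s \<in> C then of_nat (card C) else 0)"
proof (cases "s \<in> C")
  case True
  have "root_unity k (\<Sum>j\<in>{1..n}. c j * s j) = 1" if "c \<in> C" for c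
    using root_unity_cong[OF _ self_dual_inner_product[OF C that True]] k by (simp add: root_unity_def)
  then show ?thesis using True by simp
next
  case False
  have code: "is_code k n C" using C by (simp add: self_dual_code_def)
  define w where "w = (\<lambda>c. root_unity k (\<Sum>j\<in>{1..n}. c j * s j))"
  obtain c0 where c0: "c0 \<in> C" "\<not> [(\<Sum>j\<in>{1..n}. c0 j * s j) = 0] (mod 2 * k)"
    using False self_dual_memI[OF C s] by blast
  have w0: "w c0 \<noteq> 1" using root_unity_eq_1[of k] c0 k by (auto simp: w_def)
  define f where "f = (\<lambda>c. \<lambda>j\<in>{1..n}. (c j + c0 j) mod (2 * k))"
  have fC: "f c \<in> C" if "c \<in> C" for c unfolding f_def by (rule is_code_add[OF code that c0(1)])
  have inj: "inj_on f C"
  proof (rule inj_onI)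
    fix c d assume cd: "c \<in> C" "d \<in> C" "f c = f d"
    have P: "c \<in> (\<Pi>\<^sub>E j\<in>{1..n}. {0..2 * k - 1})" "d \<in> (\<Pi>\<^sub>E j\<in>{1..n}. {0..2 * k - 1})"
      using is_code_subset[OF code] cd unfolding carrier_residue_module by auto
    show "c = d"
    proof (rule PiE_ext[OF P])
      fix j assume j: "j \<in> {1..n}"
      have "(c j + c0 j) mod (2 * k) = (d j + c0 j) mod (2 * k)" using fun_cong[OF cd(3), of j] j by (simp add: f_def)
      then have "[c j = d j] (mod 2 * k)" using cong_add_rcancel[of "c j" "c0 j" "d j" "2 * k"] by (simp add: cong_def)
      moreover have "c j \<in> {0..2 * k - 1}" "d j \<in> {0..2 * k - 1}" using P j by (auto dest: PiE_mem)
      ultimately show "c j = d j" by (simp add: cong_def)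
    qed
  qed
  have "bij_betw f C C"
    using endo_inj_surj[OF is_code_finite[OF code] _ inj] fC inj by (auto simp: bij_betw_def)
  then have "(\<Sum>c\<in>C. w c) = (\<Sum>c\<in>C. w (f c))" by (rule sum.reindex_bij_betw[symmetric])
  also have "\<dots> = (\<Sum>c\<in>C. w c * w c0)"
  proof (rule sum.cong[OF refl])
    fix c
    have "[(\<Sum>j\<in>{1..n}. f c j * s j) = (\<Sum>j\<in>{1..n}. (c j + c0 j) * s j)] (mod 2 * k)"
      by (intro cong_sum cong_scalar_right) (auto simp: f_def cong_def)
    then have "w (f c) = root_unity k (\<Sum>j\<in>{1..n}. (c j + c0 j) * s j)"
      unfolding w_def by (intro root_unity_cong) (use k in auto)
    then show "w (f c) = w c * w c0" by (simp add: w_def ring_distribs sum.distrib root_unity_add)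
  qed
  finally have "(\<Sum>c\<in>C. w c) * (1 - w c0) = 0" by (simp add: sum_distrib_right[symmetric] algebra_simps)
  then show ?thesis using w0 False by (simp add: w_def)
qed

text \<open>The characters are summed over all pairs of a word and a codeword in two orders. Summing
  over codewords first gives the square of \<open>card C\<close>; summing over all words first
  leaves only the zero codeword, with value \<open>(2 * k) ^ (2 * n)\<close>.\<close>

lemma card_self_dual_code:
  assumes k: "k > 0" and C: "self_dual_code k (2 * n) C"
  shows "real (card C) = of_int (2 * k) ^ n"
proof -
  have code: "is_code k (2 * n) C" using C by (simp add: self_dual_code_def)
  define V where "V = carrier (residue_module (2 * k) (2 * n))"
  have V: "V = (\<Pi>\<^sub>E j\<in>{1..2*n}. {0..2 * k - 1})" by (simp add: V_def carrier_residue_module)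
  have finV: "finite V" by (simp add: V_def finite_residue_module)
  have CV: "C \<subseteq> V" using is_code_subset[OF code] by (simp add: V_def)
  have zero: "(\<lambda>j\<in>{1..2*n}. 0) \<in> C" by (rule is_code_zero[OF code])
  have "complex_of_real (real (card C) * real (card C)) = (\<Sum>s\<in>V. if s \<in> C then of_nat (card C) else 0)"
  proof -
    have "V \<inter> {s. s \<in> C} = C" using CV by blast
    then show ?thesis using finV by (simp add: sum.If_cases)
  qed
  also have "\<dots> = (\<Sum>s\<in>V. \<Sum>c\<in>C. root_unity k (\<Sum>j\<in>{1..2*n}. c j * s j))"
    by (rule sum.cong) (use code_character_sum[OF k C] in \<open>auto simp: V_def\<close>)
  also have "\<dots> = (\<Sum>c\<in>C. \<Sum>s\<in>V. root_unity k (\<Sum>j\<in>{1..2*n}. c j * s j))" by (rule sum.swap)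
  also have "\<dots> = (\<Sum>c\<in>C. if c = (\<lambda>j\<in>{1..2*n}. 0) then of_int (2 * k) ^ (2 * n) else 0)"
  proof (rule sum.cong[OF refl])
    fix c assume c: "c \<in> C"
    then have cV: "c \<in> (\<Pi>\<^sub>E j\<in>{1..2*n}. {0..2 * k - 1})" using CV V by auto
    have "(\<Sum>s\<in>V. root_unity k (\<Sum>j\<in>{1..2*n}. c j * s j)) = (\<Sum>s\<in>V. \<Prod>j\<in>{1..2*n}. root_unity k (c j * s j))"
      by (simp add: root_unity_sum)
    also have "\<dots> = (\<Prod>j\<in>{1..2*n}. \<Sum>s\<in>{0..2 * k - 1}. root_unity k (c j * s))"
      unfolding V by (rule prod_sum_PiE[symmetric]) auto
    also have "\<dots> = (\<Prod>j\<in>{1..2*n}. if c j = 0 then of_int (2 * k) else 0)"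
      by (rule prod.cong[OF refl], rule root_unity_complete_sum[OF k]) (use cV in \<open>auto dest: PiE_mem\<close>)
    also have "\<dots> = (if c = (\<lambda>j\<in>{1..2*n}. 0) then of_int (2 * k) ^ (2 * n) else 0)"
    proof (cases "c = (\<lambda>j\<in>{1..2*n}. 0)")
      case False
      then obtain j where "j \<in> {1..2*n}" "c j \<noteq> 0"
      proof -
        have "c = (\<lambda>j\<in>{1..2*n}. 0)" if "\<And>j. j \<in> {1..2*n} \<Longrightarrow> c j = 0"
          by (rule PiE_ext[OF cV]) (use that k in auto)
        with False that show thesis by blast
      qed
      then show ?thesis using False by auto
    qed simp
    finally show "(\<Sum>s\<in>V. root_unity k (\<Sum>j\<in>{1..2*n}. c j * s j)) = (if c = (\<lambda>j\<in>{1..2*n}. 0) then of_int (2 * k) ^ (2 * n) else 0)" .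
  qed
  also have "\<dots> = complex_of_real (of_int (2 * k) ^ (2 * n))" using zero is_code_finite[OF code] by simp
  finally have "real (card C) * real (card C) = of_int (2 * k) ^ (2 * n)" unfolding of_real_eq_iff .
  then have "(real (card C))\<^sup>2 = (of_int (2 * k) ^ n)\<^sup>2"
    by (simp only: power2_eq_square[of "real (card C)"] power_mult[symmetric] mult.commute[of n])
  then show ?thesis using k by (simp add: power2_eq_iff_nonneg)
qed

section \<open>Theta series of a code\<close>

text \<open>At \<open>q = exp (2 pi i t)\<close> this is the sum of
  \<open>q^(k (n + r/2k)^2)\<close> over \<open>n\<close>, the numerator of the graded dimension of
  the module attached to the coset of \<open>r\<close>.\<close>

definition coset_theta :: "int \<Rightarrow> int \<Rightarrow> complex \<Rightarrow> complex" where
  "coset_theta k r t = theta (of_int r / (2 * of_int k)) 0 (2 * of_int k * t)"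

lemma exp_int_eq_1: "w = 2 * of_real pi * \<i> * of_int m \<Longrightarrow> exp w = 1"
  using exp_2pi_i_int by simp

lemma exp_eqI: "w = z + 2 * of_real pi * \<i> * of_int m \<Longrightarrow> exp w = exp z"
  using exp_2pi_i_int by (simp add: exp_add)

lemma theta_add_int: "theta (x + of_int m) 0 t = theta x 0 t"
proof (induction m rule: int_induct[where k = 0])
  case (step1 i)
  then show ?case using theta_periodic[of "x + of_int i" t] by (simp add: algebra_simps)
next
  case (step2 i)
  then show ?case using theta_periodic[of "x + of_int (i - 1)" t] by (simp add: algebra_simps)
qed simp

lemma coset_theta_cong:
  assumes "k > 0" "[r = s] (mod 2 * k)"
  shows "coset_theta k r t = coset_theta k s t"
proof -
  obtain l where l: "r = s + 2 * k * l" using assms(2) by (metis cong_iff_lin cong_sym mult.commute)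
  have "of_int r / (2 * of_int k) = of_int s / (2 * of_int k) + (of_int l :: complex)"
    using assms by (simp add: l field_simps)
  then show ?thesis unfolding coset_theta_def by (simp only: theta_add_int)
qed

lemma coset_theta_plus_1:
  assumes k: "k > 0"
  shows "coset_theta k r (t + 1) = exp (of_real pi * \<i> * of_int (r\<^sup>2) / (2 * of_int k)) * coset_theta k r t"
proof -
  have "thterm (of_int r / (2 * of_int k)) 0 (2 * of_int k * (t + 1)) n
    = exp (of_real pi * \<i> * of_int (r\<^sup>2) / (2 * of_int k)) * thterm (of_int r / (2 * of_int k)) 0 (2 * of_int k * t) n" for n
    unfolding thterm_def exp_add[symmetric]
    by (rule exp_eqI[where m = "k * n\<^sup>2 + n * r"]) (use k in \<open>simp add: field_simps power2_eq_square\<close>)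
  then show ?thesis unfolding coset_theta_def theta_def by (subst infsum_cmult_right'[symmetric]) (intro infsum_cong)
qed

lemma infsum_int_residues:
  fixes f :: "int \<Rightarrow> complex"
  assumes f: "f summable_on UNIV" and m: "m > 0"
  shows "infsum f UNIV = (\<Sum>s\<in>{0..m - 1}. \<Sum>\<^sub>\<infinity>n. f (m * n + s))"
proof -
  define B where "B = (\<lambda>s. range (\<lambda>n. m * n + s))"
  have "(\<Sum>\<^sub>\<infinity>n. f (m * n + s)) = infsum f (B s)" for s
    unfolding B_def by (subst infsum_reindex) (use m in \<open>auto simp: inj_on_def o_def\<close>)
  moreover have "(\<Sum>s\<in>{0..m - 1}. infsum f (B s)) = infsum f (\<Union>s\<in>{0..m - 1}. B s)"
  proof (rule sum_infsum)
    show "f summable_on B s" for s by (rule summable_on_subset[OF f]) simp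
    show "B s \<inter> B s' = {}" if "s \<in> {0..m - 1}" "s' \<in> {0..m - 1}" "s \<noteq> s'" for s s'
    proof -
      have "x mod m = s" if "x \<in> B s" "s \<in> {0..m - 1}" for x s using that by (auto simp: B_def)
      then show ?thesis using that by blast
    qed
  qed simp
  moreover have "(\<Union>s\<in>{0..m - 1}. B s) = UNIV"
  proof -
    have "x \<in> B (x mod m)" "x mod m \<in> {0..m - 1}" for x
      using m by (auto simp: B_def image_iff intro!: exI[of _ "x div m"])
    then show ?thesis by blast
  qed
  ultimately show ?thesis by simp
qed

text \<open>Inversion at \<open>u = t / (2 * k)\<close> trades the characteristic for a phase.
  Sorting the summation index modulo \<open>2 * k\<close> then recovers coset series, so inversion
  acts on them as the finite Fourier transform.\<close>

lemma coset_theta_inversion: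
  assumes k: "k > 0" and t: "Im t > 0"
  shows "coset_theta k r (- (1 / t)) = (\<Sum>s\<in>{0..2 * k - 1}. root_unity k (r * s) * coset_theta k s t) / csqrt (2 * of_int k * \<i> / t)"
proof -
  define u where "u = t / (2 * of_int k)"
  have t0: "t \<noteq> 0" using t by auto
  have "u = t / of_real (2 * of_int k)" by (simp add: u_def)
  then have u: "Im u > 0" using t k by (simp only: Im_divide_of_real) simp
  have v: "2 * of_int k * - (1 / t) = - (1 / u)" using k t0 by (simp add: u_def)
  have x: "of_int r / (2 * of_int k) = complex_of_real (of_int r / (2 * of_int k))" by simp
  have "coset_theta k r (- (1 / t)) = theta (complex_of_real (of_int r / (2 * of_int k))) 0 (- (1 / u))"
    unfolding coset_theta_def v x ..
  also have "\<dots> = theta 0 (complex_of_real (of_int r / (2 * of_int k))) (- (1 / (- (1 / u)))) / csqrt (- \<i> * - (1 / u))"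
    by (rule theta_inversion[OF Im_minus_inverse_pos[OF u]])
  also have "- (1 / (- (1 / u))) = u" by simp
  also have "- \<i> * - (1 / u) = 2 * of_int k * \<i> / t" using k t0 by (simp add: u_def)
  also have "theta 0 (complex_of_real (of_int r / (2 * of_int k))) u = (\<Sum>s\<in>{0..2 * k - 1}. \<Sum>\<^sub>\<infinity>n. thterm 0 (of_real (of_int r / (2 * of_int k))) u (2 * k * n + s))"
    unfolding theta_def by (rule infsum_int_residues[OF thterm_summable[OF u]]) (use k in simp)
  also have "\<dots> = (\<Sum>s\<in>{0..2 * k - 1}. root_unity k (r * s) * coset_theta k s t)"
  proof (rule sum.cong[OF refl])
    fix s
    have "thterm 0 (of_real (of_int r / (2 * of_int k))) u (2 * k * n + s) = root_unity k (r * s) * thterm (of_int s / (2 * of_int k)) 0 (2 * of_int k * t) n" for n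
      unfolding thterm_def root_unity_def exp_add[symmetric]
      by (rule exp_eqI[where m = "n * r"]) (use k in \<open>simp add: u_def field_simps power2_eq_square\<close>)
    then show "(\<Sum>\<^sub>\<infinity>n. thterm 0 (of_real (of_int r / (2 * of_int k))) u (2 * k * n + s)) = root_unity k (r * s) * coset_theta k s t"
      unfolding coset_theta_def theta_def by (subst infsum_cmult_right'[symmetric]) (intro infsum_cong)
  qed
  finally show ?thesis .
qed

lemma sum_residues_shift:
  fixes F :: "int \<Rightarrow> 'a :: comm_monoid_add"
  assumes m: "m > 0" and F: "\<And>x y. [x = y] (mod m) \<Longrightarrow> F x = F y"
  shows "(\<Sum>s\<in>{0..m - 1}. F (s + a)) = (\<Sum>s\<in>{0..m - 1}. F s)"
proof (rule sum.reindex_bij_witness[of _ "\<lambda>s. (s - a) mod m" "\<lambda>s. (s + a) mod m"])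
  fix s assume s: "s \<in> {0..m - 1}"
  show "((s + a) mod m - a) mod m = s" using s by (simp add: mod_simps)
  show "((s - a) mod m + a) mod m = s" using s by (simp add: mod_simps)
  show "(s + a) mod m \<in> {0..m - 1}" "(s - a) mod m \<in> {0..m - 1}" using m by auto
  show "F ((s + a) mod m) = F (s + a)" by (rule F) (simp add: cong_def)
qed

definition code_theta :: "int \<Rightarrow> (nat \<Rightarrow> int) set \<Rightarrow> nat \<Rightarrow> complex \<Rightarrow> complex" where
  "code_theta k C i t = (\<Sum>c\<in>C. (-1) powi tau i c * (\<Prod>j\<in>{1..24}. coset_theta k (c j) t))"

definition shifted_code_theta :: "int \<Rightarrow> (nat \<Rightarrow> int) set \<Rightarrow> nat \<Rightarrow> complex \<Rightarrow> complex" where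
  "shifted_code_theta k C i t = (\<Sum>c\<in>C. \<Prod>j\<in>{1..24}. coset_theta k (c j + (if j = i then k else 0)) t)"

lemma coset_theta_holomorphic:
  assumes k: "k > 0"
  shows "coset_theta k r holomorphic_on upper_half_plane"
proof -
  have "(\<lambda>t. theta (of_int r / (2 * of_int k)) 0 (of_real (2 * of_int k) * t)) holomorphic_on upper_half_plane"
    by (rule holomorphic_theta_scaled[OF theta_holomorphic]) (use k in simp)
  then show ?thesis by (simp add: coset_theta_def[abs_def])
qed

lemma code_theta_holomorphic:
  assumes "k > 0"
  shows "code_theta k C i holomorphic_on upper_half_plane" "shifted_code_theta k C i holomorphic_on upper_half_plane"
  unfolding code_theta_def[abs_def] shifted_code_theta_def[abs_def]
  by (intro holomorphic_intros coset_theta_holomorphic assms)+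

text \<open>The MacWilliams argument: the product of 24 finite Fourier transforms is expanded into a
  sum over all words, the sums are exchanged, and orthogonality keeps exactly the words in
  \<open>C\<close>.\<close>

lemma code_theta_inversion:
  assumes k: "k > 0" and C: "self_dual_code k 24 C" and i: "i \<in> {1..24}" and t: "Im t > 0"
  shows "code_theta k C i (- (1 / t)) = t ^ 12 * shifted_code_theta k C i t"
proof -
  define g where "g = csqrt (2 * of_int k * \<i> / t)"
  define \<delta> where "\<delta> = (\<lambda>j::nat. if j = i then k else 0)"
  let ?P = "\<lambda>s. \<Prod>j\<in>{1..24}. coset_theta k (s j + \<delta> j) t"
  let ?dot = "\<lambda>c s. \<Sum>j\<in>{1..24}. c j * s j"
  have t0: "t \<noteq> 0" using t by auto
  have code: "is_code k 24 C" using C by (simp add: self_dual_code_def)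
  have CV: "C \<subseteq> (\<Pi>\<^sub>E j\<in>{1..24}. {0..2 * k - 1})" using is_code_subset[OF code] by (simp add: carrier_residue_module)
  define V :: "(nat \<Rightarrow> int) set" where "V = (\<Pi>\<^sub>E j\<in>{1..24}. {0..2 * k - 1})"
  have finV: "finite V" unfolding V_def by (intro finite_PiE) auto
  \<comment> \<open>The sign is absorbed by replacing the summation variable \<open>s\<close> with
    \<open>s + \<delta> j\<close>. The series is then shifted twice, by 0 or by \<open>2 * k\<close>
    in all, which leaves it unchanged.\<close>
  have factor: "(if j = i then root_unity k (k * c j) else 1) * coset_theta k (c j) (- (1 / t))
     = (\<Sum>s\<in>{0..2 * k - 1}. root_unity k (c j * s) * coset_theta k (s + \<delta> j) t) / g" for c j
  proof -
    have "(if j = i then root_unity k (k * c j) else 1) = root_unity k (c j * \<delta> j)"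
      by (simp add: \<delta>_def mult.commute) (simp add: root_unity_def)
    then have "(if j = i then root_unity k (k * c j) else 1) * coset_theta k (c j) (- (1 / t))
      = (\<Sum>s\<in>{0..2 * k - 1}. root_unity k (c j * (s + \<delta> j)) * coset_theta k (s + \<delta> j + \<delta> j) t) / g"
    proof -
      have "coset_theta k (s + \<delta> j + \<delta> j) t = coset_theta k s t" for s
        by (rule coset_theta_cong[OF k]) (simp add: \<delta>_def cong_iff_dvd_diff)
      then show ?thesis using \<open>_ = root_unity k (c j * \<delta> j)\<close>
        by (simp add: coset_theta_inversion[OF k t] g_def sum_distrib_left ring_distribs root_unity_add mult_ac)
    qed
    also have "(\<Sum>s\<in>{0..2 * k - 1}. root_unity k (c j * (s + \<delta> j)) * coset_theta k (s + \<delta> j + \<delta> j) t)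
       = (\<Sum>s\<in>{0..2 * k - 1}. root_unity k (c j * s) * coset_theta k (s + \<delta> j) t)"
    proof (rule sum_residues_shift)
      fix x y assume xy: "[x = y] (mod 2 * k)"
      have "root_unity k (c j * x) = root_unity k (c j * y)"
        by (rule root_unity_cong) (use k xy in \<open>auto intro: cong_scalar_left\<close>)
      moreover have "coset_theta k (x + \<delta> j) t = coset_theta k (y + \<delta> j) t"
        by (rule coset_theta_cong[OF k]) (use xy in \<open>simp add: cong_add_rcancel\<close>)
      ultimately show "root_unity k (c j * x) * coset_theta k (x + \<delta> j) t = root_unity k (c j * y) * coset_theta k (y + \<delta> j) t" by simp
    qed (use k in simp)
    finally show ?thesis .
  qed
  have sign: "(-1) powi tau i c = (\<Prod>j\<in>{1..24}. if j = i then root_unity k (k * c j) else 1)" for c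
    using i k root_unity_half[of k "c i"] by (simp add: tau_def)
  have product: "(-1) powi tau i c * (\<Prod>j\<in>{1..24}. coset_theta k (c j) (- (1 / t)))
     = (\<Sum>s\<in>V. root_unity k (?dot c s) * ?P s) / g ^ 24" for c
  proof -
    have "(-1) powi tau i c * (\<Prod>j\<in>{1..24}. coset_theta k (c j) (- (1 / t)))
       = (\<Prod>j\<in>{1..24}. (\<Sum>s\<in>{0..2 * k - 1}. root_unity k (c j * s) * coset_theta k (s + \<delta> j) t) / g)"
      unfolding sign prod.distrib[symmetric] factor ..
    also have "\<dots> = (\<Prod>j\<in>{1..24}. \<Sum>s\<in>{0..2 * k - 1}. root_unity k (c j * s) * coset_theta k (s + \<delta> j) t) / g ^ 24"
      by (simp add: prod_dividef)
    also have "(\<Prod>j\<in>{1..24}. \<Sum>s\<in>{0..2 * k - 1}. root_unity k (c j * s) * coset_theta k (s + \<delta> j) t)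
       = (\<Sum>s\<in>V. \<Prod>j\<in>{1..24}. root_unity k (c j * s j) * coset_theta k (s j + \<delta> j) t)"
      unfolding V_def by (rule prod_sum_PiE) auto
    finally show ?thesis by (simp add: prod.distrib root_unity_sum)
  qed
  have "code_theta k C i (- (1 / t)) = (\<Sum>c\<in>C. \<Sum>s\<in>V. root_unity k (?dot c s) * ?P s) / g ^ 24"
    unfolding code_theta_def product sum_divide_distrib ..
  also have "(\<Sum>c\<in>C. \<Sum>s\<in>V. root_unity k (?dot c s) * ?P s)
    = (\<Sum>s\<in>V. (\<Sum>c\<in>C. root_unity k (?dot c s)) * ?P s)"
    by (subst sum.swap) (simp only: sum_distrib_right)
  also have "\<dots> = (\<Sum>s\<in>V. if s \<in> C then of_nat (card C) * ?P s else 0)"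
  proof (rule sum.cong[OF refl])
    fix s assume "s \<in> V"
    then have "s \<in> carrier (residue_module (2 * k) 24)" by (simp add: V_def carrier_residue_module)
    from code_character_sum[OF k C this]
    show "(\<Sum>c\<in>C. root_unity k (?dot c s)) * ?P s
       = (if s \<in> C then of_nat (card C) * ?P s else 0)" by simp
  qed
  also have "\<dots> = (\<Sum>s\<in>C. of_nat (card C) * ?P s)"
  proof -
    have "V \<inter> {s. s \<in> C} = C" using CV by (auto simp: V_def)
    then show ?thesis using finV by (simp add: sum.If_cases)
  qed
  also have "\<dots> = of_nat (card C) * shifted_code_theta k C i t"
    by (simp add: shifted_code_theta_def \<delta>_def sum_distrib_left)
  finally have eq: "code_theta k C i (- (1 / t)) = of_nat (card C) / g ^ 24 * shifted_code_theta k C i t" by simp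
  have "complex_of_real (real (card C)) = complex_of_real (of_int (2 * k) ^ 12)"
    using card_self_dual_code[OF k, of 12 C] C by simp
  then have "of_nat (card C) = (2 * of_int k :: complex) ^ 12" by simp
  \<comment> \<open>An even power of the root, so its branch disappears. As
    \<open>\<i> ^ 12 = 1\<close>, only \<open>(2 * k) ^ 12\<close> and \<open>t ^ 12\<close> remain,
    and the former cancels against \<open>card C\<close>.\<close>
  moreover have "g ^ 24 = (2 * of_int k / t) ^ 12"
  proof -
    have "g ^ 24 = (g\<^sup>2) ^ 12" by (simp add: power_mult[symmetric])
    also have "g\<^sup>2 = \<i> * (2 * of_int k / t)" by (simp add: g_def mult_ac)
    also have "(\<i> * (2 * of_int k / t)) ^ 12 = \<i> ^ 12 * (2 * of_int k / t) ^ 12" by (simp only: power_mult_distrib)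
    also have "\<i> ^ 12 = (\<i> ^ 4) ^ 3" by (simp add: power_mult[symmetric])
    finally show ?thesis by simp
  qed
  ultimately have "of_nat (card C) / g ^ 24 = t ^ 12" using k t0 by (simp add: power_divide)
  then show ?thesis using eq by simp
qed

text \<open>The 24 phases multiply to \<open>exp (pi i N / (2 k))\<close>, where \<open>N\<close> is
  the sum of the squares of the entries, a multiple of \<open>4 * k\<close> by the Type II
  condition.\<close>

lemma code_theta_plus_1:
  assumes k: "k > 0" and C: "type_II_code k 24 C"
  shows "code_theta k C i (t + 1) = code_theta k C i t"
  unfolding code_theta_def
proof (rule sum.cong[OF refl])
  fix c assume c: "c \<in> C"
  obtain l where l: "(\<Sum>j\<in>{1..24}. (c j)\<^sup>2) = 4 * k * l"
    using type_II_square_sum[OF k C c, of c] by (metis cong_refl dvd_def)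
  have "(\<Prod>j\<in>{1..24::nat}. exp (of_real pi * \<i> * of_int ((c j)\<^sup>2) / (2 * of_int k)))
     = exp (\<Sum>j\<in>{1..24}. of_real pi * \<i> * of_int ((c j)\<^sup>2) / (2 * of_int k))" by (rule exp_sum[symmetric]) simp
  also have "(\<Sum>j\<in>{1..24}. of_real pi * \<i> * of_int ((c j)\<^sup>2) / (2 * of_int k)) = of_real pi * \<i> * of_int (\<Sum>j\<in>{1..24}. (c j)\<^sup>2) / (2 * of_int k)"
    unfolding of_int_sum sum_distrib_left sum_divide_distrib ..
  also have "exp \<dots> = 1" unfolding l by (rule exp_int_eq_1[where m = l]) (use k in \<open>simp add: field_simps\<close>)
  finally have "(\<Prod>j\<in>{1..24::nat}. exp (of_real pi * \<i> * of_int ((c j)\<^sup>2) / (2 * of_int k))) = 1" .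
  then show "(-1) powi tau i c * (\<Prod>j\<in>{1..24}. coset_theta k (c j) (t + 1)) = (-1) powi tau i c * (\<Prod>j\<in>{1..24}. coset_theta k (c j) t)"
    unfolding coset_theta_plus_1[OF k] prod.distrib by simp
qed

text \<open>Translation by 1 gives each word a phase \<open>w\<close> that depends on the word. Its
  square is always -1, because the squared length of a shifted word is an odd multiple of
  \<open>k\<close>; hence a common sign appears only for translation by 2.\<close>

lemma shifted_code_theta_plus_2:
  assumes k: "k > 0" "odd k" and C: "type_II_code k 24 C" and i: "i \<in> {1..24}"
  shows "shifted_code_theta k C i (t + 2) = - shifted_code_theta k C i t"
  unfolding shifted_code_theta_def sum_negf[symmetric]
proof (rule sum.cong[OF refl])
  fix c assume c: "c \<in> C"
  define s where "s = (\<lambda>j. c j + (if j = i then k else 0))"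
  obtain l where l: "(\<Sum>j\<in>{1..24}. (c j)\<^sup>2) = 4 * k * l"
    using type_II_square_sum[OF k(1) C c, of c] by (metis cong_refl dvd_def)
  obtain h where h: "k = 2 * h + 1" using k(2) by (auto elim: oddE)
  have "(\<Sum>j\<in>{1..24}. (s j)\<^sup>2) = (\<Sum>j\<in>{1..24}. (c j)\<^sup>2 + (if j = i then k\<^sup>2 + 2 * k * c j else 0))"
    by (rule sum.cong) (auto simp: s_def power2_eq_square algebra_simps)
  also have "\<dots> = 4 * k * l + (k\<^sup>2 + 2 * k * c i)" using i unfolding sum.distrib l by simp
  also have "\<dots> = k * (2 * (2 * l + h + c i) + 1)" using h by (simp add: power2_eq_square algebra_simps)
  finally have S: "(\<Sum>j\<in>{1..24}. (s j)\<^sup>2) = k * (2 * (2 * l + h + c i) + 1)" .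
  define w where "w = (\<Prod>j\<in>{1..24}. exp (of_real pi * \<i> * of_int ((s j)\<^sup>2) / (2 * of_int k)))"
  have "w = exp (\<Sum>j\<in>{1..24}. of_real pi * \<i> * of_int ((s j)\<^sup>2) / (2 * of_int k))" unfolding w_def by (rule exp_sum[symmetric]) simp
  also have "(\<Sum>j\<in>{1..24}. of_real pi * \<i> * of_int ((s j)\<^sup>2) / (2 * of_int k)) = of_real pi * \<i> * of_int (\<Sum>j\<in>{1..24}. (s j)\<^sup>2) / (2 * of_int k)"
    unfolding of_int_sum sum_distrib_left sum_divide_distrib ..
  finally have w: "w = exp (of_real pi * \<i> * of_int (\<Sum>j\<in>{1..24}. (s j)\<^sup>2) / (2 * of_int k))" .
  have "w * w = exp (of_real pi * \<i>)"
    unfolding w exp_add[symmetric] S by (rule exp_eqI[where m = "2 * l + h + c i"]) (use k in \<open>simp add: field_simps\<close>)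
  then have ww: "w * w = -1" using exp_pi_i by (simp add: mult.commute)
  have "(\<Prod>j\<in>{1..24}. coset_theta k (s j) (t + 2)) = w * (w * (\<Prod>j\<in>{1..24}. coset_theta k (s j) t))"
  proof -
    have "(\<Prod>j\<in>{1..24}. coset_theta k (s j) (u + 1)) = w * (\<Prod>j\<in>{1..24}. coset_theta k (s j) u)" for u
      unfolding coset_theta_plus_1[OF k(1)] prod.distrib w_def ..
    from this[of "t + 1"] this[of t] show ?thesis by (simp add: add.assoc)
  qed
  then have "(\<Prod>j\<in>{1..24}. coset_theta k (s j) (t + 2)) = - (\<Prod>j\<in>{1..24}. coset_theta k (s j) t)"
    unfolding mult.assoc[symmetric] ww by simp
  then show "(\<Prod>j\<in>{1..24}. coset_theta k (c j + (if j = i then k else 0)) (t + 2)) = - (\<Prod>j\<in>{1..24}. coset_theta k (c j + (if j = i then k else 0)) t)"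
    by (simp only: s_def)
qed

section \<open>Expansion over lattice points and decay at the cusps\<close>

lemma summable_on_prod_PiE:
  fixes f :: "'a \<Rightarrow> 'b \<Rightarrow> real"
  assumes A: "finite A" and f: "\<And>x. x \<in> A \<Longrightarrow> f x summable_on B x" and nn: "\<And>x y. x \<in> A \<Longrightarrow> y \<in> B x \<Longrightarrow> f x y \<ge> 0"
  shows "(\<lambda>g. \<Prod>x\<in>A. f x (g x)) summable_on PiE A B"
proof (rule nonneg_bdd_above_summable_on)
  show "0 \<le> (\<Prod>x\<in>A. f x (g x))" if "g \<in> PiE A B" for g using nn that by (intro prod_nonneg) (auto dest: PiE_mem)
  show "bdd_above (sum (\<lambda>g. \<Prod>x\<in>A. f x (g x)) ` {F. F \<subseteq> PiE A B \<and> finite F})"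
  proof (rule bdd_aboveI2)
    fix F assume F: "F \<in> {F. F \<subseteq> PiE A B \<and> finite F}"
    \<comment> \<open>The coordinates of \<open>F\<close> span a finite box, over which the sum of
      products factors and can be bounded factor by factor.\<close>
    define P where "P = (\<lambda>x. (\<lambda>g. g x) ` F)"
    have P: "finite (P x)" "x \<in> A \<Longrightarrow> P x \<subseteq> B x" for x using F by (auto simp: P_def dest: PiE_mem)
    have FP: "F \<subseteq> PiE A P" using F by (auto simp: P_def PiE_iff)
    have "sum (\<lambda>g. \<Prod>x\<in>A. f x (g x)) F \<le> (\<Sum>g\<in>PiE A P. \<Prod>x\<in>A. f x (g x))"
    proof (rule sum_mono2)
      show "0 \<le> (\<Prod>x\<in>A. f x (g x))" if "g \<in> PiE A P - F" for g
      proof (rule prod_nonneg)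
        fix x assume "x \<in> A"
        then show "0 \<le> f x (g x)" using nn P(2) that PiE_mem[of g A P x] by blast
      qed
    qed (use A P FP in \<open>auto intro: finite_PiE\<close>)
    also have "\<dots> = (\<Prod>x\<in>A. \<Sum>y\<in>P x. f x y)" by (rule prod_sum_PiE[symmetric]) (use A P in auto)
    also have "\<dots> \<le> (\<Prod>x\<in>A. infsum (f x) (B x))"
    proof (intro prod_mono conjI)
      fix x assume x: "x \<in> A"
      have "0 \<le> f x y" if "y \<in> P x" for y using nn[OF x] P(2)[OF x] that by blast
      then show "0 \<le> (\<Sum>y\<in>P x. f x y)" by (rule sum_nonneg)
      show "(\<Sum>y\<in>P x. f x y) \<le> infsum (f x) (B x)"
        by (rule finite_sum_le_infsum[OF f[OF x] P(1) P(2)[OF x]]) (use nn x in auto)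
    qed
    finally show "sum (\<lambda>g. \<Prod>x\<in>A. f x (g x)) F \<le> (\<Prod>x\<in>A. infsum (f x) (B x))" .
  qed
qed

abbreviation lattice_points :: "(nat \<Rightarrow> int) set" where
  "lattice_points \<equiv> (\<Pi>\<^sub>E j\<in>{1..24}. UNIV)"

definition lattice_term :: "int \<Rightarrow> (nat \<Rightarrow> int) \<Rightarrow> complex \<Rightarrow> (nat \<Rightarrow> int) \<Rightarrow> complex" where
  "lattice_term k v t n = (\<Prod>j\<in>{1..24}. thterm (of_int (v j) / (2 * of_int k)) 0 (2 * of_int k * t) (n j))"

lemma norm_coset_term:
  assumes k: "k > 0"
  shows "norm (thterm (of_int r / (2 * of_int k)) 0 (2 * of_int k * t) n) = exp (- (Im t * (pi / (2 * of_int k) * of_int ((2 * k * n + r)\<^sup>2))))"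
proof -
  have "norm (thterm (of_real (of_int r / (2 * of_int k))) (of_real 0) (2 * of_int k * t) n)
     = exp (- (Im (2 * of_int k * t) * (pi * (of_int n + of_int r / (2 * of_int k))\<^sup>2)))"
    by (rule norm_thterm_real)
  also have "Im (2 * of_int k * t) * (pi * (of_int n + of_int r / (2 * of_int k))\<^sup>2) = Im t * (pi / (2 * of_int k) * of_int ((2 * k * n + r)\<^sup>2))"
    using k by (simp add: field_simps power2_eq_square)
  finally show ?thesis by simp
qed

lemma norm_lattice_term:
  assumes k: "k > 0"
  shows "norm (lattice_term k v t n) = exp (- (Im t * (pi / (2 * of_int k) * of_int (\<Sum>j\<in>{1..24}. (2 * k * n j + v j)\<^sup>2))))"
proof -
  have "norm (lattice_term k v t n) = exp (\<Sum>j\<in>{1..24}. - (Im t * (pi / (2 * of_int k) * of_int ((2 * k * n j + v j)\<^sup>2))))"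
    unfolding lattice_term_def prod_norm[symmetric] norm_coset_term[OF k] by (rule exp_sum[symmetric]) simp
  then show ?thesis by (simp only: sum_negf sum_distrib_left of_int_sum)
qed

lemma lattice_term_summable:
  assumes k: "k > 0" and t: "Im t > 0"
  shows "(\<lambda>n. norm (lattice_term k v t n)) summable_on lattice_points"
  unfolding lattice_term_def prod_norm[symmetric]
  by (rule summable_on_prod_PiE) (use k t in \<open>auto intro!: thterm_abs_summable\<close>)

lemma prod_coset_theta:
  assumes k: "k > 0" and t: "Im t > 0"
  shows "(\<Prod>j\<in>{1..24}. coset_theta k (v j) t) = infsum (lattice_term k v t) lattice_points"
  unfolding lattice_term_def[abs_def] coset_theta_def theta_def
  by (rule infsum_prod_PiE_abs[symmetric]) (use k t in \<open>auto intro!: thterm_abs_summable\<close>)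

text \<open>A squared length \<open>s * k\<close> before division by \<open>2 * k\<close> is the
  order \<open>s / 4\<close> in q: the bound 8 gives order 2, and the bound 3 gives order
  3/4.\<close>

lemma lattice_sum_decay:
  assumes k: "k > 0" and X: "X \<subseteq> lattice_points"
    and s: "\<And>n. n \<in> X \<Longrightarrow> s * k \<le> (\<Sum>j\<in>{1..24}. (2 * k * n j + v j)\<^sup>2)"
  obtains M where "\<And>t. Im t \<ge> 1 \<Longrightarrow> norm (infsum (lattice_term k v t) X) \<le> M * exp (- (of_int s * pi / 2 * Im t))"
proof -
  define e where "e = (\<lambda>n. pi / (2 * of_int k) * of_int (\<Sum>j\<in>{1..24}. (2 * k * n j + v j)\<^sup>2))"
  have "(\<lambda>n. norm (lattice_term k v \<i> n)) summable_on X"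
    by (rule summable_on_subset[OF lattice_term_summable X]) (use k in auto)
  then have sum: "(\<lambda>n. exp (- (1 * e n))) summable_on X"
    unfolding norm_lattice_term[OF k] e_def by simp
  have es: "of_int s * pi / 2 \<le> e n" if "n \<in> X" for n
  proof -
    have "real_of_int (s * k) \<le> of_int (\<Sum>j\<in>{1..24}. (2 * k * n j + v j)\<^sup>2)" using s[OF that] by linarith
    then have "pi / (2 * of_int k) * of_int (s * k) \<le> e n" unfolding e_def using k by (intro mult_left_mono) auto
    then show ?thesis using k by (simp add: field_simps)
  qed
  show thesis
    by (rule that, rule infsum_exp_decay[OF sum es]) (auto simp: norm_lattice_term[OF k] e_def)
qed

lemma sum_decay:
  fixes f :: "'a \<Rightarrow> complex \<Rightarrow> complex"
  assumes fin: "finite A" and f: "\<And>x. x \<in> A \<Longrightarrow> \<exists>M. \<forall>t. Im t \<ge> 1 \<longrightarrow> norm (f x t) \<le> M * exp (- (a * Im t))"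
  shows "\<exists>M. \<forall>t. Im t \<ge> 1 \<longrightarrow> norm (\<Sum>x\<in>A. f x t) \<le> M * exp (- (a * Im t))"
proof -
  obtain M where M: "\<And>x t. x \<in> A \<Longrightarrow> Im t \<ge> 1 \<Longrightarrow> norm (f x t) \<le> M x * exp (- (a * Im t))"
    using f by metis
  have "norm (\<Sum>x\<in>A. f x t) \<le> (\<Sum>x\<in>A. M x) * exp (- (a * Im t))" if "Im t \<ge> 1" for t
    unfolding sum_distrib_right by (rule sum_norm_le) (use M that in auto)
  then show ?thesis by blast
qed

lemma shifted_code_theta_decay:
  assumes k: "k \<ge> 2" "odd k" and C: "extremal_type_II_code_24 k C" and i: "i \<in> {1..24}"
  shows "\<exists>M. \<forall>t. Im t \<ge> 1 \<longrightarrow> norm (shifted_code_theta k C i t) \<le> M * exp (- (3/2 * pi * Im t))"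
proof -
  have k0: "k > 0" using k by simp
  have fin: "finite C" using C is_code_finite by (auto simp: extremal_type_II_code_24_def type_II_code_def self_dual_code_def)
  have "\<exists>M. \<forall>t. Im t \<ge> 1 \<longrightarrow> norm (\<Prod>j\<in>{1..24}. coset_theta k (c j + (if j = i then k else 0)) t) \<le> M * exp (- (3/2 * pi * Im t))" if c: "c \<in> C" for c
  proof -
    define v where "v = (\<lambda>j. c j + (if j = i then k else 0))"
    have "3 * k \<le> (\<Sum>j\<in>{1..24}. (2 * k * n j + v j)\<^sup>2)" for n
      by (rule extremal_shifted_square_sum[OF k C c i]) (simp add: v_def cong_iff_dvd_diff)
    then obtain M where "\<And>t. Im t \<ge> 1 \<Longrightarrow> norm (infsum (lattice_term k v t) lattice_points) \<le> M * exp (- (of_int 3 * pi / 2 * Im t))"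
      using lattice_sum_decay[OF k0 order_refl, of 3 v] by blast
    then have "\<forall>t. Im t \<ge> 1 \<longrightarrow> norm (\<Prod>j\<in>{1..24}. coset_theta k (v j) t) \<le> M * exp (- (3/2 * pi * Im t))"
      using prod_coset_theta[OF k0, of _ v] by simp
    then show ?thesis unfolding v_def by blast
  qed
  then show ?thesis unfolding shifted_code_theta_def by (rule sum_decay[OF fin])
qed

lemma code_theta_decay:
  assumes k: "k \<ge> 2" and C: "extremal_type_II_code_24 k C" and i: "i \<in> {1..24}"
  shows "\<exists>M. \<forall>t. Im t \<ge> 1 \<longrightarrow> norm (code_theta k C i t - 1) \<le> M * exp (- (4 * pi * Im t))"
proof -
  have k0: "k > 0" using k by simp
  have code: "is_code k 24 C" using C by (auto simp: extremal_type_II_code_24_def type_II_code_def self_dual_code_def)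
  have fin: "finite C" by (rule is_code_finite[OF code])
  define z :: "nat \<Rightarrow> int" where "z = (\<lambda>j\<in>{1..24}. 0)"
  have z: "z \<in> C" unfolding z_def by (rule is_code_zero[OF code])
  \<comment> \<open>The constant 1 is charged to the zero word, where it cancels the contribution of
    the origin; every word can then be estimated separately.\<close>
  define f where "f = (\<lambda>c t. (-1) powi tau i c * (\<Prod>j\<in>{1..24}. coset_theta k (c j) t) - (if c = z then 1 else 0))"
  have "\<exists>M. \<forall>t. Im t \<ge> 1 \<longrightarrow> norm (f c t) \<le> M * exp (- (4 * pi * Im t))" if c: "c \<in> C" for c
  proof -
    define X where "X = (if c = z then lattice_points - {z} else lattice_points)"
    have XL: "X \<subseteq> lattice_points" by (auto simp: X_def)
    have cV: "c \<in> (\<Pi>\<^sub>E j\<in>{1..24}. {0..2 * k - 1})" using is_code_subset[OF code] c by (auto simp: carrier_residue_module)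
    have "8 * k \<le> (\<Sum>j\<in>{1..24}. (2 * k * n j + c j)\<^sup>2)" if n: "n \<in> X" for n
    proof (rule extremal_square_sum[OF k C c])
      show "\<exists>j\<in>{1..24}. 2 * k * n j + c j \<noteq> 0"
      proof (rule ccontr)
        assume "\<not> ?thesis"
        then have e: "2 * k * n j + c j = 0" if "j \<in> {1..24}" for j using that by blast
        have c0: "c j = 0" if j: "j \<in> {1..24}" for j
        proof -
          have "2 * k dvd c j"
          by (rule dvdI[of _ _ "- n j"]) (use e[OF j] in simp)
          moreover have "0 \<le> c j" "c j < 2 * k" using PiE_mem[OF cV j] by auto
          ultimately show ?thesis using zdvd_not_zless[of "c j" "2 * k"] by force
        qed
        have cz: "c = z" by (rule PiE_ext[OF cV]) (use c0 k0 in \<open>auto simp: z_def\<close>)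
        then have nL: "n \<in> lattice_points" "n \<noteq> z" using n by (auto simp: X_def)
        moreover have "n = z" by (rule PiE_ext[OF nL(1)]) (use e c0 k0 in \<open>auto simp: z_def\<close>)
        ultimately show False by simp
      qed
    qed (simp add: cong_iff_dvd_diff)
    then obtain M where M: "\<And>t. Im t \<ge> 1 \<Longrightarrow> norm (infsum (lattice_term k c t) X) \<le> M * exp (- (of_int 8 * pi / 2 * Im t))"
      using lattice_sum_decay[OF k0 XL, of 8 c] by blast
    have "norm (f c t) = norm (infsum (lattice_term k c t) X)" if t: "Im t \<ge> 1" for t
    proof (cases "c = z")
      case True
      have t0: "Im t > 0" using t by simp
      have "tau i z = 0" using i by (simp add: tau_def z_def)
      have s: "lattice_term k c t summable_on lattice_points"
        by (rule abs_summable_summable[OF lattice_term_summable[OF k0]]) (use t in simp)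
      have "infsum (lattice_term k c t) (insert z (lattice_points - {z})) = lattice_term k c t z + infsum (lattice_term k c t) (lattice_points - {z})"
        by (rule infsum_insert[OF summable_on_subset[OF s]]) auto
      moreover have "insert z (lattice_points - {z}) = lattice_points" by (auto simp: z_def)
      moreover have "lattice_term k c t z = 1" using True by (simp add: lattice_term_def z_def thterm_def)
      ultimately have e: "infsum (lattice_term k c t) lattice_points = 1 + infsum (lattice_term k c t) (lattice_points - {z})"
        by simp
      have "f c t = infsum (lattice_term k c t) X"
        unfolding f_def prod_coset_theta[OF k0 t0] e X_def using True \<open>tau i z = 0\<close> by simp
      then show ?thesis by simp
    next
      case False
      have t0: "Im t > 0" using t by simp
      have "norm ((-1 :: complex) powi tau i c) = 1" by (simp add: norm_power_int)
      then show ?thesis unfolding f_def prod_coset_theta[OF k0 t0] using False by (simp add: X_def norm_mult)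
    qed
    then show ?thesis using M by (intro exI[of _ M]) (auto simp: mult_ac)
  qed
  then have "\<exists>M. \<forall>t. Im t \<ge> 1 \<longrightarrow> norm (\<Sum>c\<in>C. f c t) \<le> M * exp (- (4 * pi * Im t))" by (rule sum_decay[OF fin])
  moreover have "(\<Sum>c\<in>C. f c t) = code_theta k C i t - 1" for t
    using z fin by (simp add: f_def code_theta_def sum_subtractf)
  ultimately show ?thesis by simp
qed

theorem code_theta_eq_ref_form:
  assumes k: "k \<ge> 2" "odd k" and C: "extremal_type_II_code_24 k C" and i: "i \<in> {1..24}" and t: "Im t > 0"
  shows "code_theta k C i t = ref_form t"
proof -
  have k0: "k > 0" using k by simp
  have II: "type_II_code k 24 C" and sd: "self_dual_code k 24 C"
    using C by (auto simp: extremal_type_II_code_24_def type_II_code_def)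
  obtain m where m: "m > 0" "\<And>t. Im t \<ge> 1 \<Longrightarrow> norm (Delta t) \<ge> m * exp (- (2 * pi * Im t))"
    using Delta_lower_bound by blast
  obtain M1 where M1: "\<And>t. Im t \<ge> 1 \<Longrightarrow> norm (code_theta k C i t - 1) \<le> M1 * exp (- (4 * pi * Im t))"
    using code_theta_decay[OF k(1) C i] by blast
  obtain M2 where M2: "\<And>t. Im t \<ge> 1 \<Longrightarrow> norm (ref_form t - 1) \<le> M2 * exp (- (4 * pi * Im t))"
    using ref_form_decay by blast
  obtain M3 where M3: "\<And>t. Im t \<ge> 1 \<Longrightarrow> norm (shifted_code_theta k C i t) \<le> M3 * exp (- (3/2 * pi * Im t))"
    using shifted_code_theta_decay[OF k C i] by blast
  obtain M4 where M4: "\<And>t. Im t \<ge> 1 \<Longrightarrow> norm (ref_form_dual t) \<le> M4 * exp (- (3/2 * pi * Im t))"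
    using ref_form_dual_decay by blast
  define a where "a = (\<lambda>t. code_theta k C i t - ref_form t)"
  define b where "b = (\<lambda>t. shifted_code_theta k C i t - ref_form_dual t)"
  have "a t = 0"
  proof (rule gamma02_form_unique[where a = a and b = b and D = Delta and m = m and Ma = "M1 + M2" and Mb = "M3 + M4"])
    show "a holomorphic_on upper_half_plane" "b holomorphic_on upper_half_plane"
      unfolding a_def b_def by (intro holomorphic_intros code_theta_holomorphic ref_form_holomorphic ref_form_dual_holomorphic k0)+
    show "a (t + 1) = a t" for t
      by (simp add: a_def code_theta_plus_1[OF k0 II] ref_form_plus_1)
    show "a (- (1 / t)) = t ^ 12 * b t" if "Im t > 0" for t
      unfolding a_def b_def code_theta_inversion[OF k0 sd i that] ref_form_inversion[OF that] by (simp add: right_diff_distrib)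
    show "b (t + 2) = - b t" for t
      unfolding b_def shifted_code_theta_plus_2[OF k0 k(2) II i] ref_form_dual_plus_2 by simp
    show "norm (a t) \<le> (M1 + M2) * exp (- (4 * pi * Im t))" if "Im t \<ge> 1" for t
    proof -
      have "a t = (code_theta k C i t - 1) - (ref_form t - 1)" by (simp add: a_def)
      then have "norm (a t) \<le> norm (code_theta k C i t - 1) + norm (ref_form t - 1)" by (metis norm_triangle_ineq4)
      then show ?thesis using M1[OF that] M2[OF that] by (simp add: ring_distribs)
    qed
    show "norm (b t) \<le> (M3 + M4) * exp (- (3/2 * pi * Im t))" if "Im t \<ge> 1" for t
    proof -
      have "norm (b t) \<le> norm (shifted_code_theta k C i t) + norm (ref_form_dual t)" unfolding b_def by (rule norm_triangle_ineq4)
      then show ?thesis using M3[OF that] M4[OF that] by (simp add: ring_distribs)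
    qed
  qed (use t m Delta_holomorphic Delta_nonzero Delta_plus_1 Delta_inversion in auto)
  then show ?thesis by (simp add: a_def)
qed

section \<open>The graded modules of the lattice vertex operator algebra\<close>

interpretation fun_space: vector_space fun_scale
  by (rule vector_space_fun_scale)

lemma sum_fun_apply: "(\<Sum>x\<in>A. F x) b = (\<Sum>x\<in>A. F x b)" for F :: "'a \<Rightarrow> 'b \<Rightarrow> complex"
  by (induction A rule: infinite_finite_induct) (simp_all add: zero_fun_def)

definition unit_fun :: "'b \<Rightarrow> 'b \<Rightarrow> complex" where
  "unit_fun b = (\<lambda>b'. if b' = b then 1 else 0)"

lemma subspace_free_space: "fun_space.subspace (free_space B)"
proof (rule fun_space.subspaceI)
  show "0 \<in> free_space B" by (simp add: free_space_def zero_fun_def)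
  show "x + y \<in> free_space B" if "x \<in> free_space B" "y \<in> free_space B" for x y
  proof -
    have "{b. (x + y) b \<noteq> 0} \<subseteq> {b. x b \<noteq> 0} \<union> {b. y b \<noteq> 0}" by auto
    then show ?thesis using that unfolding free_space_def by (auto intro: finite_subset)
  qed
  show "fun_scale a x \<in> free_space B" if "x \<in> free_space B" for a x
  proof -
    have "{b. fun_scale a x b \<noteq> 0} \<subseteq> {b. x b \<noteq> 0}" by (auto simp: fun_scale_def)
    then show ?thesis using that unfolding free_space_def by (auto intro: finite_subset)
  qed
qed

lemma pure_tensor_in_free_space:
  assumes J: "finite J" and f: "\<And>j. j \<in> J \<Longrightarrow> f j \<in> free_space (B j)"
  shows "pure_tensor J f \<in> free_space (PiE J B)"
proof -
  have s: "{b. pure_tensor J f b \<noteq> 0} \<subseteq> (\<Pi>\<^sub>E j\<in>J. {x. f j x \<noteq> 0})"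
    using J by (auto simp: pure_tensor_def PiE_def split: if_splits)
  have "finite (\<Pi>\<^sub>E j\<in>J. {x. f j x \<noteq> 0})" by (rule finite_PiE[OF J]) (use f in \<open>auto simp: free_space_def\<close>)
  moreover have "(\<Pi>\<^sub>E j\<in>J. {x. f j x \<noteq> 0}) \<subseteq> PiE J B" by (rule PiE_mono) (use f in \<open>auto simp: free_space_def\<close>)
  ultimately show ?thesis using s unfolding free_space_def by (auto intro: finite_subset)
qed

lemma tensor_space_free_subset:
  assumes "finite J" shows "tensor_space J (\<lambda>j. free_space (B j)) \<subseteq> free_space (PiE J B)"
  unfolding tensor_space_def
  by (rule fun_space.span_minimal[OF _ subspace_free_space]) (use pure_tensor_in_free_space[OF assms] in auto)

text \<open>With \<open>tensor_space_free_subset\<close>, this encloses the tensor product between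
  the unit functions and the finitely supported ones, so weight spaces can be computed with labels
  instead of tensors.\<close>

lemma unit_fun_in_tensor_space:
  assumes J: "finite J" and b: "b \<in> PiE J B"
  shows "unit_fun b \<in> tensor_space J (\<lambda>j. free_space (B j))"
proof -
  have "unit_fun b = pure_tensor J (\<lambda>j. unit_fun (b j))"
  proof
    fix b'
    show "unit_fun b b' = pure_tensor J (\<lambda>j. unit_fun (b j)) b'"
    proof (cases "b' = b")
      case True
      then show ?thesis using b by (simp add: unit_fun_def pure_tensor_def PiE_def)
    next
      case False
      \<comment> \<open>Two different extensional functions differ inside \<open>J\<close>, where
        one factor vanishes; on functions that are not extensional, \<open>pure_tensor\<close> is 0
        by definition.\<close>
      have "\<exists>j\<in>J. b' j \<noteq> b j" if "b' \<in> extensional J"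
        using False that b extensionalityI[of b' J b] by (auto simp: PiE_def)
      then show ?thesis using False J by (auto simp: unit_fun_def pure_tensor_def intro!: prod_zero[symmetric])
    qed
  qed
  moreover have "unit_fun (b j) \<in> free_space (B j)" if "j \<in> J" for j
  proof -
    have "{x. unit_fun (b j) x \<noteq> 0} = {b j}" by (auto simp: unit_fun_def)
    then show ?thesis using PiE_mem[OF b that] by (simp add: free_space_def)
  qed
  ultimately show ?thesis unfolding tensor_space_def by (intro fun_space.span_base) auto
qed

lemma free_space_expansion:
  assumes "finite S" "v \<in> free_space S"
  shows "v = (\<Sum>b\<in>S. fun_scale (v b) (unit_fun b))"
proof
  fix b
  have "(\<Sum>b'\<in>S. fun_scale (v b') (unit_fun b')) b = (\<Sum>b'\<in>S. if b' = b then v b else 0)"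
    unfolding sum_fun_apply by (rule sum.cong) (auto simp: fun_scale_def unit_fun_def)
  then show "v b = (\<Sum>b\<in>S. fun_scale (v b) (unit_fun b)) b"
    using assms by (auto simp: free_space_def)
qed

section \<open>Weight spaces and their dimensions\<close>

definition fock_labels :: "int \<Rightarrow> int \<Rightarrow> fock_label set" where
  "fock_labels k r = {(\<mu>, x). 0 \<notin># \<mu> \<and> x - real_of_int r / real_of_int (2 * k) \<in> \<int>}"

definition M_labels :: "int \<Rightarrow> (nat \<Rightarrow> int) \<Rightarrow> (nat \<Rightarrow> fock_label) set" where
  "M_labels k c = (\<Pi>\<^sub>E j\<in>{1..24}. fock_labels k (c j))"

definition total_weight :: "int \<Rightarrow> (nat \<Rightarrow> fock_label) \<Rightarrow> real" where
  "total_weight k b = (\<Sum>j\<in>{1..24}. conformal_weight k (b j))"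

text \<open>\<open>L0\<close> is diagonal on the unit functions, so an eigenvector is supported on
  labels of its own weight. The finiteness assumed here is derived in \<open>ch_M_eq\<close> from
  convergence of the q-series.\<close>

lemma dim_weight_space:
  assumes fin: "finite {b \<in> M_labels k c. total_weight k b = w}"
  shows "vector_space.dim fun_scale (weight_space k c w) = card {b \<in> M_labels k c. total_weight k b = w}"
proof -
  define S where "S = {b \<in> M_labels k c. total_weight k b = w}"
  have finS: "finite S" using fin by (simp add: S_def)
  have M: "M_module k c = tensor_space {1..24} (\<lambda>j. free_space (fock_labels k (c j)))"
    by (simp add: M_module_def lattice_module_def fock_labels_def)
  have L0: "L0 k v b = complex_of_real (total_weight k b) * v b" for v b
    by (simp add: L0_def total_weight_def)
  have inj: "inj_on unit_fun S" by (rule inj_onI) (metis unit_fun_def zero_neq_one)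
  have sub: "unit_fun ` S \<subseteq> weight_space k c w"
  proof
    fix v assume "v \<in> unit_fun ` S"
    then obtain b where b: "b \<in> S" "v = unit_fun b" by blast
    have "unit_fun b \<in> M_module k c" unfolding M
      by (rule unit_fun_in_tensor_space) (use b in \<open>auto simp: S_def M_labels_def\<close>)
    moreover have "L0 k v = fun_scale (complex_of_real w) v"
      by (rule ext) (use b in \<open>simp add: L0 fun_scale_def unit_fun_def S_def\<close>)
    ultimately show "v \<in> weight_space k c w" using b by (simp add: weight_space_def)
  qed
  have span: "weight_space k c w \<subseteq> fun_space.span (unit_fun ` S)"
  proof
    fix v assume v: "v \<in> weight_space k c w"
    then have vM: "v \<in> M_module k c" and vL: "L0 k v = fun_scale (complex_of_real w) v" by (auto simp: weight_space_def)
    have vf: "v \<in> free_space (M_labels k c)"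
      using vM tensor_space_free_subset[of "{1..24}" "\<lambda>j. fock_labels k (c j)"] unfolding M M_labels_def by auto
    have "total_weight k b = w" if "v b \<noteq> 0" for b
      using fun_cong[OF vL, of b] that by (simp add: L0 fun_scale_def)
    then have "v \<in> free_space S" using vf by (auto simp: free_space_def S_def)
    then have "v = (\<Sum>b\<in>S. fun_scale (v b) (unit_fun b))" by (rule free_space_expansion[OF finS])
    then show "v \<in> fun_space.span (unit_fun ` S)"
      by (metis (no_types, lifting) fun_space.span_sum fun_space.span_scale fun_space.span_base imageI)
  qed
  have indep: "fun_space.independent (unit_fun ` S)"
  proof (rule fun_space.independent_if_scalars_zero)
    show "finite (unit_fun ` S)" using finS by simp
    fix f x assume 0: "(\<Sum>x\<in>unit_fun ` S. fun_scale (f x) x) = 0" and x: "x \<in> unit_fun ` S"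
    obtain b where b: "b \<in> S" "x = unit_fun b" using x by blast
    have "(\<Sum>b'\<in>S. fun_scale (f (unit_fun b')) (unit_fun b')) = 0"
      using 0 by (simp add: sum.reindex[OF inj])
    from fun_cong[OF this, of b] have "(\<Sum>b'\<in>S. fun_scale (f (unit_fun b')) (unit_fun b') b) = 0"
      by (simp add: sum_fun_apply)
    moreover have "(\<Sum>b'\<in>S. fun_scale (f (unit_fun b')) (unit_fun b') b) = (\<Sum>b'\<in>S. if b' = b then f (unit_fun b) else 0)"
      by (rule sum.cong) (auto simp: fun_scale_def unit_fun_def)
    ultimately show "f x = 0" using b finS by simp
  qed
  show ?thesis
    using fun_space.dim_unique[OF sub span indep refl] card_image[OF inj] by (simp add: S_def)
qed

text \<open>Turns absolute convergence into finite dimension: on the labels of one weight, the terms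
  of the q-series have a constant positive modulus.\<close>

lemma finite_if_constant_summable:
  fixes c :: real
  assumes "(\<lambda>_. c) summable_on B" "c > 0"
  shows "finite B"
proof (rule ccontr)
  assume inf: "infinite B"
  obtain n :: nat where n: "infsum (\<lambda>_. c) B < real n * c"
    using reals_Archimedean3[OF assms(2)] by blast
  obtain F where F: "finite F" "card F = n" "F \<subseteq> B" using infinite_arbitrarily_large[OF inf] by blast
  have "(\<Sum>_\<in>F. c) \<le> infsum (\<lambda>_. c) B" by (rule finite_sum_le_infsum) (use assms F in auto)
  then show False using n F by simp
qed

section \<open>The generating function of partitions\<close>

definition parts_upto :: "nat \<Rightarrow> nat multiset set" where
  "parts_upto N = {\<mu>. set_mset \<mu> \<subseteq> {1..N}}"

text \<open>Separates the multiplicity of the largest admissible part, so that the induction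
  multiplies by one geometric series per part size.\<close>

lemma bij_parts_upto_Suc:
  "bij_betw (\<lambda>(m, \<mu>). \<mu> + replicate_mset m (Suc N)) (UNIV \<times> parts_upto N) (parts_upto (Suc N))"
proof (rule bij_betwI[where g = "\<lambda>\<mu>. (count \<mu> (Suc N), filter_mset (\<lambda>n. n \<le> N) \<mu>)"])
  show "(\<lambda>(m, \<mu>). \<mu> + replicate_mset m (Suc N)) \<in> UNIV \<times> parts_upto N \<rightarrow> parts_upto (Suc N)"
    by (fastforce simp: parts_upto_def)
  show "(\<lambda>\<mu>. (count \<mu> (Suc N), filter_mset (\<lambda>n. n \<le> N) \<mu>)) \<in> parts_upto (Suc N) \<rightarrow> UNIV \<times> parts_upto N"
    by (fastforce simp: parts_upto_def)
  fix p :: "nat \<times> nat multiset" assume "p \<in> UNIV \<times> parts_upto N"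
  then obtain m \<mu> where p: "p = (m, \<mu>)" and \<mu>: "set_mset \<mu> \<subseteq> {1..N}" by (auto simp: parts_upto_def)
  have "Suc N \<notin># \<mu>" using \<mu> by auto
  then have 1: "count \<mu> (Suc N) = 0" by (simp add: not_in_iff)
  have 2: "filter_mset (\<lambda>n. n \<le> N) \<mu> = \<mu>" using \<mu> by (auto simp: filter_mset_eq_conv)
  have 3: "filter_mset (\<lambda>n. n \<le> N) (replicate_mset m (Suc N)) = {#}" by (auto simp: filter_mset_eq_conv)
  show "(\<lambda>\<mu>. (count \<mu> (Suc N), filter_mset (\<lambda>n. n \<le> N) \<mu>)) ((\<lambda>(m, \<mu>). \<mu> + replicate_mset m (Suc N)) p) = p"
    using 1 2 3 by (simp add: p)
next
  fix \<mu> assume "\<mu> \<in> parts_upto (Suc N)"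
  then have \<mu>: "set_mset \<mu> \<subseteq> {1..Suc N}" by (simp add: parts_upto_def)
  have "count (filter_mset (\<lambda>n. n \<le> N) \<mu> + replicate_mset (count \<mu> (Suc N)) (Suc N)) n = count \<mu> n" for n
  proof -
    have "count \<mu> n = 0" if "n > Suc N" using \<mu> that by (auto simp: not_in_iff[symmetric])
    then show ?thesis by (cases "n \<le> N"; cases "n = Suc N") auto
  qed
  then show "(\<lambda>(m, \<mu>). \<mu> + replicate_mset m (Suc N)) ((\<lambda>\<mu>. (count \<mu> (Suc N), filter_mset (\<lambda>n. n \<le> N) \<mu>)) \<mu>) = \<mu>"
    by (auto intro: multiset_eqI)
qed

lemma summable_on_product:
  fixes f :: "'a \<Rightarrow> real" and g :: "'b \<Rightarrow> real"
  assumes f: "f summable_on A" and g: "g summable_on B" and nn: "\<And>x. x \<in> A \<Longrightarrow> f x \<ge> 0" "\<And>y. y \<in> B \<Longrightarrow> g y \<ge> 0"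
  shows "(\<lambda>(x, y). f x * g y) summable_on A \<times> B"
  by (rule summable_on_SigmaI[where g = "\<lambda>x. f x * infsum g B"])
     (use assms in \<open>auto intro!: has_sum_cmult_right has_sum_infsum summable_on_cmult_left\<close>)

lemma infsum_product:
  fixes f :: "'a \<Rightarrow> 'c :: {real_normed_field, banach}" and g :: "'b \<Rightarrow> 'c"
  assumes f: "(\<lambda>x. norm (f x)) summable_on A" and g: "(\<lambda>y. norm (g y)) summable_on B"
  shows "infsum (\<lambda>(x, y). f x * g y) (A \<times> B) = infsum f A * infsum g B"
proof -
  have "(\<lambda>p. norm ((\<lambda>(x, y). f x * g y) p)) summable_on A \<times> B"
    using summable_on_product[OF f g] by (simp add: norm_mult case_prod_unfold)
  then have "(\<lambda>(x, y). f x * g y) summable_on A \<times> B" by (rule abs_summable_summable)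
  then have "infsum (\<lambda>(x, y). f x * g y) (A \<times> B) = (\<Sum>\<^sub>\<infinity>x\<in>A. \<Sum>\<^sub>\<infinity>y\<in>B. f x * g y)"
    by (rule infsum_Sigma'_banach[symmetric])
  then show ?thesis by (simp add: infsum_cmult_right' infsum_cmult_left')
qed

text \<open>Summability and value are carried through the induction together, since the product
  formula for sums needs absolute summability. The type is general because the real instance at
  \<open>norm q\<close> bounds the complex one.\<close>

lemma partition_sum_upto:
  fixes q :: "'a :: {real_normed_field, banach}"
  assumes q: "norm q < 1"
  shows "(\<lambda>\<mu>. norm (q ^ sum_mset \<mu>)) summable_on parts_upto N \<and>
    infsum (\<lambda>\<mu>. q ^ sum_mset \<mu>) (parts_upto N) = 1 / (\<Prod>n<N. 1 - q ^ Suc n)"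
proof (induction N)
  case 0
  have "parts_upto 0 = {{#}}" by (auto simp: parts_upto_def)
  then show ?case by simp
next
  case (Suc N)
  define h where "h = (\<lambda>(m, \<mu>). \<mu> + replicate_mset m (Suc N))"
  have bij: "bij_betw h (UNIV \<times> parts_upto N) (parts_upto (Suc N))" unfolding h_def by (rule bij_parts_upto_Suc)
  have hq: "q ^ sum_mset (h (m, \<mu>)) = (q ^ Suc N) ^ m * q ^ sum_mset \<mu>" for m \<mu>
    by (simp add: h_def power_add power_mult_distrib power_mult[symmetric] mult.commute)
  have qN: "norm (q ^ Suc N) < 1"
  proof -
    have "norm q * norm q ^ N \<le> norm q" using q by (simp add: mult_left_le power_le_one)
    then show ?thesis using q by (simp add: norm_power norm_mult)
  qed
  have s1: "(\<lambda>m. norm ((q ^ Suc N) ^ m)) summable_on UNIV"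
    unfolding norm_power using qN by (intro summable_nonneg_imp_summable_on summable_geometric) (auto simp: norm_power norm_mult)
  have i1: "infsum (\<lambda>m. (q ^ Suc N) ^ m) UNIV = 1 / (1 - q ^ Suc N)"
    by (rule infsumI, rule norm_summable_imp_has_sum)
       (use geometric_sums[OF qN] qN in \<open>auto simp: norm_power norm_mult intro!: summable_geometric\<close>)
  have S: "(\<lambda>(m, \<mu>). norm ((q ^ Suc N) ^ m) * norm (q ^ sum_mset \<mu>)) summable_on UNIV \<times> parts_upto N"
    by (rule summable_on_product[OF s1 conjunct1[OF Suc]]) auto
  have "(\<lambda>p. norm (q ^ sum_mset (h p))) summable_on UNIV \<times> parts_upto N"
    using S by (rule summable_on_cong[THEN iffD1, rotated]) (auto simp: hq norm_mult)
  then have 1: "(\<lambda>\<mu>. norm (q ^ sum_mset \<mu>)) summable_on parts_upto (Suc N)"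
    using summable_on_reindex_bij_betw[OF bij, of "\<lambda>\<mu>. norm (q ^ sum_mset \<mu>)"] by simp
  have "infsum (\<lambda>\<mu>. q ^ sum_mset \<mu>) (parts_upto (Suc N)) = infsum (\<lambda>p. q ^ sum_mset (h p)) (UNIV \<times> parts_upto N)"
    by (rule infsum_reindex_bij_betw[OF bij, symmetric])
  also have "\<dots> = infsum (\<lambda>(m, \<mu>). (q ^ Suc N) ^ m * q ^ sum_mset \<mu>) (UNIV \<times> parts_upto N)"
    by (rule infsum_cong) (auto simp: hq)
  also have "\<dots> = 1 / (1 - q ^ Suc N) * (1 / (\<Prod>n<N. 1 - q ^ Suc n))"
    by (simp only: infsum_product[OF s1 conjunct1[OF Suc]] i1 conjunct2[OF Suc])
  finally show ?case using 1 by simp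
qed

lemma parts_upto_finite_subset:
  assumes "finite F" "F \<subseteq> {\<mu>. 0 \<notin># \<mu>}"
  obtains N where "F \<subseteq> parts_upto N"
proof
  define N where "N = Max (insert 0 (\<Union>\<mu>\<in>F. set_mset \<mu>))"
  show "F \<subseteq> parts_upto N"
  proof
    fix \<mu> assume \<mu>: "\<mu> \<in> F"
    have "1 \<le> n \<and> n \<le> N" if n: "n \<in># \<mu>" for n
    proof -
      have "0 \<notin># \<mu>" using assms(2) \<mu> by blast
      then have "n \<noteq> 0" using n by metis
      moreover have "n \<le> N" unfolding N_def by (rule Max_ge) (use assms \<mu> n in auto)
      ultimately show ?thesis by simp
    qed
    then show "\<mu> \<in> parts_upto N" by (auto simp: parts_upto_def)
  qed
qed

text \<open>Every finite set of partitions lies in some \<open>parts_upto N\<close>. The sums over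
  these at \<open>norm q\<close> are reciprocals of \<open>qpoch\<close>, which converge and are
  therefore bounded.\<close>

lemma partition_sum_summable:
  fixes q :: complex
  assumes q: "norm q < 1"
  shows "(\<lambda>\<mu>. norm (q ^ sum_mset \<mu>)) summable_on {\<mu>. 0 \<notin># \<mu>}"
proof (rule nonneg_bdd_above_summable_on)
  define r where "r = norm q"
  have r: "norm r < 1" using q by (simp add: r_def)
  have rc: "norm (complex_of_real r) < 1" using q by (simp add: r_def)
  have "(\<lambda>n. 1 / qpoch (of_real r) n) \<longlonglongrightarrow> 1 / euler_prod (of_real r)"
    by (intro tendsto_divide tendsto_const euler_prod_nonzero qpoch_LIMSEQ rc)
  then have "Bseq (\<lambda>n. 1 / qpoch (of_real r) n)" using convergentI convergent_imp_Bseq by blast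
  then obtain K where K: "\<And>n. norm (1 / qpoch (of_real r) n) \<le> K" unfolding Bseq_def by auto
  have KN: "infsum (\<lambda>\<mu>. r ^ sum_mset \<mu>) (parts_upto N) \<le> K" for N
  proof -
    have "complex_of_real (1 / (\<Prod>n<N. 1 - r ^ Suc n)) = 1 / qpoch (of_real r) N" by (simp add: qpoch_def)
    then have "1 / (\<Prod>n<N. 1 - r ^ Suc n) \<le> norm (1 / qpoch (of_real r) N)"
      by (metis abs_ge_self norm_of_real)
    then show ?thesis using partition_sum_upto[OF r, of N] K[of N] by simp
  qed
  show "bdd_above (sum (\<lambda>\<mu>. norm (q ^ sum_mset \<mu>)) ` {F. F \<subseteq> {\<mu>. 0 \<notin># \<mu>} \<and> finite F})"
  proof (rule bdd_aboveI2)
    fix F :: "nat multiset set" assume F: "F \<in> {F. F \<subseteq> {\<mu>. 0 \<notin># \<mu>} \<and> finite F}"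
    then obtain N where N: "F \<subseteq> parts_upto N" using parts_upto_finite_subset by blast
    have "(\<lambda>\<mu>. r ^ sum_mset \<mu>) summable_on parts_upto N"
      by (rule abs_summable_summable[OF conjunct1[OF partition_sum_upto[OF r]]])
    then have "sum (\<lambda>\<mu>. r ^ sum_mset \<mu>) F \<le> infsum (\<lambda>\<mu>. r ^ sum_mset \<mu>) (parts_upto N)"
      by (rule finite_sum_le_infsum) (use F N in \<open>auto simp: r_def\<close>)
    then show "sum (\<lambda>\<mu>. norm (q ^ sum_mset \<mu>)) F \<le> K" using KN[of N] by (simp add: norm_power r_def)
  qed
qed simp

text \<open>Restricting to parts at most \<open>N\<close> captures each partition from some
  \<open>N\<close> on, so dominated convergence passes from the finite products to the infinite
  one.\<close>

lemma partition_generating_function: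
  fixes q :: complex
  assumes q: "norm q < 1"
  shows "infsum (\<lambda>\<mu>. q ^ sum_mset \<mu>) {\<mu>. 0 \<notin># \<mu>} = 1 / euler_prod q"
proof (rule LIMSEQ_unique)
  define f where "f = (\<lambda>N \<mu>. if \<mu> \<in> parts_upto N then q ^ sum_mset \<mu> else 0)"
  show "(\<lambda>N. infsum (f N) {\<mu>. 0 \<notin># \<mu>}) \<longlonglongrightarrow> infsum (\<lambda>\<mu>. q ^ sum_mset \<mu>) {\<mu>. 0 \<notin># \<mu>}"
  proof (rule infsum_dominated_tendsto[OF _ _ partition_sum_summable[OF q]])
    fix \<mu> :: "nat multiset" assume "\<mu> \<in> {\<mu>. 0 \<notin># \<mu>}"
    then obtain M where M: "{\<mu>} \<subseteq> parts_upto M" using parts_upto_finite_subset[of "{\<mu>}"] by auto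
    have "f N \<mu> = q ^ sum_mset \<mu>" if "N \<ge> M" for N
      using M that by (auto simp: f_def parts_upto_def)
    then show "(\<lambda>N. f N \<mu>) \<longlonglongrightarrow> q ^ sum_mset \<mu>"
      by (intro tendsto_eventually eventually_sequentiallyI[of M])
  qed (simp add: f_def)
  have "infsum (f N) {\<mu>. 0 \<notin># \<mu>} = 1 / qpoch q N" for N
  proof -
    have "infsum (f N) {\<mu>. 0 \<notin># \<mu>} = infsum (\<lambda>\<mu>. q ^ sum_mset \<mu>) (parts_upto N)"
      by (rule infsum_cong_neutral) (auto simp: f_def parts_upto_def)
    then show ?thesis using partition_sum_upto[OF q, of N] by (simp add: qpoch_def)
  qed
  then show "(\<lambda>N. infsum (f N) {\<mu>. 0 \<notin># \<mu>}) \<longlonglongrightarrow> 1 / euler_prod q"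
    by (simp add: tendsto_divide euler_prod_nonzero[OF q] qpoch_LIMSEQ[OF q])
qed

section \<open>Graded dimensions as theta quotients\<close>

lemma powr_conformal_weight:
  assumes "q \<noteq> 0"
  shows "q powr complex_of_real (conformal_weight k (\<mu>, x)) = q ^ sum_mset \<mu> * q powr complex_of_real (of_int k * x\<^sup>2)"
proof -
  have "complex_of_real (conformal_weight k (\<mu>, x)) = of_nat (sum_mset \<mu>) + complex_of_real (of_int k * x\<^sup>2)"
  proof -
    have "conformal_weight k (\<mu>, x) = real (sum_mset \<mu>) + of_int k * x\<^sup>2"
      by (simp add: conformal_weight_def)
    then show ?thesis by (simp only: of_real_add of_real_of_nat_eq)
  qed
  then have "q powr complex_of_real (conformal_weight k (\<mu>, x)) = q powr of_nat (sum_mset \<mu>) * q powr complex_of_real (of_int k * x\<^sup>2)"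
    by (simp only: powr_add)
  also have "q powr of_nat (sum_mset \<mu>) = q ^ sum_mset \<mu>" by (rule powr_nat') (use assms in simp)
  finally show ?thesis .
qed

lemma fock_labels_product: "fock_labels k r = {\<mu>. 0 \<notin># \<mu>} \<times> {x. x - real_of_int r / real_of_int (2 * k) \<in> \<int>}"
  by (auto simp: fock_labels_def)

lemma bij_coset: "bij_betw (\<lambda>n. real_of_int n + a) UNIV {x. x - a \<in> \<int>}"
  by (rule bij_betwI[where g = "\<lambda>x. \<lfloor>x - a\<rfloor>"]) (auto elim: Ints_cases)

text \<open>The principal logarithm is used so that \<open>q powr w\<close> is exactly
  \<open>exp (2 pi i t w)\<close> with \<open>t = log_nome q\<close>, also for fractional weights
  \<open>w\<close> of individual factors.\<close>

definition log_nome :: "complex \<Rightarrow> complex" where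
  "log_nome q = Ln q / (2 * of_real pi * \<i>)"

lemma log_nome:
  assumes "q \<noteq> 0"
  shows "exp (2 * of_real pi * \<i> * log_nome q) = q" "Im (log_nome q) = - ln (norm q) / (2 * pi)"
proof -
  show "exp (2 * of_real pi * \<i> * log_nome q) = q" using assms by (simp add: log_nome_def)
  have "log_nome q = - \<i> * Ln q / of_real (2 * pi)"
    unfolding log_nome_def by (simp add: field_simps)
  then show "Im (log_nome q) = - ln (norm q) / (2 * pi)"
    using assms by (simp only: Im_divide_of_real) simp
qed

context
  fixes q :: complex and k :: int
  assumes q: "0 < norm q" "norm q < 1" and k: "k > 0"
begin

lemma Im_log_nome_pos: "Im (log_nome q) > 0"
  using q by (subst log_nome(2)) (auto simp: divide_neg_pos)

lemma coset_powr:
  "q powr complex_of_real (of_int k * (real_of_int n + of_int r / of_int (2 * k))\<^sup>2)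
     = thterm (of_int r / (2 * of_int k)) 0 (2 * of_int k * log_nome q) n"
proof -
  have Ln: "Ln q = 2 * of_real pi * \<i> * log_nome q" by (simp add: log_nome_def)
  show ?thesis using q unfolding powr_def thterm_def Ln by (simp add: mult_ac)
qed

lemma coset_sum:
  defines "X \<equiv> \<lambda>r. {x. x - real_of_int r / real_of_int (2 * k) \<in> \<int>}"
  shows "(\<lambda>x. norm (q powr complex_of_real (of_int k * x\<^sup>2))) summable_on X r"
    and "infsum (\<lambda>x. q powr complex_of_real (of_int k * x\<^sup>2)) (X r) = coset_theta k r (log_nome q)"
proof -
  note bij = bij_coset[of "real_of_int r / real_of_int (2 * k)"]
  have t: "Im (2 * of_int k * log_nome q) > 0" using Im_log_nome_pos k by simp
  show "(\<lambda>x. norm (q powr complex_of_real (of_int k * x\<^sup>2))) summable_on X r"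
    unfolding X_def
    by (subst summable_on_reindex_bij_betw[OF bij, symmetric], unfold coset_powr) (rule thterm_abs_summable[OF t])
  show "infsum (\<lambda>x. q powr complex_of_real (of_int k * x\<^sup>2)) (X r) = coset_theta k r (log_nome q)"
    unfolding X_def coset_theta_def theta_def
    by (subst infsum_reindex_bij_betw[OF bij, symmetric], unfold coset_powr) (rule refl)
qed

lemma fock_sum:
  shows "(\<lambda>b. norm (q powr complex_of_real (conformal_weight k b))) summable_on fock_labels k r"
    and "infsum (\<lambda>b. q powr complex_of_real (conformal_weight k b)) (fock_labels k r) = coset_theta k r (log_nome q) / euler_prod q"
proof -
  define f where "f = (\<lambda>\<mu>. q ^ sum_mset \<mu>)"
  define g where "g = (\<lambda>x. q powr complex_of_real (of_int k * x\<^sup>2))"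
  have w: "q powr complex_of_real (conformal_weight k b) = (\<lambda>(\<mu>, x). f \<mu> * g x) b" for b
    using powr_conformal_weight[of q k "fst b" "snd b"] q by (simp add: f_def g_def case_prod_unfold)
  have f: "(\<lambda>\<mu>. norm (f \<mu>)) summable_on {\<mu>. 0 \<notin># \<mu>}" unfolding f_def by (rule partition_sum_summable[OF q(2)])
  have g: "(\<lambda>x. norm (g x)) summable_on {x. x - real_of_int r / real_of_int (2 * k) \<in> \<int>}"
    unfolding g_def by (rule coset_sum(1))
  show "(\<lambda>b. norm (q powr complex_of_real (conformal_weight k b))) summable_on fock_labels k r"
    unfolding w fock_labels_product using summable_on_product[OF f g] by (simp add: norm_mult case_prod_unfold)
  show "infsum (\<lambda>b. q powr complex_of_real (conformal_weight k b)) (fock_labels k r) = coset_theta k r (log_nome q) / euler_prod q"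
    unfolding w fock_labels_product
    by (subst infsum_product[OF f g]) (simp add: f_def g_def partition_generating_function[OF q(2)] coset_sum(2)[simplified])
qed

lemma powr_total_weight:
  "q powr complex_of_real (total_weight k b) = (\<Prod>j\<in>{1..24}. q powr complex_of_real (conformal_weight k (b j)))"
proof -
  have q0: "q \<noteq> 0" using q by auto
  have "q powr complex_of_real (total_weight k b) = exp (\<Sum>j\<in>{1..24}. complex_of_real (conformal_weight k (b j)) * Ln q)"
    using q0 by (simp add: powr_def total_weight_def sum_distrib_right)
  also have "\<dots> = (\<Prod>j\<in>{1..24}. exp (complex_of_real (conformal_weight k (b j)) * Ln q))" by (rule exp_sum) simp
  finally show ?thesis using q0 by (simp add: powr_def)
qed

lemma ch_M_eq: "ch_M k c q = (\<Prod>j\<in>{1..24}. coset_theta k (c j) (log_nome q)) / euler_prod q ^ 24"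
proof -
  define f where "f = (\<lambda>b. q powr complex_of_real (total_weight k b))"
  define B where "B = (\<lambda>w. {b \<in> M_labels k c. total_weight k b = w})"
  have fs: "(\<lambda>b. norm (f b)) summable_on M_labels k c"
    unfolding f_def powr_total_weight prod_norm[symmetric] M_labels_def
    by (rule summable_on_prod_PiE) (auto intro: fock_sum)
  have finB: "finite (B w)" for w
  proof (rule finite_if_constant_summable)
    have "(\<lambda>b. norm (f b)) summable_on B w" by (rule summable_on_subset[OF fs]) (auto simp: B_def)
    then show "(\<lambda>b. norm (q powr complex_of_real w)) summable_on B w"
      by (rule summable_on_cong[THEN iffD1, rotated]) (auto simp: B_def f_def)
    show "norm (q powr complex_of_real w) > 0" using q by auto
  qed
  \<comment> \<open>Each label has exactly one weight, so the sum over labels regroups into fibres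
    over all real \<open>w\<close>, and each fibre contributes its dimension times
    \<open>q powr w\<close>.\<close>
  have bij: "bij_betw snd (Sigma UNIV B) (M_labels k c)"
    by (rule bij_betwI[where g = "\<lambda>b. (total_weight k b, b)"]) (auto simp: B_def)
  have "f summable_on M_labels k c" by (rule abs_summable_summable[OF fs])
  then have "(\<lambda>p. f (snd p)) summable_on Sigma UNIV B"
    by (subst summable_on_reindex_bij_betw[OF bij])
  then have sS: "(\<lambda>(w, b). f b) summable_on Sigma UNIV B" by (simp add: case_prod_unfold)
  have "ch_M k c q = (\<Sum>\<^sub>\<infinity>w. infsum f (B w))"
    unfolding ch_M_def
  proof (rule infsum_cong)
    fix w
    have "infsum f (B w) = (\<Sum>b\<in>B w. q powr complex_of_real w)"
      using finB[of w] by (simp add: f_def B_def)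
    then show "of_nat (vector_space.dim fun_scale (weight_space k c w)) * q powr complex_of_real w = infsum f (B w)"
      using dim_weight_space[of k c w] finB[of w] by (simp add: B_def)
  qed
  also have "\<dots> = infsum (\<lambda>(w, b). f b) (Sigma UNIV B)" by (rule infsum_Sigma'_banach[OF sS])
  also have "\<dots> = infsum f (M_labels k c)"
    using infsum_reindex_bij_betw[OF bij, of f] by (simp add: case_prod_unfold)
  also have "\<dots> = (\<Prod>j\<in>{1..24}. infsum (\<lambda>b. q powr complex_of_real (conformal_weight k b)) (fock_labels k (c j)))"
    unfolding f_def powr_total_weight M_labels_def by (rule infsum_prod_PiE_abs) (auto intro: fock_sum)
  also have "\<dots> = (\<Prod>j\<in>{1..24}. coset_theta k (c j) (log_nome q)) / euler_prod q ^ 24"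
    unfolding fock_sum(2) by (simp add: prod_dividef)
  finally show ?thesis .
qed

end

lemma eta_power24:
  assumes "q \<noteq> 0"
  shows "eta q ^ 24 = q * euler_prod q ^ 24"
proof -
  have "(q powr (1 / 24)) ^ 24 = q"
    using assms by (simp add: powr_def exp_of_nat_mult[symmetric])
  then show ?thesis by (simp add: eta_def euler_prod_def power_mult_distrib)
qed

theorem mainTheorem6:
  fixes k :: int and C :: "(nat \<Rightarrow> int) set" and i :: nat and q :: complex
  assumes "k \<ge> 2" and "odd k"
    and "extremal_type_II_code_24 k C"
    and "i \<in> {1..24}"
    and "0 < norm q" and "norm q < 1"
  shows "eta (q ^ 2) ^ 48 / (eta q ^ 24 * eta (q ^ 4) ^ 24) - 24 =
    inverse q * (1 / 2) * (\<Sum>c\<in>C. (- 1) powi tau i c * ch_M k c q)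
    + 1 / 2 * (eta q ^ 24 / eta (q ^ 2) ^ 24)"
proof -
  have k: "k > 0" using assms(1) by simp
  have q: "q \<noteq> 0" using assms(5) by auto
  define t where "t = log_nome q"
  have t: "Im t > 0" unfolding t_def by (rule Im_log_nome_pos[OF assms(5,6) k])
  have qt: "exp (2 * of_real pi * \<i> * t) = q" unfolding t_def by (rule log_nome(1)[OF q])
  define e1 e2 e4 where "e1 = euler_prod q" and "e2 = euler_prod (q\<^sup>2)" and "e4 = euler_prod (q ^ 4)"
  have e0: "e1 \<noteq> 0" "e2 \<noteq> 0" "e4 \<noteq> 0" using theta_euler_nonzero[OF assms(6)] by (auto simp: e1_def e2_def e4_def)
  have "(\<Sum>c\<in>C. (- 1) powi tau i c * ch_M k c q) = code_theta k C i t / e1 ^ 24"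
    unfolding ch_M_eq[OF assms(5,6) k] code_theta_def sum_divide_distrib by (simp add: e1_def t_def)
  also have "code_theta k C i t = 2 * (e2\<^sup>2 / e4) ^ 24 - (e1\<^sup>2 / e2) ^ 24 - 48 * q * e1 ^ 24"
    using code_theta_eq_ref_form[OF assms(1-4) t] ref_form_products(1)[OF t] by (simp add: qt e1_def e2_def e4_def)
  finally have S: "(\<Sum>c\<in>C. (- 1) powi tau i c * ch_M k c q) = (2 * (e2\<^sup>2 / e4) ^ 24 - (e1\<^sup>2 / e2) ^ 24 - 48 * q * e1 ^ 24) / e1 ^ 24" .
  have eta1: "eta q ^ 24 = q * e1 ^ 24" and eta2: "eta (q ^ 2) ^ 24 = q\<^sup>2 * e2 ^ 24" and eta4: "eta (q ^ 4) ^ 24 = q ^ 4 * e4 ^ 24"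
    using q by (simp_all add: eta_power24 e1_def e2_def e4_def)
  have "eta (q ^ 2) ^ 48 = (eta (q ^ 2) ^ 24)\<^sup>2" by (simp add: power_mult[symmetric])
  then have eta48: "eta (q ^ 2) ^ 48 = (q\<^sup>2 * e2 ^ 24)\<^sup>2" unfolding eta2 .
  \<comment> \<open>With the 24th powers of the three Euler products as free quantities
    \<open>a\<close>, \<open>b\<close>, \<open>d\<close>, what remains of the claim is an identity
    of rational functions.\<close>
  have "(q\<^sup>2 * b)\<^sup>2 / (q * a * (q ^ 4 * d)) - 24 = inverse q * (1 / 2) * ((2 * (b\<^sup>2 / d) - a\<^sup>2 / b - 48 * q * a) / a) + 1 / 2 * (q * a / (q\<^sup>2 * b))"
    if "a \<noteq> 0" "b \<noteq> 0" "d \<noteq> 0" for a b d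
    using that q by (simp add: field_simps power2_eq_square eval_nat_numeral)
  from this[of "e1 ^ 24" "e2 ^ 24" "e4 ^ 24"] show ?thesis
    unfolding S eta48 eta1 eta2 eta4 using e0 by (simp add: power_divide power_mult[symmetric])
qed

end
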